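(* Let $p\in(1,\infty)$ and $q\in[1,\infty]$, and let each of the four sequences $\{a_{mn}^{ij}\}_{m,n=1}^{\infty}$, $i,j\in\{0,1\}$, belong either to $GM^c_1$ or to $GM^c_2$ (definitions below). a) If $\{a_{mn}^{ij}\}_{m,n=1}^{\infty}$, $i,j=0,1$, are the Fourier coefficients of a function $f\in L([-\pi,\pi]^2)$, i.e. $f$ has Fourier series $\sum_{i,j=0}^1\sum_{m,n} a_{mn}^{ij}\sin^{(i)} mx\,\sin^{(j)} ny$, then $$\|f\|_{L_{w(p,q)}^q}^q \gtrsim \sum_{i,j=0}^1\sum_{m,n=1}^{\infty}|a_{mn}^{ij}|^q(mn)^{\frac{q}{p'}-1}.$$ b) If $\sum_{i,j=0}^1\sum_{m,n=1}^{\infty}|a_{mn}^{ij}|^q(mn)^{\frac{q}{p'}-1}<\infty$, then the trigonometric series $\sum_{i,j=0}^1\sum_{m,n} a_{mn}^{ij}\sin^{(i)} mx\,\sin^{(j)} ny$ converges everywhere on $(0,2\pi)^2$ and is the Fourier series of its sum $f$; moreover $$\|f\|_{L_{w(p,q)}^q}^q \lesssim\sum_{i,j=0}^1\sum_{m,n=1}^{\infty}|a_{mn}^{ij}|^q(mn)^{\frac{q}{p'}-1}.$$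
   Context: Here $p'$ is the conjugate exponent, $1/p+1/p'=1$. Notation: $\sin^{(0)}x=\sin x$, $\sin^{(1)}x=\cos x$. Differences: $\Delta^{11}a_{mn}=a_{mn}-a_{m+1,n}-a_{m,n+1}+a_{m+1,n+1}$. A double sequence $\{a_{mn}\}$ belongs to $GM^c_1$ if $a_{mn}\to 0$ as $m+n\to\infty$ and, for all $k,l\in\mathbb{N}$ and some constant $C$ depending only on the sequence, $$\sum_{m=k}^{2k}\sum_{n=l}^{\infty}|\Delta^{11}a_{mn}|+\sum_{m=k}^{\infty}\sum_{n=l}^{2l}|\Delta^{11}a_{mn}|\leq C|a_{kl}|;$$ it belongs to $GM^c_2$ if $a_{mn}\to0$ as $m+n\to\infty$ and the same inequality holds with $|a_{2k,l}|$ in place of $|a_{kl}|$ on the right-hand side. The sequences need not be nonnegative. The weighted norm on $[-\pi,\pi]^2$ is $\|f\|_{L_{w(p,q)}^q}=\Big(\int_{-\pi}^{\pi}\int_{-\pi}^{\pi}|ts|^{\frac{q}{p}-1}|f(t,s)|^q\,dt\,ds\Big)^{1/q}$ for $q<\infty$, and $\operatorname*{ess\,sup}_{(t,s)\in[-\pi,\pi]^2}|(ts)^{1/p}f(t,s)|$ for $q=\infty$ (for $q=\infty$ the sums on the right are read as the corresponding supremum $\sup_{m,n}(mn)^{1/p'}|a^{ij}_{mn}|$). $A\gtrsim B$ means $A\geq cB$ for a constant $c>0$ independent of $f$ and the coefficients (depending on $p,q$ and the $GM^c$ constants). *)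

theory Defs
  imports "HOL-Analysis.Analysis" "HOL-Probability.Essential_Supremum"
begin

text \<open>Index convention: i, j range over {0,1} (as nat, i < 2);
  trig 0 = sin = sin^(0), trig 1 = cos = sin^(1).
  Double sequences are nat => nat => real; only indices m, n >= 1 matter.\<close>

definition trig :: "nat \<Rightarrow> real \<Rightarrow> real" where
  "trig i x = (if i = 0 then sin x else cos x)"

definition Delta11 :: "(nat \<Rightarrow> nat \<Rightarrow> real) \<Rightarrow> nat \<Rightarrow> nat \<Rightarrow> real" where
  "Delta11 a m n = a m n - a (m+1) n - a m (n+1) + a (m+1) (n+1)"

definition tends_to_zero2 :: "(nat \<Rightarrow> nat \<Rightarrow> real) \<Rightarrow> bool" where
  "tends_to_zero2 a \<longleftrightarrow> (\<forall>\<epsilon>>0. \<exists>N. \<forall>m n. 1 \<le> m \<longrightarrow> 1 \<le> n \<longrightarrow> N \<le> m + n \<longrightarrow> \<bar>a m n\<bar> < \<epsilon>)"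

definition GM_lhs :: "(nat \<Rightarrow> nat \<Rightarrow> real) \<Rightarrow> nat \<Rightarrow> nat \<Rightarrow> ennreal" where
  "GM_lhs a k l =
     (\<Sum>m\<in>{k..2*k}. \<Sum>n. ennreal \<bar>Delta11 a m (n + l)\<bar>)
   + (\<Sum>m. \<Sum>n\<in>{l..2*l}. ennreal \<bar>Delta11 a (m + k) n\<bar>)"

definition GMc1_const :: "real \<Rightarrow> (nat \<Rightarrow> nat \<Rightarrow> real) \<Rightarrow> bool" where
  "GMc1_const C a \<longleftrightarrow> tends_to_zero2 a \<and>
     (\<forall>k l. 1 \<le> k \<longrightarrow> 1 \<le> l \<longrightarrow> GM_lhs a k l \<le> ennreal (C * \<bar>a k l\<bar>))"

definition GMc2_const :: "real \<Rightarrow> (nat \<Rightarrow> nat \<Rightarrow> real) \<Rightarrow> bool" where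
  "GMc2_const C a \<longleftrightarrow> tends_to_zero2 a \<and>
     (\<forall>k l. 1 \<le> k \<longrightarrow> 1 \<le> l \<longrightarrow> GM_lhs a k l \<le> ennreal (C * \<bar>a (2*k) l\<bar>))"

definition GMc1 :: "(nat \<Rightarrow> nat \<Rightarrow> real) \<Rightarrow> bool" where
  "GMc1 a \<longleftrightarrow> (\<exists>C. GMc1_const C a)"

definition GMc2 :: "(nat \<Rightarrow> nat \<Rightarrow> real) \<Rightarrow> bool" where
  "GMc2 a \<longleftrightarrow> (\<exists>C. GMc2_const C a)"

definition square :: "(real \<times> real) set" where
  "square = {-pi..pi} \<times> {-pi..pi}"

definition fourier_coeff :: "(real \<times> real \<Rightarrow> real) \<Rightarrow> nat \<Rightarrow> nat \<Rightarrow> nat \<Rightarrow> nat \<Rightarrow> real" where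
  "fourier_coeff f i j m n =
     (LINT z:square|lborel. f z * trig i (real m * fst z) * trig j (real n * snd z)) / pi\<^sup>2"

definition has_fourier_series ::
    "(real \<times> real \<Rightarrow> real) \<Rightarrow> (nat \<Rightarrow> nat \<Rightarrow> nat \<Rightarrow> nat \<Rightarrow> real) \<Rightarrow> bool" where
  "has_fourier_series f a \<longleftrightarrow> set_integrable lborel square f \<and>
     (\<forall>i<2. \<forall>j<2. \<forall>m n. fourier_coeff f i j m n = (if 1 \<le> m \<and> 1 \<le> n then a i j m n else 0))"

definition partial_sum :: "(nat \<Rightarrow> nat \<Rightarrow> nat \<Rightarrow> nat \<Rightarrow> real) \<Rightarrow> nat \<Rightarrow> nat \<Rightarrow> real \<Rightarrow> real \<Rightarrow> real" where
  "partial_sum a M N x y =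
     (\<Sum>i<2. \<Sum>j<2. \<Sum>m=1..M. \<Sum>n=1..N. a i j m n * trig i (real m * x) * trig j (real n * y))"

text \<open>Weighted quantity ||f||^q_{L^q_{w(p,q)}} for finite q, and ||f||_{L^infty_{w(p,infty)}} for q = infinity.\<close>
definition wnorm_pow :: "real \<Rightarrow> ereal \<Rightarrow> (real \<times> real \<Rightarrow> real) \<Rightarrow> ereal" where
  "wnorm_pow p q f =
    (if q = \<infinity> then
       esssup (restrict_space lborel square) (\<lambda>z. ereal (\<bar>fst z * snd z\<bar> powr (1/p) * \<bar>f z\<bar>))
     else enn2ereal (\<integral>\<^sup>+ z\<in>square. ennreal (\<bar>fst z * snd z\<bar> powr (real_of_ereal q / p - 1)
                                               * \<bar>f z\<bar> powr real_of_ereal q) \<partial>lborel))"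

definition conj_exp :: "real \<Rightarrow> real" where
  "conj_exp p = p / (p - 1)"

definition coeff_sum :: "real \<Rightarrow> ereal \<Rightarrow> (nat \<Rightarrow> nat \<Rightarrow> nat \<Rightarrow> nat \<Rightarrow> real) \<Rightarrow> ereal" where
  "coeff_sum p q a =
    (if q = \<infinity> then
       (\<Sum>i<2. \<Sum>j<2. SUP mn\<in>{1..}\<times>{1..}.
          ereal ((real (fst mn) * real (snd mn)) powr (1 / conj_exp p) * \<bar>a i j (fst mn) (snd mn)\<bar>))
     else enn2ereal (\<Sum>i<2. \<Sum>j<2. \<Sum>m. \<Sum>n.
          ennreal (\<bar>a i j (Suc m) (Suc n)\<bar> powr real_of_ereal q
                   * (real (Suc m) * real (Suc n)) powr (real_of_ereal q / conj_exp p - 1))))"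

end

theory Submission
  imports Defs
begin

text \<open>Everything is measured on dyadic blocks. On a block, the mixed variation of a general monotone
  sequence is bounded by a single corner coefficient, and the trigonometric sums are bounded by
  \<open>2\<^sup>I min(1, \<pi> / (2\<^sup>I |t|))\<close> in each variable. The two directions are then dual to each other: testing
  \<open>f\<close> against block Dirichlet kernels bounds block sums of coefficients by means of \<open>|f|\<close> against
  these kernels, and summation by parts bounds the partial sums by the same kernels summed against
  the block variations. One Schur test, with power weights in both variables, transports these
  estimates to the weighted norms.

  Since the coefficients may change sign, a block sum need not control the corner coefficient. A
  subblock of small relative size has small oscillation, so it does control it up to a small multiple
  of a neighbouring dyadic corner; this multiple is absorbed after summation over all blocks.\<close>

section \<open>Dyadic blocks and Dirichlet kernels\<close>

text \<open>Only four kernel estimates enter: integrals of the kernel against |t|^(-g) and sums of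
  it against 2^(I g), for g = 1/p and g = 1 - 1/p. They require 0 < g < 1, which is how 1 < p <
  \<infinity> is used. The absorption has no finite quantity to start from. In the second class the
  neighbouring corner lies one dyadic step further out in the first variable, so a truncated sum is
  bounded by a small multiple of a larger truncated sum, and so on without end. Boundedness of the
  coefficients limits the growth of these sums to a fixed geometric rate, and the fineness of the
  subdivision is chosen against that rate. The resulting constants depend on p, q and C only and are
  fixed before any sequence is introduced. Both classes are treated at once through an exponent
  \<open>e\<close> in {0, 1}: the controlling coefficient is the one at (2^e k, l). The case q = 1
  needs no separate treatment in the Schur test because Jensen's inequality enters through a
  tangent; q = \<infinity> is a pointwise variant that bypasses the test.\<close>

definition dyadic :: "nat \<Rightarrow> nat set" where
  "dyadic I = {2 ^ I..<2 ^ Suc I}"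

lemma finite_dyadic [simp]: "finite (dyadic I)"
  by (simp add: dyadic_def)

lemma card_dyadic [simp]: "card (dyadic I) = 2 ^ I"
  by (simp add: dyadic_def)

lemma sum_dyadic_blocks:
  fixes h :: "nat \<Rightarrow> 'a::comm_monoid_add"
  shows "(\<Sum>I<K. \<Sum>m\<in>dyadic I. h m) = (\<Sum>m=1..<2 ^ K. h m)"
proof (induction K)
  case (Suc K)
  have "(\<Sum>m=1..<2 ^ Suc K. h m) = (\<Sum>m=1..<2 ^ K. h m) + (\<Sum>m=2 ^ K..<2 ^ Suc K. h m)"
    by (rule sum.atLeastLessThan_concat [symmetric]) auto
  with Suc show ?case by (simp add: dyadic_def)
qed simp

text \<open>The terms are nonnegative and the initial segments ending at powers of two are cofinal
  among all initial segments, so both suprema agree.\<close>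

lemma suminf_dyadic:
  fixes h :: "nat \<Rightarrow> ennreal"
  shows "(\<Sum>m. h (Suc m)) = (\<Sum>I. \<Sum>m\<in>dyadic I. h m)"
proof -
  have shift: "(\<Sum>m<n. h (Suc m)) = (\<Sum>m=1..<Suc n. h m)" for n
    by (simp add: sum.atLeast1_atMost_eq atLeastLessThanSuc_atLeastAtMost)
  have "(SUP n. \<Sum>m=1..<Suc n. h m) = (SUP K. \<Sum>m=1..<2 ^ K. h m)"
  proof (rule antisym; rule SUP_least)
    fix n :: nat
    have "Suc n \<le> 2 ^ n" by (induction n) auto
    then have "(\<Sum>m=1..<Suc n. h m) \<le> (\<Sum>m=1..<2 ^ n. h m)"
      by (intro sum_mono2) auto
    then show "(\<Sum>m=1..<Suc n. h m) \<le> (SUP K. \<Sum>m=1..<2 ^ K. h m)"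
      by (rule SUP_upper2 [rotated]) simp
  next
    fix K :: nat
    have "(\<Sum>m=1..<2 ^ K. h m) \<le> (\<Sum>m=1..<Suc (2 ^ K). h m)"
      by (intro sum_mono2) auto
    then show "(\<Sum>m=1..<2 ^ K. h m) \<le> (SUP n. \<Sum>m=1..<Suc n. h m)"
      by (rule SUP_upper2 [rotated]) simp
  qed
  then show ?thesis
    by (simp only: suminf_eq_SUP shift sum_dyadic_blocks)
qed

text \<open>At \<open>t = 0\<close> the value is the junk value \<open>0\<close>, on a null set.\<close>

definition dker :: "nat \<Rightarrow> real \<Rightarrow> real" where
  "dker I t = min 1 (pi / (2 ^ I * \<bar>t\<bar>))"

lemma dker_nonneg [simp]: "0 \<le> dker I t"
  by (simp add: dker_def)

lemma dker_le_1: "dker I t \<le> 1"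
  by (simp add: dker_def)

lemma borel_measurable_dker [measurable]: "dker I \<in> borel_measurable borel"
  unfolding dker_def by measurable

section \<open>Integrals and dyadic sums of the one-variable kernel against powers\<close>

lemma nn_integral_truncated_powr_finite:
  fixes g :: real
  assumes "0 < g" "g < 1"
  shows "(\<integral>\<^sup>+t. ennreal (min 1 (pi / \<bar>t\<bar>) * \<bar>t\<bar> powr - g) \<partial>lborel) < \<infinity>"
proof -
  \<comment> \<open>\<open>G\<close> serves the positive half-line: the minimum is replaced by
    \<open>1\<close> up to \<open>1\<close> and by \<open>pi / t\<close> beyond, so
    \<open>g < 1\<close> gives integrability at zero and \<open>g > 0\<close> at infinity.
    \<open>G (- t)\<close> serves the other half-line.\<close>
  define G where "G t = ennreal (t powr - g) * indicator {0..1} t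
      + ennreal (t powr (- g - 1)) * indicator {1..} t * ennreal pi" for t :: real
  have [measurable]: "G \<in> borel_measurable borel"
    unfolding G_def by measurable
  have i1: "(\<integral>\<^sup>+t. ennreal (t powr - g) * indicator {0..1} t \<partial>lborel) < \<infinity>"
    by (subst nn_integral_has_integral_lebesgue' [OF _ has_integral_powr_from_0]) (use assms in auto)
  have i2: "(\<integral>\<^sup>+t. ennreal (t powr (- g - 1)) * indicator {1..} t \<partial>lborel) < \<infinity>"
    by (subst nn_integral_has_integral_lebesgue' [OF _ has_integral_powr_to_inf]) (use assms in auto)
  have iG: "integral\<^sup>N lborel G < \<infinity>"
    unfolding G_def using i1 i2
    by (subst nn_integral_add) (auto simp: nn_integral_multc ennreal_mult_less_top)
  have "integral\<^sup>N lborel G = (\<integral>\<^sup>+t. G (- t) \<partial>lborel)"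
    by (subst nn_integral_real_affine [where c = "-1" and t = 0]) auto
  then have fin: "(\<integral>\<^sup>+t. G t + G (- t) \<partial>lborel) < \<infinity>"
    using iG by (subst nn_integral_add) auto
  have le: "ennreal (min 1 (pi / \<bar>t\<bar>) * \<bar>t\<bar> powr - g) \<le> G t + G (- t)" for t
  proof -
    have *: "ennreal (min 1 (pi / t) * t powr - g) \<le> G t" if "0 < t" for t
    proof (cases "t \<le> 1")
      case True
      then have "ennreal (min 1 (pi / t) * t powr - g) \<le> ennreal (t powr - g)"
        by (intro ennreal_leI mult_left_le_one_le) (use that in auto)
      also have "\<dots> \<le> G t"
        using True that by (simp add: G_def)
      finally show ?thesis .
    next
      case False
      have "min 1 (pi / t) * t powr - g \<le> pi / t * t powr - g"
        by (intro mult_right_mono) auto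
      also have "\<dots> = t powr (- g - 1) * pi"
        using that by (simp add: powr_diff)
      finally show ?thesis using False that
        by (simp add: G_def ennreal_mult [symmetric] ennreal_leI)
    qed
    show ?thesis
      using * [of t] * [of "- t"]
      by (cases t "0::real" rule: linorder_cases) (auto simp: add_increasing add_increasing2)
  qed
  have "(\<integral>\<^sup>+t. ennreal (min 1 (pi / \<bar>t\<bar>) * \<bar>t\<bar> powr - g) \<partial>lborel)
      \<le> (\<integral>\<^sup>+t. G t + G (- t) \<partial>lborel)"
    by (rule nn_integral_mono) (rule le)
  then show ?thesis using fin by (rule le_less_trans)
qed

text \<open>The substitution of \<open>t / 2 ^ I\<close> for \<open>t\<close> removes the scale from
  the kernel; the powers of \<open>2 ^ I\<close> come from the Jacobian and from the weight.\<close>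

lemma dker_integral_bound:
  fixes g :: real
  assumes "0 < g" "g < 1"
  obtains c where "0 < c"
    "\<And>I. (\<integral>\<^sup>+t. ennreal (dker I t * \<bar>t\<bar> powr - g) \<partial>lborel) \<le> ennreal (c * (2 ^ I) powr (g - 1))"
proof -
  define F where "F t = ennreal (min 1 (pi / \<bar>t\<bar>) * \<bar>t\<bar> powr - g)" for t :: real
  have [measurable]: "F \<in> borel_measurable borel"
    unfolding F_def by measurable
  \<comment> \<open>Adding \<open>1\<close> makes the constant positive without evaluating the
    integral.\<close>
  define c where "c = enn2real (integral\<^sup>N lborel F) + 1"
  have "0 < c"
    unfolding c_def by (intro add_nonneg_pos) auto
  have "integral\<^sup>N lborel F < \<infinity>"
    unfolding F_def using assms by (rule nn_integral_truncated_powr_finite)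
  then have "integral\<^sup>N lborel F = ennreal (enn2real (integral\<^sup>N lborel F))"
    by simp
  also have "\<dots> \<le> ennreal c"
    unfolding c_def by (intro ennreal_leI) simp
  finally have c: "integral\<^sup>N lborel F \<le> ennreal c" .
  have "(\<integral>\<^sup>+t. ennreal (dker I t * \<bar>t\<bar> powr - g) \<partial>lborel) \<le> ennreal (c * (2 ^ I) powr (g - 1))" for I
  proof -
    have "(\<integral>\<^sup>+t. ennreal (dker I t * \<bar>t\<bar> powr - g) \<partial>lborel)
        = ennreal \<bar>1 / 2 ^ I\<bar> * (\<integral>\<^sup>+t. ennreal (dker I (0 + 1 / 2 ^ I * t) * \<bar>0 + 1 / 2 ^ I * t\<bar> powr - g) \<partial>lborel)"
      by (rule nn_integral_real_affine) auto
    also have "(\<integral>\<^sup>+t. ennreal (dker I (0 + 1 / 2 ^ I * t) * \<bar>0 + 1 / 2 ^ I * t\<bar> powr - g) \<partial>lborel)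
        = (\<integral>\<^sup>+t. ennreal ((2 ^ I) powr g) * F t \<partial>lborel)"
      by (intro nn_integral_cong)
        (simp add: F_def dker_def abs_mult powr_divide powr_minus_divide ennreal_mult [symmetric] mult_ac)
    also have "\<dots> = ennreal ((2 ^ I) powr g) * integral\<^sup>N lborel F"
      by (rule nn_integral_cmult) auto
    also have "ennreal \<bar>1 / 2 ^ I\<bar> * \<dots> \<le> ennreal \<bar>1 / 2 ^ I\<bar> * (ennreal ((2 ^ I) powr g) * ennreal c)"
      by (intro mult_left_mono c) auto
    also have "\<dots> = ennreal (c * (2 ^ I) powr (g - 1))"
      using \<open>0 < c\<close> by (simp add: ennreal_mult [symmetric] powr_diff)
    finally show ?thesis .
  qed
  with \<open>0 < c\<close> show thesis by (rule that)
qed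

lemma pow2_powr: "(2 ^ I) powr (g::real) = (2 powr g) ^ I"
proof -
  have "(2 ^ I) powr g = (2 powr real I) powr g" by (simp add: powr_realpow)
  also have "\<dots> = (2 powr g) powr real I" by (simp only: powr_powr mult.commute)
  also have "\<dots> = (2 powr g) ^ I" by (simp add: powr_realpow)
  finally show ?thesis .
qed

text \<open>A growing geometric sum is dominated by its last term. Induction on \<open>K\<close>:
  either \<open>2 ^ K\<close> exceeds \<open>y\<close> and the index set does not change, or all
  indices up to \<open>K\<close> qualify and the closed form applies.\<close>

lemma geometric_sum_below:
  fixes g y :: real
  assumes "0 < g" "0 < y"
  shows "(\<Sum>I\<in>{I. I < K \<and> 2 ^ I \<le> y}. (2 ^ I) powr g) \<le> 2 powr g / (2 powr g - 1) * y powr g"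
proof (induction K)
  case 0
  then show ?case using assms by (simp add: ge_one_powr_ge_zero)
next
  case (Suc K)
  define b where "b = 2 powr g"
  have b: "b > 1" using assms by (simp add: b_def)
  have pw: "(2 ^ I) powr g = b ^ I" for I
    unfolding b_def by (rule pow2_powr)
  show ?case
  proof (cases "2 ^ K \<le> y")
    case False
    then have "{I. I < Suc K \<and> 2 ^ I \<le> y} = {I. I < K \<and> 2 ^ I \<le> y}"
      by (auto simp: less_Suc_eq)
    with Suc show ?thesis by simp
  next
    case True
    have "{I. I < Suc K \<and> 2 ^ I \<le> y} = {..<Suc K}"
    proof (intro set_eqI iffI)
      fix I assume "I \<in> {..<Suc K}"
      then have "(2::real) ^ I \<le> 2 ^ K" by (intro power_increasing) auto
      also note True
      finally show "I \<in> {I. I < Suc K \<and> 2 ^ I \<le> y}" using \<open>I \<in> {..<Suc K}\<close> by auto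
    qed auto
    then have "(\<Sum>I\<in>{I. I < Suc K \<and> 2 ^ I \<le> y}. (2 ^ I) powr g) = (b ^ Suc K - 1) / (b - 1)"
      using b by (simp add: pw sum_gp_strict del: sum.lessThan_Suc power_Suc) (simp add: field_simps)
    also have "\<dots> \<le> b / (b - 1) * b ^ K"
      using b by (simp add: field_simps)
    also have "\<dots> \<le> b / (b - 1) * y powr g"
      using b True assms by (intro mult_left_mono) (auto simp: pw [symmetric] intro!: powr_mono2)
    finally show ?thesis by (simp add: b_def)
  qed
qed

text \<open>A decaying geometric sum is dominated by its first term, here at the least
  \<open>n\<close> with \<open>y < 2 ^ n\<close>; a negative exponent gives
  \<open>(2 ^ n) powr g \<le> y powr g\<close>.\<close>

lemma geometric_sum_above:
  fixes g y :: real
  assumes "g < 0" "0 < y"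
  shows "(\<Sum>I\<in>{I. I < K \<and> y < 2 ^ I}. (2 ^ I) powr g) \<le> 1 / (1 - 2 powr g) * y powr g"
proof -
  define b where "b = 2 powr g"
  have b: "0 < b" "b < 1" using assms by (auto simp: b_def intro: powr_less_one)
  have pw: "(2 ^ I) powr g = b ^ I" for I
    unfolding b_def by (rule pow2_powr)
  define n where "n = (LEAST I. y < 2 ^ I)"
  obtain I0 :: nat where "y < 2 ^ I0" using real_arch_pow [of 2 y] by auto
  then have n: "y < 2 ^ n" unfolding n_def by (rule LeastI)
  have "{I. I < K \<and> y < 2 ^ I} \<subseteq> {n..<n + K}"
    unfolding n_def by (auto intro: Least_le)
  then have "(\<Sum>I\<in>{I. I < K \<and> y < 2 ^ I}. (2 ^ I) powr g) \<le> (\<Sum>I=n..<n + K. b ^ I)"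
    unfolding pw using b by (intro sum_mono2) auto
  also have "\<dots> = (\<Sum>I<K. b ^ (I + n))"
    using sum.shift_bounds_nat_ivl [of "\<lambda>I. b ^ I" 0 n K] by (simp add: lessThan_atLeast0 add.commute)
  also have "\<dots> = (\<Sum>I<K. b ^ I) * b ^ n"
    by (simp add: power_add sum_distrib_right)
  also have "\<dots> \<le> 1 / (1 - b) * b ^ n"
    using b by (intro mult_right_mono) (auto simp: sum_gp_strict field_simps)
  also have "b ^ n \<le> y powr g"
    unfolding pw [symmetric] using n assms by (intro powr_mono2') auto
  finally show ?thesis using b
    by (simp add: b_def divide_right_mono)
qed

text \<open>The kernel changes regime at \<open>2 ^ I = pi / |t|\<close>. Below this threshold it is
  bounded by one and the exponent is \<open>g > 0\<close>; above it the decay lowers the exponent to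
  \<open>g - 1 < 0\<close>. Both geometric sums are governed by the threshold.\<close>

lemma dker_sum_bound:
  fixes g :: real
  assumes "0 < g" "g < 1"
  obtains c where "0 < c"
    "\<And>t. t \<noteq> 0 \<Longrightarrow> (\<Sum>I. ennreal (dker I t * (2 ^ I) powr g)) \<le> ennreal (c * \<bar>t\<bar> powr - g)"
proof -
  define c1 c2 :: real where "c1 = 2 powr g / (2 powr g - 1)" and "c2 = 1 / (1 - 2 powr (g - 1))"
  have c: "0 < c1" "0 < c2"
    using assms by (auto simp: c1_def c2_def intro!: powr_less_one)
  define c where "c = (c1 + c2) * pi powr g"
  have "(\<Sum>I. ennreal (dker I t * (2 ^ I) powr g)) \<le> ennreal (c * \<bar>t\<bar> powr - g)" if "t \<noteq> 0" for t
  proof (rule suminf_le_const)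
    fix K
    define y where "y = pi / \<bar>t\<bar>"
    have y: "0 < y" using that by (simp add: y_def)
    have dk: "dker I t = min 1 (y / 2 ^ I)" for I
      by (simp add: dker_def y_def mult.commute)
    have "(\<Sum>I<K. dker I t * (2 ^ I) powr g)
        = (\<Sum>I\<in>{I. I < K \<and> 2 ^ I \<le> y}. dker I t * (2 ^ I) powr g)
          + (\<Sum>I\<in>{I. I < K \<and> y < 2 ^ I}. dker I t * (2 ^ I) powr g)"
      by (subst sum.union_disjoint [symmetric]) (auto intro!: sum.cong)
    also have "(\<Sum>I\<in>{I. I < K \<and> 2 ^ I \<le> y}. dker I t * (2 ^ I) powr g)
        \<le> (\<Sum>I\<in>{I. I < K \<and> 2 ^ I \<le> y}. (2 ^ I) powr g)"
      by (intro sum_mono mult_left_le_one_le) (auto intro: dker_le_1)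
    also have "\<dots> \<le> c1 * y powr g"
      unfolding c1_def using assms y by (intro geometric_sum_below) auto
    also have "(\<Sum>I\<in>{I. I < K \<and> y < 2 ^ I}. dker I t * (2 ^ I) powr g)
        \<le> (\<Sum>I\<in>{I. I < K \<and> y < 2 ^ I}. y * (2 ^ I) powr (g - 1))"
    proof (intro sum_mono)
      fix I
      have "dker I t * (2 ^ I) powr g \<le> y / 2 ^ I * (2 ^ I) powr g"
        unfolding dk by (intro mult_right_mono) auto
      then show "dker I t * (2 ^ I) powr g \<le> y * (2 ^ I) powr (g - 1)"
        by (simp add: powr_diff)
    qed
    also have "\<dots> \<le> y * (c2 * y powr (g - 1))"
      unfolding c2_def sum_distrib_left [symmetric] using assms y
      by (intro mult_left_mono geometric_sum_above) auto
    also have "\<dots> = c2 * y powr g"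
      using y by (simp add: powr_diff)
    finally have "(\<Sum>I<K. dker I t * (2 ^ I) powr g) \<le> (c1 + c2) * y powr g"
      by (simp add: algebra_simps)
    also have "\<dots> = c * \<bar>t\<bar> powr - g"
      using that by (simp add: c_def y_def powr_divide powr_minus_divide)
    finally show "(\<Sum>I<K. ennreal (dker I t * (2 ^ I) powr g)) \<le> ennreal (c * \<bar>t\<bar> powr - g)"
      by (subst sum_ennreal) (auto intro: ennreal_leI)
  qed auto
  moreover have "0 < c"
    unfolding c_def using c by (intro mult_pos_pos add_pos_pos) auto
  ultimately show thesis by (rule that [rotated])
qed

section \<open>Trigonometric sums bounded by the kernel\<close>

lemma jordan_inequality:
  fixes x :: real
  assumes "0 \<le> x" "x \<le> pi / 2"
  shows "2 / pi * x \<le> sin x"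
proof -
  have "concave_on {0..pi/2} sin"
  proof (rule f''_le0_imp_concave)
    show "\<And>x. x \<in> {0..pi/2} \<Longrightarrow> (sin has_real_derivative cos x) (at x)"
      "\<And>x. x \<in> {0..pi/2} \<Longrightarrow> (cos has_real_derivative - sin x) (at x)"
      by (auto intro!: derivative_eq_intros)
  qed (auto intro!: sin_ge_zero)
  from concave_onD [OF this, of "2 / pi * x" 0 "pi / 2"] show ?thesis
    using assms by (auto simp: field_simps)
qed

lemma trig_le_1: "\<bar>trig i x\<bar> \<le> 1"
  by (simp add: trig_def)

text \<open>The half-angle sine turns each term into a difference at neighbouring half-integer
  frequencies, which telescopes. Keeping the sine as a factor makes the identity valid where it
  vanishes.\<close>

lemma trig_sum_closed_form:
  "2 * sin (t / 2) * (\<Sum>m=m0..<m0 + r. trig i (real m * t))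
    = (if i = 0 then cos ((real m0 - 1/2) * t) - cos ((real (m0 + r) - 1/2) * t)
       else sin ((real (m0 + r) - 1/2) * t) - sin ((real m0 - 1/2) * t))"
proof (induction r)
  case (Suc r)
  define u where "u = real (m0 + r) * t"
  have e: "(real (m0 + r) - 1/2) * t = u - t / 2" "(real (m0 + Suc r) - 1/2) * t = u + t / 2"
    by (simp_all add: u_def algebra_simps)
  have "2 * sin (t / 2) * (\<Sum>m=m0..<m0 + Suc r. trig i (real m * t))
    = 2 * sin (t / 2) * (\<Sum>m=m0..<m0 + r. trig i (real m * t)) + 2 * sin (t / 2) * trig i u"
    by (simp add: algebra_simps u_def)
  then show ?case
    unfolding Suc e by (auto simp: trig_def cos_add cos_diff sin_add sin_diff)
qed simp

lemma trig_sum_le_sin: "\<bar>sin (t / 2)\<bar> * \<bar>\<Sum>m=m0..<m0 + r. trig i (real m * t)\<bar> \<le> 1"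
proof -
  have "\<bar>u - v\<bar> \<le> 2" if "\<bar>u\<bar> \<le> 1" "\<bar>v\<bar> \<le> 1" for u v :: real
    using that by linarith
  then have "\<bar>2 * sin (t / 2) * (\<Sum>m=m0..<m0 + r. trig i (real m * t))\<bar> \<le> 2"
    unfolding trig_sum_closed_form by simp
  then show ?thesis by (simp add: abs_mult)
qed

lemma trig_sum_le_card: "\<bar>\<Sum>m=m0..<m0 + r. trig i (real m * t)\<bar> \<le> real r"
  using sum_norm_bound [of "{m0..<m0 + r}" "\<lambda>m. trig i (real m * t)" 1] trig_le_1 by simp

text \<open>Two bounds compete: the number of terms, and \<open>pi / |t|\<close> from the half-angle
  sine, which Jordan's inequality bounds below by \<open>|t| / pi\<close>. Only the length of the
  range matters, not its position.\<close>

lemma trig_sum_le_dker: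
  assumes "\<bar>t\<bar> \<le> pi" "t \<noteq> 0" "r \<le> 2 ^ I"
  shows "\<bar>\<Sum>m=m0..<m0 + r. trig i (real m * t)\<bar> \<le> 2 ^ I * dker I t"
proof -
  let ?S = "\<bar>\<Sum>m=m0..<m0 + r. trig i (real m * t)\<bar>"
  have "2 / pi * (\<bar>t\<bar> / 2) \<le> sin (\<bar>t\<bar> / 2)"
    using assms by (intro jordan_inequality) auto
  also have "sin (\<bar>t\<bar> / 2) \<le> \<bar>sin (t / 2)\<bar>"
    by (cases "t \<ge> 0") (auto simp: abs_if)
  finally have "\<bar>t\<bar> / pi * ?S \<le> \<bar>sin (t / 2)\<bar> * ?S"
    by (intro mult_right_mono) auto
  also have "\<dots> \<le> 1" by (rule trig_sum_le_sin)
  finally have "?S \<le> pi / \<bar>t\<bar>"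
    using assms by (simp add: field_simps)
  moreover have "?S \<le> 2 ^ I"
  proof -
    have "real r \<le> 2 ^ I" using assms(3) of_nat_le_iff [of r "2 ^ I", where ?'a = real] by simp
    then show ?thesis using trig_sum_le_card [of i t m0 r] by linarith
  qed
  ultimately have "?S \<le> min (2 ^ I) (pi / \<bar>t\<bar>)" by simp
  also have "\<dots> = 2 ^ I * dker I t"
    using assms by (simp add: dker_def min_def field_simps)
  finally show ?thesis .
qed

section \<open>Kernel estimates and a Schur test\<close>

text \<open>The cardinality of \<open>dyadic I \<times> dyadic J\<close>, hence the natural scale of
  the product kernel.\<close>

definition dscale :: "nat \<times> nat \<Rightarrow> real" where
  "dscale x = 2 ^ fst x * 2 ^ snd x"

definition dker2 :: "nat \<times> nat \<Rightarrow> real \<times> real \<Rightarrow> real" where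
  "dker2 x z = dker (fst x) (fst z) * dker (snd x) (snd z)"

lemma dscale_pos [simp]: "0 < dscale x"
  by (simp add: dscale_def)

lemma dscale_nonneg [simp]: "0 \<le> dscale x" and dscale_nonzero [simp]: "dscale x \<noteq> 0"
  by (simp_all add: dscale_def)

lemma dker2_nonneg [simp]: "0 \<le> dker2 x z"
  by (simp add: dker2_def)

lemma dker2_le_1: "dker2 x z \<le> 1"
  by (simp add: dker2_def mult_le_one dker_le_1)

lemma borel_measurable_dker2 [measurable]: "dker2 x \<in> borel_measurable borel"
proof -
  have "dker2 x \<in> borel_measurable (borel \<Otimes>\<^sub>M borel)"
    unfolding dker2_def by measurable
  then show ?thesis by (simp add: borel_prod)
qed

abbreviation psum :: "(nat \<times> nat \<Rightarrow> real) \<Rightarrow> ennreal" where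
  "psum f \<equiv> \<integral>\<^sup>+x. ennreal (f x) \<partial>count_space UNIV"

abbreviation pint :: "(real \<times> real \<Rightarrow> real) \<Rightarrow> ennreal" where
  "pint f \<equiv> \<integral>\<^sup>+z. ennreal (f z) \<partial>lborel"

abbreviation absprod :: "real \<times> real \<Rightarrow> real" where
  "absprod z \<equiv> \<bar>fst z * snd z\<bar>"

lemma nn_integral_lborel_mult:
  fixes f g :: "real \<Rightarrow> ennreal"
  assumes [measurable]: "f \<in> borel_measurable borel" "g \<in> borel_measurable borel"
  shows "(\<integral>\<^sup>+z. f (fst z) * g (snd z) \<partial>lborel) = integral\<^sup>N lborel f * integral\<^sup>N lborel g"
proof -
  have "(\<integral>\<^sup>+z. f (fst z) * g (snd z) \<partial>lborel) = (\<integral>\<^sup>+z. f (fst z) * g (snd z) \<partial>(lborel \<Otimes>\<^sub>M lborel))"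
    by (simp add: lborel_prod)
  also have "\<dots> = (\<integral>\<^sup>+t. \<integral>\<^sup>+s. f t * g s \<partial>lborel \<partial>lborel)"
    by (subst lborel.nn_integral_fst [symmetric]) auto
  also have "\<dots> = integral\<^sup>N lborel f * integral\<^sup>N lborel g"
    by (simp add: nn_integral_cmult nn_integral_multc)
  finally show ?thesis .
qed

lemma nn_integral_nat_pair:
  fixes f :: "nat \<times> nat \<Rightarrow> ennreal"
  shows "(\<integral>\<^sup>+x. f x \<partial>count_space UNIV) = (\<Sum>I. \<Sum>J. f (I, J))"
  by (simp add: nn_integral_fst_count_space [symmetric] nn_integral_count_space_nat)

lemma nn_integral_nat_pair_mult:
  fixes f g :: "nat \<Rightarrow> ennreal"
  shows "(\<integral>\<^sup>+x. f (fst x) * g (snd x) \<partial>count_space UNIV) = suminf f * suminf g"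
  by (simp add: nn_integral_fst_count_space [symmetric] nn_integral_cmult nn_integral_multc
      nn_integral_count_space_nat)

lemma dker2_integral_bound:
  fixes g :: real
  assumes "0 < g" "g < 1"
  obtains c where "0 < c"
    "\<And>x. pint (\<lambda>z. dker2 x z * absprod z powr - g) \<le> ennreal (c * dscale x powr (g - 1))"
proof -
  obtain c where c: "0 < c"
    "\<And>I. (\<integral>\<^sup>+t. ennreal (dker I t * \<bar>t\<bar> powr - g) \<partial>lborel) \<le> ennreal (c * (2 ^ I) powr (g - 1))"
    using dker_integral_bound [OF assms] by blast
  have "pint (\<lambda>z. dker2 x z * absprod z powr - g)
      \<le> ennreal (c * c * dscale x powr (g - 1))" for x
  proof -
    have "pint (\<lambda>z. dker2 x z * absprod z powr - g)
      = (\<integral>\<^sup>+z. ennreal (dker (fst x) (fst z) * \<bar>fst z\<bar> powr - g) * ennreal (dker (snd x) (snd z) * \<bar>snd z\<bar> powr - g) \<partial>lborel)"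
      by (intro nn_integral_cong)
        (simp add: dker2_def abs_mult powr_mult ennreal_mult [symmetric] mult_ac)
    also have "\<dots> = (\<integral>\<^sup>+t. ennreal (dker (fst x) t * \<bar>t\<bar> powr - g) \<partial>lborel)
        * (\<integral>\<^sup>+t. ennreal (dker (snd x) t * \<bar>t\<bar> powr - g) \<partial>lborel)"
      by (rule nn_integral_lborel_mult) auto
    also have "\<dots> \<le> ennreal (c * (2 ^ fst x) powr (g - 1)) * ennreal (c * (2 ^ snd x) powr (g - 1))"
      by (intro mult_mono c) auto
    also have "\<dots> = ennreal (c * c * dscale x powr (g - 1))"
      using c by (simp add: dscale_def powr_mult ennreal_mult [symmetric] mult_ac)
    finally show ?thesis .
  qed
  moreover have "0 < c * c" using c by simp
  ultimately show thesis by (rule that [rotated])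
qed

lemma dker2_sum_bound:
  fixes g :: real
  assumes "0 < g" "g < 1"
  obtains c where "0 < c"
    "\<And>z. fst z \<noteq> 0 \<Longrightarrow> snd z \<noteq> 0 \<Longrightarrow>
       psum (\<lambda>x. dker2 x z * dscale x powr g) \<le> ennreal (c * absprod z powr - g)"
proof -
  obtain c where c: "0 < c"
    "\<And>t. t \<noteq> 0 \<Longrightarrow> (\<Sum>I. ennreal (dker I t * (2 ^ I) powr g)) \<le> ennreal (c * \<bar>t\<bar> powr - g)"
    using dker_sum_bound [OF assms] by blast
  have "psum (\<lambda>x. dker2 x z * dscale x powr g)
      \<le> ennreal (c * c * absprod z powr - g)" if "fst z \<noteq> 0" "snd z \<noteq> 0" for z
  proof -
    have "psum (\<lambda>x. dker2 x z * dscale x powr g)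
      = (\<integral>\<^sup>+x. ennreal (dker (fst x) (fst z) * (2 ^ fst x) powr g) * ennreal (dker (snd x) (snd z) * (2 ^ snd x) powr g) \<partial>count_space UNIV)"
      by (intro nn_integral_cong)
        (simp add: dker2_def dscale_def powr_mult ennreal_mult [symmetric] mult_ac)
    also have "\<dots> = (\<Sum>I. ennreal (dker I (fst z) * (2 ^ I) powr g)) * (\<Sum>I. ennreal (dker I (snd z) * (2 ^ I) powr g))"
      by (rule nn_integral_nat_pair_mult)
    also have "\<dots> \<le> ennreal (c * \<bar>fst z\<bar> powr - g) * ennreal (c * \<bar>snd z\<bar> powr - g)"
      using that by (intro mult_mono c) auto
    also have "\<dots> = ennreal (c * c * absprod z powr - g)"
      using c by (simp add: abs_mult powr_mult ennreal_mult [symmetric] mult_ac)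
    finally show ?thesis .
  qed
  moreover have "0 < c * c" using c by simp
  ultimately show thesis by (rule that [rotated])
qed

text \<open>Young's inequality for the exponents \<open>q\<close> and \<open>q / (q - 1)\<close>,
  rearranged: \<open>h powr q\<close> lies above its tangent at \<open>c\<close>. For
  \<open>q = 1\<close> there is no finite conjugate exponent, but both sides are then
  \<open>h\<close>.\<close>

lemma tangent_powr:
  fixes q h c :: real
  assumes "1 \<le> q" "0 \<le> h" "0 < c"
  shows "q * c powr (q - 1) * h \<le> h powr q + (q - 1) * c powr q"
proof (cases "q = 1")
  case False
  then have q: "1 < q" using assms by simp
  have "h * c powr (q - 1) \<le> h powr q / q + (c powr (q - 1)) powr (q / (q - 1)) / (q / (q - 1))"
    using q assms by (intro Youngs_inequality) (auto simp: field_simps)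
  also have "(c powr (q - 1)) powr (q / (q - 1)) = c powr q"
    using q by (simp add: powr_powr)
  finally have "q * (h * c powr (q - 1)) \<le> q * (h powr q / q + c powr q / (q / (q - 1)))"
    using q by (intro mult_left_mono) auto
  also have "q * (h powr q / q + c powr q / (q / (q - 1))) = h powr q + (q - 1) * c powr q"
    using q by (simp add: field_simps)
  finally show ?thesis by (simp add: mult_ac)
qed (use assms in auto)

text \<open>Jensen's inequality for the measure with density \<open>K / v\<close>; the tangent of \<open>h \<mapsto> h\<^sup>q\<close> at
  the mean value \<open>G / H\<close> is integrated.\<close>

lemma nn_integral_powr_jensen:
  fixes K F v :: "'b \<Rightarrow> real" and q G H :: real
  assumes [measurable]: "K \<in> borel_measurable N" "F \<in> borel_measurable N" "v \<in> borel_measurable N"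
    and q: "1 \<le> q" and K: "\<And>y. 0 \<le> K y" and F: "\<And>y. 0 \<le> F y" and v: "AE y in N. 0 < v y"
    and "0 \<le> G" "0 \<le> H"
    and G: "ennreal G \<le> (\<integral>\<^sup>+y. ennreal (K y * F y) \<partial>N)"
    and H: "(\<integral>\<^sup>+y. ennreal (K y / v y) \<partial>N) \<le> ennreal H"
  shows "ennreal (G powr q)
    \<le> ennreal (H powr (q - 1)) * (\<integral>\<^sup>+y. ennreal (K y * (v y powr (q - 1) * F y powr q)) \<partial>N)"
proof -
  let ?J = "\<integral>\<^sup>+y. ennreal (K y * (v y powr (q - 1) * F y powr q)) \<partial>N"
  consider "G = 0" | "G \<noteq> 0" "H = 0" | "G > 0" "H > 0"
    using \<open>0 \<le> G\<close> \<open>0 \<le> H\<close> by linarith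
  then show ?thesis
  proof cases
    \<comment> \<open>Since \<open>v\<close> is positive, \<open>H = 0\<close> forces
      \<open>K\<close> to vanish almost everywhere, and then \<open>G\<close> is zero after
      all.\<close>
    case 2
    then have "(\<integral>\<^sup>+y. ennreal (K y / v y) \<partial>N) = 0" using H by simp
    then have "AE y in N. ennreal (K y / v y) = 0"
      by (subst (asm) nn_integral_0_iff_AE) auto
    with v have "AE y in N. ennreal (K y * F y) = 0"
    proof eventually_elim
      case (elim y)
      then have "K y \<le> 0" by (simp add: ennreal_eq_0_iff divide_le_0_iff)
      with K [of y] show ?case by simp
    qed
    then have "(\<integral>\<^sup>+y. ennreal (K y * F y) \<partial>N) = 0"
      by (subst nn_integral_0_iff_AE) auto
    with G \<open>0 \<le> G\<close> have "G = 0" by simp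
    with 2 show ?thesis by simp
  next
    case 3
    define c where "c = G / H"
    have c: "0 < c" using 3 by (simp add: c_def)
    have cH: "c powr q * H = c powr (q - 1) * G"
      using c 3 by (simp add: powr_diff c_def)
    have "ennreal (q * c powr (q - 1) * G) = ennreal (q * c powr (q - 1)) * ennreal G"
      using q 3 by (simp add: ennreal_mult)
    also have "\<dots> \<le> ennreal (q * c powr (q - 1)) * (\<integral>\<^sup>+y. ennreal (K y * F y) \<partial>N)"
      by (intro mult_left_mono G) auto
    also have "\<dots> = (\<integral>\<^sup>+y. ennreal (q * c powr (q - 1) * (K y * F y)) \<partial>N)"
      using q K F by (subst nn_integral_cmult [symmetric]) (auto simp: ennreal_mult)
    also have "\<dots> \<le> (\<integral>\<^sup>+y. ennreal (K y * (v y powr (q - 1) * F y powr q))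
        + ennreal ((q - 1) * c powr q) * ennreal (K y / v y) \<partial>N)"
      using v
    proof (intro nn_integral_mono_AE, eventually_elim)
      case (elim y)
      have "K y / v y * (q * c powr (q - 1) * (F y * v y))
          \<le> K y / v y * ((F y * v y) powr q + (q - 1) * c powr q)"
        using elim K F q c by (intro mult_left_mono tangent_powr) auto
      also have "\<dots> = K y * (v y powr (q - 1) * F y powr q) + (q - 1) * c powr q * (K y / v y)"
        using elim F [of y] by (simp add: powr_mult powr_diff field_simps)
      also have "K y / v y * (q * c powr (q - 1) * (F y * v y)) = q * c powr (q - 1) * (K y * F y)"
        using elim by simp
      finally show ?case
        using elim K [of y] F [of y] q
        by (simp add: ennreal_mult [symmetric] ennreal_plus [symmetric] ennreal_leI del: ennreal_plus)
    qed
    also have "\<dots> = ?J + ennreal ((q - 1) * c powr q) * (\<integral>\<^sup>+y. ennreal (K y / v y) \<partial>N)"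
      by (subst nn_integral_add) (auto simp: nn_integral_cmult)
    also have "\<dots> \<le> ?J + ennreal ((q - 1) * c powr q) * ennreal H"
      by (intro add_left_mono mult_left_mono H) auto
    also have "\<dots> = ?J + ennreal ((q - 1) * c powr (q - 1) * G)"
      using q 3 cH by (simp add: ennreal_mult [symmetric] mult.assoc)
    finally have main: "ennreal (q * c powr (q - 1) * G) \<le> ?J + ennreal ((q - 1) * c powr (q - 1) * G)" .
    \<comment> \<open>The term with the factor \<open>q - 1\<close> can be cancelled only among
      finite numbers; if \<open>?J\<close> is infinite, positivity of \<open>H\<close> makes the
      claim trivial.\<close>
    show ?thesis
    proof (cases ?J)
      case top
      then show ?thesis using 3 by (simp add: ennreal_mult_top)
    next
      case (real j)
      with main have "q * c powr (q - 1) * G \<le> j + (q - 1) * c powr (q - 1) * G"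
        using q 3 by (simp add: ennreal_plus [symmetric] del: ennreal_plus)
      then have "c powr (q - 1) * G \<le> j" by (simp add: algebra_simps)
      then have "H powr (q - 1) * (c powr (q - 1) * G) \<le> H powr (q - 1) * j"
        by (intro mult_left_mono) auto
      also have "H powr (q - 1) * (c powr (q - 1) * G) = G powr q"
        using 3 by (simp add: c_def powr_divide powr_diff)
      finally show ?thesis
        using real by (simp add: ennreal_mult [symmetric] ennreal_leI)
    qed
  qed (use q in simp)
qed

text \<open>Jensen in \<open>y\<close> for each \<open>x\<close>, then Tonelli, then the column
  bound. The weight \<open>v\<close> is free, its row integral may depend on \<open>x\<close>
  through \<open>h\<close>, and the factor \<open>h powr (q - 1)\<close> that Jensen produces is
  carried into the column condition. This freedom lets power weights on both sides fit
  together.\<close>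

lemma schur_test:
  fixes K :: "'a \<Rightarrow> 'b \<Rightarrow> real" and F v g :: "'b \<Rightarrow> real" and G w h :: "'a \<Rightarrow> real" and q A B :: real
  assumes "sigma_finite_measure M" "sigma_finite_measure N"
    and meas_K [measurable]: "case_prod K \<in> borel_measurable (M \<Otimes>\<^sub>M N)"
    and [measurable]: "g \<in> borel_measurable N" "F \<in> borel_measurable N" "v \<in> borel_measurable N" "w \<in> borel_measurable M" "h \<in> borel_measurable M"
    and q: "1 \<le> q" and A: "0 \<le> A" and B: "0 \<le> B"
    and nonneg: "\<And>x y. 0 \<le> K x y" "\<And>y. 0 \<le> F y" "\<And>x. 0 \<le> w x" "\<And>x. 0 \<le> h x" "\<And>x. 0 \<le> G x"
      "\<And>y. 0 \<le> g y"
    and v: "AE y in N. 0 < v y"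
    and G: "AE x in M. ennreal (G x) \<le> (\<integral>\<^sup>+y. ennreal (K x y * F y) \<partial>N)"
    and row: "AE x in M. (\<integral>\<^sup>+y. ennreal (K x y / v y) \<partial>N) \<le> ennreal (A * h x)"
    and col: "AE y in N. (\<integral>\<^sup>+x. ennreal (K x y * (w x * h x powr (q - 1))) \<partial>M) \<le> ennreal (B * g y)"
  shows "(\<integral>\<^sup>+x. ennreal (w x * G x powr q) \<partial>M)
    \<le> ennreal (A powr (q - 1) * B) * (\<integral>\<^sup>+y. ennreal (F y powr q * v y powr (q - 1) * g y) \<partial>N)"
proof -
  interpret pair_sigma_finite M N
    by (intro pair_sigma_finite.intro assms(1,2))
  have "(\<integral>\<^sup>+x. ennreal (w x * G x powr q) \<partial>M)
    \<le> (\<integral>\<^sup>+x. (\<integral>\<^sup>+y. ennreal (A powr (q - 1) * (K x y * (w x * h x powr (q - 1)) * (v y powr (q - 1) * F y powr q))) \<partial>N) \<partial>M)"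
    proof (rule nn_integral_mono_AE)
    show "AE x in M. ennreal (w x * G x powr q) \<le> (\<integral>\<^sup>+y. ennreal (A powr (q - 1) * (K x y * (w x * h x powr (q - 1)) * (v y powr (q - 1) * F y powr q))) \<partial>N)"
    using G row AE_space [of M]
  proof eventually_elim
    case (elim x)
    have Kx: "K x \<in> borel_measurable N"
      using measurable_Pair2 [OF meas_K elim(3)] by simp
    have "ennreal (w x * G x powr q) = ennreal (w x) * ennreal (G x powr q)"
      using nonneg by (simp add: ennreal_mult)
    also have "\<dots> \<le> ennreal (w x) * (ennreal ((A * h x) powr (q - 1)) *
        (\<integral>\<^sup>+y. ennreal (K x y * (v y powr (q - 1) * F y powr q)) \<partial>N))"
      using Kx q nonneg v elim A by (intro mult_left_mono nn_integral_powr_jensen) auto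
    also have "\<dots> = ennreal (w x * (A * h x) powr (q - 1)) *
        (\<integral>\<^sup>+y. ennreal (K x y * (v y powr (q - 1) * F y powr q)) \<partial>N)"
      using nonneg by (simp add: ennreal_mult mult.assoc)
    also have "\<dots> = (\<integral>\<^sup>+y. ennreal (w x * (A * h x) powr (q - 1)) * ennreal (K x y * (v y powr (q - 1) * F y powr q)) \<partial>N)"
      using Kx by (subst nn_integral_cmult) auto
    also have "\<dots> = (\<integral>\<^sup>+y. ennreal (A powr (q - 1) * (K x y * (w x * h x powr (q - 1)) * (v y powr (q - 1) * F y powr q))) \<partial>N)"
      using nonneg A by (intro nn_integral_cong) (simp add: ennreal_mult [symmetric] powr_mult mult_ac)
    finally show ?case .
  qed
  qed
  also have "\<dots> = (\<integral>\<^sup>+y. (\<integral>\<^sup>+x. ennreal (A powr (q - 1) * (K x y * (w x * h x powr (q - 1)) * (v y powr (q - 1) * F y powr q))) \<partial>M) \<partial>N)"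
    by (rule Fubini' [symmetric]) measurable
  also have "\<dots> \<le> (\<integral>\<^sup>+y. ennreal (A powr (q - 1) * B) * ennreal (F y powr q * v y powr (q - 1) * g y) \<partial>N)"
  proof (rule nn_integral_mono_AE)
    show "AE y in N. (\<integral>\<^sup>+x. ennreal (A powr (q - 1) * (K x y * (w x * h x powr (q - 1)) * (v y powr (q - 1) * F y powr q))) \<partial>M) \<le> ennreal (A powr (q - 1) * B) * ennreal (F y powr q * v y powr (q - 1) * g y)"
    using col AE_space [of N]
  proof eventually_elim
    case (elim y)
    have Ky: "(\<lambda>x. K x y) \<in> borel_measurable M"
      using measurable_Pair1 [OF meas_K elim(2)] by simp
    have "(\<integral>\<^sup>+x. ennreal (A powr (q - 1) * (K x y * (w x * h x powr (q - 1)) * (v y powr (q - 1) * F y powr q))) \<partial>M)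
       = (\<integral>\<^sup>+x. ennreal (A powr (q - 1) * (v y powr (q - 1) * F y powr q)) * ennreal (K x y * (w x * h x powr (q - 1))) \<partial>M)"
      using nonneg by (intro nn_integral_cong) (simp add: ennreal_mult [symmetric] mult_ac)
    also have "\<dots> = ennreal (A powr (q - 1) * (v y powr (q - 1) * F y powr q)) * (\<integral>\<^sup>+x. ennreal (K x y * (w x * h x powr (q - 1))) \<partial>M)"
      using Ky by (subst nn_integral_cmult) auto
    also have "\<dots> \<le> ennreal (A powr (q - 1) * (v y powr (q - 1) * F y powr q)) * ennreal (B * g y)"
      by (intro mult_left_mono elim) auto
    also have "\<dots> = ennreal (A powr (q - 1) * B) * ennreal (F y powr q * v y powr (q - 1) * g y)"
      using nonneg B by (simp add: ennreal_mult [symmetric] mult_ac)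
    finally show ?case .
  qed
  qed
  also have "\<dots> = ennreal (A powr (q - 1) * B) * (\<integral>\<^sup>+y. ennreal (F y powr q * v y powr (q - 1) * g y) \<partial>N)"
    by (rule nn_integral_cmult) measurable
  finally show ?thesis .
qed

section \<open>General monotone double sequences\<close>

lemma tendsto_zero_row:
  assumes "tends_to_zero2 a" "1 \<le> m"
  shows "(\<lambda>n. a m n) \<longlonglongrightarrow> 0"
proof (rule LIMSEQ_I)
  fix e :: real assume "0 < e"
  with assms(1) obtain N where N: "\<And>m n. 1 \<le> m \<Longrightarrow> 1 \<le> n \<Longrightarrow> N \<le> m + n \<Longrightarrow> \<bar>a m n\<bar> < e"
    unfolding tends_to_zero2_def by meson
  show "\<exists>no. \<forall>n\<ge>no. norm (a m n - 0) < e"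
    using N [OF assms(2)] by (intro exI [of _ "Suc N"]) auto
qed

lemma tends_to_zero2_transpose: "tends_to_zero2 a \<Longrightarrow> tends_to_zero2 (\<lambda>m n. a n m)"
  unfolding tends_to_zero2_def by (metis add.commute)

lemma tendsto_zero_col: "tends_to_zero2 a \<Longrightarrow> 1 \<le> n \<Longrightarrow> (\<lambda>m. a m n) \<longlonglongrightarrow> 0"
  by (rule tendsto_zero_row [OF tends_to_zero2_transpose])

text \<open>As \<open>d\<close> tends to zero, \<open>d n\<close> is the sum of its own decrements
  from \<open>n\<close> on, and these are part of the variation from \<open>l\<close> on.\<close>

lemma abs_le_tail_variation:
  fixes d :: "nat \<Rightarrow> real"
  assumes "d \<longlonglongrightarrow> 0" and sm: "summable (\<lambda>j. \<bar>d (j + l) - d (Suc (j + l))\<bar>)" and "l \<le> n"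
  shows "\<bar>d n\<bar> \<le> (\<Sum>j. \<bar>d (j + l) - d (Suc (j + l))\<bar>)"
proof -
  define x where "x j = \<bar>d (j + l) - d (Suc (j + l))\<bar>" for j
  have sx: "summable x"
    using sm by (simp only: x_def [abs_def])
  have shift: "\<bar>d (j + n) - d (Suc (j + n))\<bar> = x (j + (n - l))" for j
    using assms(3) by (simp add: x_def)
  have smn: "summable (\<lambda>j. \<bar>d (j + n) - d (Suc (j + n))\<bar>)"
    unfolding shift by (rule summable_ignore_initial_segment [OF sx])
  have "(\<lambda>j. d (j + n)) \<longlonglongrightarrow> 0"
    using assms(1) by (rule LIMSEQ_ignore_initial_segment)
  from telescope_sums' [OF this] have "(\<lambda>j. d (j + n) - d (Suc (j + n))) sums d n"
    by simp
  then have "\<bar>d n\<bar> = \<bar>\<Sum>j. d (j + n) - d (Suc (j + n))\<bar>"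
    by (simp add: sums_iff)
  also have "\<dots> \<le> (\<Sum>j. \<bar>d (j + n) - d (Suc (j + n))\<bar>)"
    by (rule summable_rabs [OF smn])
  also have "\<dots> = suminf x - (\<Sum>j<n - l. x j)"
    unfolding shift by (rule suminf_minus_initial_segment [OF sx])
  also have "\<dots> \<le> suminf x"
    by (simp add: sum_nonneg x_def)
  finally show ?thesis by (simp only: x_def [abs_def])
qed

lemma diff_le_sum_steps:
  fixes b v :: "nat \<Rightarrow> real"
  assumes v: "\<And>i. m0 \<le> i \<Longrightarrow> i < M \<Longrightarrow> \<bar>b i - b (Suc i)\<bar> \<le> v i"
    and m: "m0 \<le> m" "m \<le> M" "m0 \<le> m'" "m' \<le> M"
  shows "\<bar>b m - b m'\<bar> \<le> (\<Sum>i=m0..<M. v i)"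
proof -
  have *: "\<bar>b m - b m'\<bar> \<le> (\<Sum>i=m0..<M. v i)" if "m \<le> m'" "m0 \<le> m" "m' \<le> M" for m m'
  proof -
    have "\<bar>b m - b m'\<bar> \<le> (\<Sum>i=m..<m'. v i)"
      using that(1)
    proof (induction m' rule: dec_induct)
      case (step i)
      with v [of i] that show ?case by simp
    qed simp
    also have "\<dots> \<le> (\<Sum>i=m0..<M. v i)"
      using that v by (intro sum_mono2) (auto intro: order_trans [OF abs_ge_zero])
    finally show ?thesis .
  qed
  show ?thesis
    using * [of m m'] * [of m' m] m by (cases "m \<le> m'") (auto simp: abs_minus_commute)
qed

text \<open>Passage from extended to real sums: a finite bound makes each inner series converge, and
  only then does its real \<open>suminf\<close> have the intended value.\<close>

lemma ennreal_double_sum_le: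
  fixes D :: "nat \<Rightarrow> nat \<Rightarrow> real"
  assumes le: "(\<Sum>i\<in>S. \<Sum>j. ennreal \<bar>D i j\<bar>) \<le> ennreal R" and "finite S" "0 \<le> R"
  shows "i \<in> S \<Longrightarrow> summable (\<lambda>j. \<bar>D i j\<bar>)" and "(\<Sum>i\<in>S. \<Sum>j. \<bar>D i j\<bar>) \<le> R"
proof -
  have sm: "summable (\<lambda>j. \<bar>D i j\<bar>)" if "i \<in> S" for i
  proof (rule summable_suminf_not_top)
    have "(\<Sum>j. ennreal \<bar>D i j\<bar>) \<le> (\<Sum>i\<in>S. \<Sum>j. ennreal \<bar>D i j\<bar>)"
      using that assms by (intro member_le_sum [of i S "\<lambda>i. \<Sum>j. ennreal \<bar>D i j\<bar>"]) auto
    also note le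
    finally show "(\<Sum>j. ennreal \<bar>D i j\<bar>) \<noteq> top" by (auto simp: top_unique)
  qed auto
  then show "i \<in> S \<Longrightarrow> summable (\<lambda>j. \<bar>D i j\<bar>)" .
  have "ennreal (\<Sum>i\<in>S. \<Sum>j. \<bar>D i j\<bar>) = (\<Sum>i\<in>S. ennreal (\<Sum>j. \<bar>D i j\<bar>))"
    using sm by (intro sum_ennreal [symmetric] suminf_nonneg) auto
  also have "\<dots> = (\<Sum>i\<in>S. \<Sum>j. ennreal \<bar>D i j\<bar>)"
    using sm by (intro sum.cong refl suminf_ennreal2 [symmetric]) auto
  also note le
  finally show "(\<Sum>i\<in>S. \<Sum>j. \<bar>D i j\<bar>) \<le> R" using \<open>0 \<le> R\<close> by (simp add: ennreal_le_iff)
qed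

text \<open>Pigeonhole: among \<open>N\<close> consecutive runs of equal length, one carries at most
  a fraction \<open>1 / N\<close> of the variation. The inner sum stops at \<open>m0 + r - 1\<close>
  because \<open>r\<close> points have \<open>r - 1\<close> steps between them. The even element is
  for the second class, where only even first indices can serve as comparison points.\<close>

lemma exists_short_subinterval:
  fixes x :: "nat \<Rightarrow> real"
  assumes x: "\<And>m. 0 \<le> x m" and N: "1 \<le> N"
  obtains m0 r where "1 \<le> r" "r \<le> 2 ^ I" "2 ^ I \<le> 4 * N * r" "2 ^ (I - 1) \<le> m0" "m0 + r \<le> 2 ^ I + 1"
    "real N * (\<Sum>m=m0..<m0 + r - 1. x m) \<le> (\<Sum>m=2 ^ (I - 1)..<2 ^ I. x m)"
    "1 \<le> I \<Longrightarrow> \<exists>m\<in>{m0..<m0 + r}. even m"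
proof (cases "I = 0")
  case True
  with N show ?thesis by (intro that [of 1 1]) auto
next
  case False
  define k :: nat where "k = 2 ^ (I - 1)"
  have k2: "2 ^ I = 2 * k" using False by (cases I) (auto simp: k_def)
  have kS: "2 ^ (I - Suc 0) = k" by (simp add: k_def)
  have k1: "1 \<le> k" by (simp add: k_def)
  show ?thesis
  proof (cases "k < 2 * N")
    case True
    \<comment> \<open>The range is too short to divide. The single point
      \<open>2 * k = 2 ^ I\<close> has no internal variation, and \<open>k < 2 * N\<close> keeps its
      length comparable to the range.\<close>
    show ?thesis
      by (rule that [of 1 "2 * k"]) (use True k1 in \<open>auto simp: k2 kS x sum_nonneg\<close>)
  next
    case False
    define L where "L = k div N"
    \<comment> \<open>Two consecutive indices guarantee an even one in the chosen run.\<close>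
    have L: "2 \<le> L"
      using False N by (simp add: L_def less_eq_div_iff_mult_less_eq)
    have kL: "k < N * L + N"
      unfolding L_def using N mult_div_mod_eq [of N k] mod_less_divisor [of N k] by linarith
    have NLk: "N * L \<le> k" by (simp add: L_def)
    define S where "S u = (\<Sum>m=k + u * L..<k + Suc u * L. x m)" for u
    have tot: "(\<Sum>u<M. S u) = (\<Sum>m=k..<k + M * L. x m)" for M
    proof (induction M)
      case (Suc M)
      have "(\<Sum>m=k..<k + Suc M * L. x m) = (\<Sum>m=k..<k + M * L. x m) + S M"
        unfolding S_def by (rule sum.atLeastLessThan_concat [symmetric]) auto
      with Suc show ?case by simp
    qed simp
    have "\<exists>u<N. real N * S u \<le> (\<Sum>u<N. S u)"
    proof (rule ccontr)
      assume "\<not> ?thesis"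
      then have "(\<Sum>u<N. \<Sum>u<N. S u) < (\<Sum>u<N. real N * S u)"
        using N by (intro sum_strict_mono) (auto simp: lessThan_empty_iff)
      then show False by (simp add: sum_distrib_left)
    qed
    then obtain u where u: "u < N" "real N * S u \<le> (\<Sum>u<N. S u)" by blast
    have "Suc u * L \<le> N * L" using u by (intro mult_right_mono) auto
    then have end_le: "k + u * L + L \<le> 2 * k" using NLk by simp
    have "real N * (\<Sum>m=k + u * L..<k + u * L + L - 1. x m) \<le> real N * S u"
      unfolding S_def using x by (intro mult_left_mono sum_mono2) auto
    also have "\<dots> \<le> (\<Sum>m=k..<k + N * L. x m)" using u by (simp add: tot)
    also have "\<dots> \<le> (\<Sum>m=k..<2 * k. x m)"
      using NLk x by (intro sum_mono2) auto
    finally have var: "real N * (\<Sum>m=k + u * L..<k + u * L + L - 1. x m) \<le> (\<Sum>m=k..<2 * k. x m)" .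
    have ev: "\<exists>m\<in>{k + u * L..<k + u * L + L}. even m"
    proof (cases "even (k + u * L)")
      case True
      then show ?thesis using L by (intro bexI [of _ "k + u * L"]) auto
    next
      case False
      then show ?thesis using L by (intro bexI [of _ "Suc (k + u * L)"]) auto
    qed
    have "2 * N \<le> N * L" using L by simp
    then have "2 * k \<le> 4 * N * L" using kL by linarith
    then show ?thesis
      using L end_le var ev
      by (intro that [of L "k + u * L"]) (auto simp: k2 kS)
  qed
qed

section \<open>Dyadic corner values and comparison of coefficients\<close>

definition alpha :: "(nat \<Rightarrow> nat \<Rightarrow> real) \<Rightarrow> nat \<Rightarrow> nat \<Rightarrow> real" where
  "alpha a I J = \<bar>a (2 ^ I) (2 ^ J)\<bar>"

lemma alpha_nonneg [simp]: "0 \<le> alpha a I J"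
  by (simp add: alpha_def)

text \<open>One locale for both classes: \<open>e = 0\<close> compares with \<open>a k l\<close>,
  \<open>e = 1\<close> with \<open>a (2 * k) l\<close>. The normalisation \<open>1 \<le> C\<close>
  spares case distinctions on the sign of the constant.\<close>

locale gm_sequence =
  fixes a :: "nat \<Rightarrow> nat \<Rightarrow> real" and C :: real and e :: nat
  assumes e: "e \<le> 1" and C: "1 \<le> C" and tz: "tends_to_zero2 a"
    and gm: "\<And>k l. 1 \<le> k \<Longrightarrow> 1 \<le> l \<Longrightarrow> GM_lhs a k l \<le> ennreal (C * \<bar>a (2 ^ e * k) l\<bar>)"
begin

definition rowvar :: "nat \<Rightarrow> nat \<Rightarrow> real" where
  "rowvar l m = (\<Sum>n. \<bar>Delta11 a m (n + l)\<bar>)"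

definition colvar :: "nat \<Rightarrow> nat \<Rightarrow> real" where
  "colvar k n = (\<Sum>m. \<bar>Delta11 a (m + k) n\<bar>)"

lemma gm_row:
  assumes "1 \<le> k" "1 \<le> l"
  shows "(\<Sum>m\<in>{k..2*k}. \<Sum>n. ennreal \<bar>Delta11 a m (n + l)\<bar>) \<le> ennreal (C * \<bar>a (2 ^ e * k) l\<bar>)"
  using gm [OF assms] unfolding GM_lhs_def by (rule order_trans [rotated]) simp

lemma gm_col:
  assumes "1 \<le> k" "1 \<le> l"
  shows "(\<Sum>n\<in>{l..2*l}. \<Sum>m. ennreal \<bar>Delta11 a (m + k) n\<bar>) \<le> ennreal (C * \<bar>a (2 ^ e * k) l\<bar>)"
proof -
  have "(\<Sum>n\<in>{l..2*l}. \<Sum>m. ennreal \<bar>Delta11 a (m + k) n\<bar>) = (\<Sum>m. \<Sum>n\<in>{l..2*l}. ennreal \<bar>Delta11 a (m + k) n\<bar>)"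
    by (rule suminf_sum [symmetric]) simp
  also have "\<dots> \<le> GM_lhs a k l" unfolding GM_lhs_def by simp
  finally show ?thesis using gm [OF assms] by (rule order_trans)
qed

lemma summable_row: "1 \<le> m \<Longrightarrow> 1 \<le> l \<Longrightarrow> summable (\<lambda>n. \<bar>Delta11 a m (n + l)\<bar>)"
  using C ennreal_double_sum_le(1) [OF gm_row] by simp

lemma summable_col: "1 \<le> n \<Longrightarrow> 1 \<le> k \<Longrightarrow> summable (\<lambda>m. \<bar>Delta11 a (m + k) n\<bar>)"
  using C ennreal_double_sum_le(1) [OF gm_col] by simp

lemma rowvar_nonneg: "1 \<le> m \<Longrightarrow> 1 \<le> l \<Longrightarrow> 0 \<le> rowvar l m"
  unfolding rowvar_def by (intro suminf_nonneg summable_row) auto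

lemma colvar_nonneg: "1 \<le> n \<Longrightarrow> 1 \<le> k \<Longrightarrow> 0 \<le> colvar k n"
  unfolding colvar_def by (intro suminf_nonneg summable_col) auto

lemma sum_rowvar_le: "1 \<le> k \<Longrightarrow> 1 \<le> l \<Longrightarrow> (\<Sum>m\<in>{k..2*k}. rowvar l m) \<le> C * \<bar>a (2 ^ e * k) l\<bar>"
  unfolding rowvar_def using C by (intro ennreal_double_sum_le(2) [OF gm_row]) auto

lemma sum_colvar_le: "1 \<le> k \<Longrightarrow> 1 \<le> l \<Longrightarrow> (\<Sum>n\<in>{l..2*l}. colvar k n) \<le> C * \<bar>a (2 ^ e * k) l\<bar>"
  unfolding colvar_def using C by (intro ennreal_double_sum_le(2) [OF gm_col]) auto

text \<open>The row difference tends to zero in \<open>n\<close> and its decrements are the mixed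
  differences, so the tail bound applies. A single number thus controls the step from
  \<open>m\<close> to \<open>Suc m\<close> at every height \<open>n \<ge> l\<close>.\<close>

lemma row_step:
  assumes "1 \<le> m" "1 \<le> l" "l \<le> n"
  shows "\<bar>a m n - a (Suc m) n\<bar> \<le> rowvar l m"
proof -
  define d where "d n = a m n - a (Suc m) n" for n
  have D: "d (j + l) - d (Suc (j + l)) = Delta11 a m (j + l)" for j
    by (simp add: d_def Delta11_def)
  have "d \<longlonglongrightarrow> 0 - 0"
    unfolding d_def using assms by (intro tendsto_diff tendsto_zero_row tz) auto
  then have "\<bar>d n\<bar> \<le> (\<Sum>j. \<bar>d (j + l) - d (Suc (j + l))\<bar>)"
    using assms by (intro abs_le_tail_variation) (auto simp: D summable_row)
  then show ?thesis by (simp add: D rowvar_def) (simp add: d_def)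
qed

lemma col_step:
  assumes "1 \<le> n" "1 \<le> k" "k \<le> m"
  shows "\<bar>a m n - a m (Suc n)\<bar> \<le> colvar k n"
proof -
  define d where "d m = a m n - a m (Suc n)" for m
  have D: "d (j + k) - d (Suc (j + k)) = Delta11 a (j + k) n" for j
    by (simp add: d_def Delta11_def)
  have "d \<longlonglongrightarrow> 0 - 0"
    unfolding d_def using assms by (intro tendsto_diff tendsto_zero_col tz) auto
  then have "\<bar>d m\<bar> \<le> (\<Sum>j. \<bar>d (j + k) - d (Suc (j + k))\<bar>)"
    using assms by (intro abs_le_tail_variation) (auto simp: D summable_col)
  then show ?thesis by (simp add: D colvar_def) (simp add: d_def)
qed

lemma row_diff:
  assumes "1 \<le> m0" "1 \<le> l" "l \<le> n" "m0 \<le> m" "m \<le> M" "m0 \<le> m'" "m' \<le> M"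
  shows "\<bar>a m n - a m' n\<bar> \<le> (\<Sum>\<mu>=m0..<M. rowvar l \<mu>)"
  using assms by (intro diff_le_sum_steps [of m0 M "\<lambda>m. a m n"] row_step) auto

lemma col_diff:
  assumes "1 \<le> n0" "1 \<le> k" "k \<le> m" "n0 \<le> n" "n \<le> N" "n0 \<le> n'" "n' \<le> N"
  shows "\<bar>a m n - a m n'\<bar> \<le> (\<Sum>\<nu>=n0..<N. colvar k \<nu>)"
  using assms by (intro diff_le_sum_steps [of n0 N "a m"] col_step) auto

lemma pow_e: "2 ^ e = (1::nat) \<or> 2 ^ e = (2::nat)"
  using e by (cases e) auto

text \<open>Two legs: the first index moves to \<open>2 ^ e * k\<close> at fixed \<open>n\<close>,
  then the second moves to \<open>l\<close>. The target is \<open>k\<close> or \<open>2 * k\<close>,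
  so both legs stay in the range covered by the GM inequality, and each costs \<open>C\<close> times
  the corner coefficient.\<close>

lemma gm_upper:
  assumes "1 \<le> k" "1 \<le> l" "k \<le> m" "m \<le> 2 * k" "l \<le> n" "n \<le> 2 * l"
  shows "\<bar>a m n\<bar> \<le> (1 + 2 * C) * \<bar>a (2 ^ e * k) l\<bar>"
proof -
  have "\<bar>a m n - a (2 ^ e * k) n\<bar> \<le> (\<Sum>\<mu>=k..<2*k. rowvar l \<mu>)"
    using assms pow_e by (intro row_diff) auto
  also have "\<dots> \<le> (\<Sum>m\<in>{k..2*k}. rowvar l m)"
    using assms by (intro sum_mono2) (auto intro!: rowvar_nonneg)
  also have "\<dots> \<le> C * \<bar>a (2 ^ e * k) l\<bar>" by (intro sum_rowvar_le assms)
  finally have 1: "\<bar>a m n - a (2 ^ e * k) n\<bar> \<le> C * \<bar>a (2 ^ e * k) l\<bar>" .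
  have "\<bar>a (2 ^ e * k) n - a (2 ^ e * k) l\<bar> \<le> (\<Sum>\<nu>=l..<2*l. colvar k \<nu>)"
    using assms pow_e by (intro col_diff) auto
  also have "\<dots> \<le> (\<Sum>n\<in>{l..2*l}. colvar k n)"
    using assms by (intro sum_mono2) (auto intro!: colvar_nonneg)
  also have "\<dots> \<le> C * \<bar>a (2 ^ e * k) l\<bar>" by (intro sum_colvar_le assms)
  finally show ?thesis using 1 by (simp add: algebra_simps)
qed

lemma abs_le_alpha:
  assumes "m \<in> dyadic I" "n \<in> dyadic J"
  shows "\<bar>a m n\<bar> \<le> (1 + 2 * C) * alpha a (I + e) J"
  using gm_upper [of "2 ^ I" "2 ^ J" m n] assms
  by (auto simp: dyadic_def alpha_def power_add mult.commute)

text \<open>The upper comparison, based at \<open>(j, n)\<close> instead of at a dyadic corner: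
  \<open>(2 ^ I, 2 ^ J)\<close> lies in the doubling rectangle of \<open>(j, n)\<close>. For
  \<open>e = 1\<close> the lower bound therefore reaches only coefficients with even first
  index.\<close>

lemma alpha_le_abs:
  assumes "2 ^ (I - 1) \<le> j" "j \<le> 2 ^ I" "2 ^ (J - 1) \<le> n" "n \<le> 2 ^ J"
  shows "alpha a I J \<le> (1 + 2 * C) * \<bar>a (2 ^ e * j) n\<bar>"
proof -
  have pw: "1 \<le> i \<and> 2 ^ K \<le> 2 * i" if "2 ^ (K - 1) \<le> i" for K i :: nat
    using that le_trans [OF one_le_power that] by (cases K) auto
  note j = pw [OF assms(1)] and n = pw [OF assms(3)]
  show ?thesis
    unfolding alpha_def using j n assms by (intro gm_upper) auto
qed

lemma Delta11_block:
  "(\<Sum>m\<in>dyadic I. \<Sum>n\<in>dyadic J. \<bar>Delta11 a m n\<bar>) \<le> C * alpha a (I + e) J"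
proof -
  have "(\<Sum>m\<in>dyadic I. \<Sum>n\<in>dyadic J. \<bar>Delta11 a m n\<bar>) \<le> (\<Sum>m\<in>dyadic I. rowvar (2 ^ J) m)"
  proof (intro sum_mono)
    fix m assume "m \<in> dyadic I"
    then have m: "1 \<le> m" using one_le_power [of "2::nat" I] by (auto simp: dyadic_def)
    have "(\<Sum>n\<in>dyadic J. \<bar>Delta11 a m n\<bar>) = (\<Sum>n=0 + 2 ^ J..<2 ^ J + 2 ^ J. \<bar>Delta11 a m n\<bar>)"
      by (simp add: dyadic_def mult_2)
    also have "\<dots> = (\<Sum>n<2 ^ J. \<bar>Delta11 a m (n + 2 ^ J)\<bar>)"
      by (subst sum.shift_bounds_nat_ivl) (simp add: lessThan_atLeast0)
    also have "\<dots> \<le> rowvar (2 ^ J) m"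
      unfolding rowvar_def using m by (intro sum_le_suminf summable_row) auto
    finally show "(\<Sum>n\<in>dyadic J. \<bar>Delta11 a m n\<bar>) \<le> rowvar (2 ^ J) m" .
  qed
  also have "\<dots> \<le> (\<Sum>m\<in>{2 ^ I..2 * 2 ^ I}. rowvar (2 ^ J) m)"
  proof (intro sum_mono2)
    fix m :: nat assume "m \<in> {2 ^ I..2 * 2 ^ I} - dyadic I"
    then have "1 \<le> m" using le_trans [OF one_le_power [of "2::nat" I], of m] by auto
    then show "0 \<le> rowvar (2 ^ J) m" by (intro rowvar_nonneg) auto
  qed (auto simp: dyadic_def)
  also have "\<dots> \<le> C * \<bar>a (2 ^ e * 2 ^ I) (2 ^ J)\<bar>"
    by (intro sum_rowvar_le) auto
  finally show ?thesis by (simp add: alpha_def power_add mult.commute)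
qed

text \<open>A coefficient can be much smaller than the variation around it, so it controls no block
  average by itself. Splitting the block into \<open>N\<close> parts in each direction leaves an error
  \<open>O(1/N)\<close> times a neighbouring coefficient, which is absorbed upon summation.\<close>

lemma alpha_le_block_sum:
  assumes N: "1 \<le> N"
    and T: "\<And>m0 n0 r s. 1 \<le> m0 \<Longrightarrow> 1 \<le> n0 \<Longrightarrow> r \<le> 2 ^ (I + e) \<Longrightarrow> s \<le> 2 ^ J \<Longrightarrow>
      \<bar>\<Sum>m=m0..<m0 + r. \<Sum>n=n0..<n0 + s. a m n\<bar> \<le> 2 ^ (I + e) * 2 ^ J * T"
  shows "alpha a I J \<le> (1 + 2 * C) * (2 * C / real N * alpha a (I + e - 1 + e) (J - 1) + 16 * (real N)\<^sup>2 * T)"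
proof -
  \<comment> \<open>The rectangle ends at \<open>(2 ^ (I + e), 2 ^ J)\<close>. Raising the first
    exponent by \<open>e\<close> makes room for the points \<open>2 ^ e * j\<close> with
    \<open>j\<close> between \<open>2 ^ (I - 1)\<close> and \<open>2 ^ I\<close>.\<close>
  define k l :: nat where "k = 2 ^ (I + e - 1)" and "l = 2 ^ (J - 1)"
  have kl: "1 \<le> k" "1 \<le> l" by (auto simp: k_def l_def)
  have k2: "2 ^ (I + e) \<le> 2 * k" and l2: "2 ^ J \<le> 2 * l"
    by (cases "I + e"; simp add: k_def) (cases J; simp add: l_def)
  \<comment> \<open>Nonnegativity of the variations is available for positive indices only, hence
    the cut-off at zero in \<open>x\<close> and \<open>y\<close>.\<close>
  define x where "x m = (if 1 \<le> m then rowvar l m else 0)" for m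
  define y where "y n = (if 1 \<le> n then colvar k n else 0)" for n
  have x0: "\<And>m. 0 \<le> x m" using kl by (simp add: x_def rowvar_nonneg)
  have y0: "\<And>n. 0 \<le> y n" using kl by (simp add: y_def colvar_nonneg)
  obtain m0 r where m: "1 \<le> r" "r \<le> 2 ^ (I + e)" "2 ^ (I + e) \<le> 4 * N * r" "k \<le> m0" "m0 + r \<le> 2 ^ (I + e) + 1"
    "real N * (\<Sum>m=m0..<m0 + r - 1. x m) \<le> (\<Sum>m=k..<2 ^ (I + e). x m)"
    "1 \<le> I + e \<Longrightarrow> \<exists>m\<in>{m0..<m0 + r}. even m"
    by (rule exists_short_subinterval [of x N "I + e", OF x0 N, folded k_def]) (rule that)
  obtain n0 s where n: "1 \<le> s" "s \<le> 2 ^ J" "2 ^ J \<le> 4 * N * s" "l \<le> n0" "n0 + s \<le> 2 ^ J + 1"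
    "real N * (\<Sum>n=n0..<n0 + s - 1. y n) \<le> (\<Sum>n=l..<2 ^ J. y n)"
    by (rule exists_short_subinterval [of y N J, OF y0 N, folded l_def]) (rule that)
  define R where "R = alpha a (I + e - 1 + e) (J - 1)"
  have R: "\<bar>a (2 ^ e * k) l\<bar> = R"
    by (simp add: R_def alpha_def k_def l_def power_add mult.commute)
  have "(\<Sum>m=k..<2 ^ (I + e). x m) \<le> (\<Sum>m\<in>{k..2*k}. rowvar l m)"
    unfolding x_def using kl k2 by (subst sum.cong [OF refl, of _ _ "rowvar l"])
      (auto intro!: sum_mono2 rowvar_nonneg)
  with m(6) sum_rowvar_le [OF kl] have X: "real N * (\<Sum>m=m0..<m0 + r - 1. x m) \<le> C * R"
    by (simp add: R)
  have "(\<Sum>n=l..<2 ^ J. y n) \<le> (\<Sum>n\<in>{l..2*l}. colvar k n)"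
    unfolding y_def using kl l2 by (subst sum.cong [OF refl, of _ _ "colvar k"])
      (auto intro!: sum_mono2 colvar_nonneg)
  with n(6) sum_colvar_le [OF kl] have Y: "real N * (\<Sum>n=n0..<n0 + s - 1. y n) \<le> C * R"
    by (simp add: R)
  have xr: "(\<Sum>m=m0..<m0 + r - 1. x m) = (\<Sum>m=m0..<m0 + r - 1. rowvar l m)"
    using m kl by (intro sum.cong) (auto simp: x_def)
  have yr: "(\<Sum>n=n0..<n0 + s - 1. y n) = (\<Sum>n=n0..<n0 + s - 1. colvar k n)"
    using n kl by (intro sum.cong) (auto simp: y_def)
  \<comment> \<open>A multiple of \<open>2 ^ e\<close> in the run, so that the lower comparison for
    \<open>alpha a I J\<close> applies there. For \<open>e = 1\<close> it is the even element of the
    run.\<close>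
  obtain j where j: "2 ^ e * j \<in> {m0..<m0 + r}" "2 ^ (I - 1) \<le> j" "j \<le> 2 ^ I"
  proof (cases "e = 0")
    case True
    then show ?thesis using m k_def by (intro that [of m0]) auto
  next
    case False
    then have e1: "e = 1" using e by simp
    then obtain m' where m': "m' \<in> {m0..<m0 + r}" "even m'" using m(7) by auto
    then obtain j where j: "m' = 2 * j" by (elim evenE)
    have jk: "2 ^ I \<le> 2 * j" "2 * j \<le> 2 * 2 ^ I" using m' m(4,5) j by (auto simp: k_def e1)
    have "2 ^ (I - 1) \<le> j" using jk(1) by (cases I) auto
    then show ?thesis using jk m' j e1 by (intro that [of j]) auto
  qed
  define ms where "ms = 2 ^ e * j"
  define A where "A = a ms n0"
  define osc where "osc = 2 * C * R / real N"
  have near: "\<bar>a m' n' - A\<bar> \<le> osc" if "m' \<in> {m0..<m0 + r}" "n' \<in> {n0..<n0 + s}" for m' n'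
  proof -
    have "\<bar>a m' n' - a ms n'\<bar> \<le> (\<Sum>m=m0..<m0 + r - 1. x m)"
      unfolding xr using that j m n kl ms_def by (intro row_diff) auto
    also have "\<dots> \<le> C * R / real N" using X N by (simp add: field_simps)
    finally have 1: "\<bar>a m' n' - a ms n'\<bar> \<le> C * R / real N" .
    have "\<bar>a ms n' - a ms n0\<bar> \<le> (\<Sum>n=n0..<n0 + s - 1. y n)"
      unfolding yr using that j m n kl ms_def by (intro col_diff) auto
    also have "\<dots> \<le> C * R / real N" using Y N by (simp add: field_simps)
    finally have "\<bar>a ms n' - a ms n0\<bar> \<le> C * R / real N" .
    moreover have "osc = C * R / real N + C * R / real N"
      by (simp add: osc_def field_simps)
    ultimately show ?thesis using 1 unfolding A_def by linarith
  qed
  have rs: "0 < real r * real s" using m n by simp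
  have "\<bar>(\<Sum>m=m0..<m0 + r. \<Sum>n=n0..<n0 + s. a m n) - real r * real s * A\<bar>
      = \<bar>\<Sum>m=m0..<m0 + r. \<Sum>n=n0..<n0 + s. (a m n - A)\<bar>"
    by (simp add: sum_subtractf)
  also have "\<dots> \<le> (\<Sum>m=m0..<m0 + r. \<Sum>n=n0..<n0 + s. \<bar>a m n - A\<bar>)"
    by (intro order_trans [OF sum_abs] sum_mono sum_abs)
  also have "\<dots> \<le> (\<Sum>m=m0..<m0 + r. \<Sum>n=n0..<n0 + s. osc)"
    by (intro sum_mono near)
  also have "\<dots> = real r * real s * osc" by simp
  finally have "real r * real s * \<bar>A\<bar> \<le> \<bar>\<Sum>m=m0..<m0 + r. \<Sum>n=n0..<n0 + s. a m n\<bar> + real r * real s * osc"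
    using abs_mult [of "real r * real s" A] abs_of_pos [OF rs] by linarith
  also have "\<bar>\<Sum>m=m0..<m0 + r. \<Sum>n=n0..<n0 + s. a m n\<bar> \<le> 2 ^ (I + e) * 2 ^ J * T"
    using m n kl by (intro T) auto
  \<comment> \<open>Each side of the subblock is at least the fraction \<open>1 / (4 * N)\<close> of
    the full side; this is the origin of the factor 16 and of the square of
    \<open>N\<close>.\<close>
  also have "\<dots> \<le> (4 * real N * real r) * (4 * real N * real s) * T"
  proof (intro mult_right_mono mult_mono)
    show "(2::real) ^ (I + e) \<le> 4 * real N * real r"
      using of_nat_mono [OF m(3), where ?'a = real] by simp
    show "(2::real) ^ J \<le> 4 * real N * real s"
      using of_nat_mono [OF n(3), where ?'a = real] by simp
    \<comment> \<open>The empty rectangle shows that \<open>T\<close> is nonnegative.\<close>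
    have "0 \<le> 2 ^ (I + e) * 2 ^ J * T" using T [of 1 1 0 0] by simp
    moreover have "0 < (2::real) ^ (I + e) * 2 ^ J" by simp
    ultimately show "0 \<le> T" by (meson not_le mult_pos_neg)
  qed auto
  finally have "real r * real s * \<bar>A\<bar> \<le> real r * real s * (16 * (real N)\<^sup>2 * T + osc)"
    by (simp add: power2_eq_square algebra_simps)
  then have A_le: "\<bar>A\<bar> \<le> osc + 16 * (real N)\<^sup>2 * T"
    unfolding mult_le_cancel_left_pos [OF rs] by simp
  have "alpha a I J \<le> (1 + 2 * C) * \<bar>A\<bar>"
    unfolding A_def ms_def using j n by (intro alpha_le_abs) (auto simp: l_def)
  also have "\<dots> \<le> (1 + 2 * C) * (osc + 16 * (real N)\<^sup>2 * T)"
    using A_le C by (intro mult_left_mono) auto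
  finally show ?thesis by (simp add: osc_def R_def)
qed

end

section \<open>Absorbing the error along dyadic neighbours\<close>

text \<open>Unfolding \<open>r\<close> times leaves \<open>\<eta> ^ r * s (M + r)\<close>, which is
  bounded by a quantity tending to zero because \<open>\<eta> * Q < 1\<close>. The inhomogeneous
  terms form a geometric series of sum at most \<open>2 * \<tau>\<close> because
  \<open>\<eta> \<le> 1 / 2\<close>. The growth bound stands in for an a priori finite supremum, and
  \<open>P\<close> and \<open>Q\<close> leave no trace in the result.\<close>

lemma absorb_iteration:
  fixes s :: "nat \<Rightarrow> real"
  assumes rec: "\<And>M. s M \<le> \<eta> * s (Suc M) + \<tau>" and growth: "\<And>M. s M \<le> P * Q ^ M"
    and "0 \<le> \<eta>" "\<eta> \<le> 1 / 2" "0 \<le> Q" "\<eta> * Q < 1" "0 \<le> \<tau>"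
  shows "s M \<le> 2 * \<tau>"
proof -
  have it: "s M \<le> \<eta> ^ r * s (M + r) + 2 * \<tau> * (1 - (1 / 2) ^ r)" for r
  proof (induction r)
    case (Suc r)
    have "\<eta> ^ r * s (M + r) \<le> \<eta> ^ r * (\<eta> * s (Suc (M + r)) + \<tau>)"
      using assms by (intro mult_left_mono) auto
    also have "\<dots> = \<eta> ^ Suc r * s (M + Suc r) + \<eta> ^ r * \<tau>"
      by (simp add: algebra_simps)
    also have "\<eta> ^ r * \<tau> \<le> (1 / 2) ^ r * \<tau>"
      using assms by (intro mult_right_mono power_mono) auto
    finally show ?case using Suc by (simp add: algebra_simps)
  qed simp
  have "s M \<le> P * Q ^ M * (\<eta> * Q) ^ r + 2 * \<tau>" for r
  proof -
    have "\<eta> ^ r * s (M + r) \<le> \<eta> ^ r * (P * Q ^ (M + r))"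
      using assms by (intro mult_left_mono) auto
    moreover have "2 * \<tau> * (1 - (1 / 2) ^ r) \<le> 2 * \<tau>"
      using assms by (intro mult_right_le_one_le) (auto simp: power_le_one)
    ultimately show ?thesis using it [of r] by (simp add: power_add power_mult_distrib mult_ac)
  qed
  moreover have "(\<lambda>r. P * Q ^ M * (\<eta> * Q) ^ r + 2 * \<tau>) \<longlonglongrightarrow> P * Q ^ M * 0 + 2 * \<tau>"
    using assms by (intro tendsto_intros LIMSEQ_realpow_zero) auto
  ultimately show ?thesis
    by (intro LIMSEQ_le_const [of _ "2 * \<tau>"]) auto
qed

section \<open>Inequalities for powers and for extended double series\<close>

lemma powr_add_le:
  fixes x y q :: real
  assumes "0 \<le> x" "0 \<le> y" "0 \<le> q"
  shows "(x + y) powr q \<le> 2 powr q * (x powr q + y powr q)"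
proof -
  have "(x + y) powr q \<le> (2 * max x y) powr q"
    using assms by (intro powr_mono2) auto
  also have "\<dots> = 2 powr q * (max x y) powr q"
    using assms by (simp add: powr_mult)
  also have "\<dots> \<le> 2 powr q * (x powr q + y powr q)"
    by (intro mult_left_mono) (auto simp: max_def)
  finally show ?thesis .
qed

text \<open>A power varies by a bounded factor on an interval with endpoint ratio \<open>L\<close>.
  The absolute value in the exponent covers increasing and decreasing weights alike, as the weight
  exponent \<open>q / p' - 1\<close> may have either sign.\<close>

lemma powr_doubling_upper:
  fixes u S k L :: real
  assumes "0 < S" "S \<le> u" "u \<le> L * S" "1 \<le> L"
  shows "u powr k \<le> L powr \<bar>k\<bar> * S powr k"
proof (cases "0 \<le> k")
  case True
  then have "u powr k \<le> (L * S) powr k" using assms by (intro powr_mono2) auto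
  then show ?thesis using True assms by (simp add: powr_mult)
next
  case False
  then have "u powr k \<le> S powr k" using assms by (intro powr_mono2') auto
  also have "\<dots> \<le> L powr \<bar>k\<bar> * S powr k"
    using assms mult_right_mono [of 1 "L powr \<bar>k\<bar>" "S powr k"] by (simp add: ge_one_powr_ge_zero)
  finally show ?thesis .
qed

lemma powr_doubling_lower:
  fixes u S k L :: real
  assumes "0 < S" "S \<le> u" "u \<le> L * S" "1 \<le> L"
  shows "S powr k \<le> L powr \<bar>k\<bar> * u powr k"
proof (cases "0 \<le> k")
  case True
  then have "S powr k \<le> u powr k" using assms by (intro powr_mono2) auto
  also have "\<dots> \<le> L powr \<bar>k\<bar> * u powr k"
    using assms mult_right_mono [of 1 "L powr \<bar>k\<bar>" "u powr k"] by (simp add: ge_one_powr_ge_zero)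
  finally show ?thesis .
next
  case False
  have "S powr k = L powr - k * (L * S) powr k" using assms by (simp add: powr_mult powr_minus)
  also have "\<dots> \<le> L powr - k * u powr k"
    using False assms by (intro mult_left_mono powr_mono2') auto
  finally show ?thesis using False by simp
qed

lemma finite_sum_le_nn_integral_count_space:
  fixes f :: "'a \<Rightarrow> ennreal"
  assumes "finite F"
  shows "sum f F \<le> (\<integral>\<^sup>+x. f x \<partial>count_space UNIV)"
proof -
  have "sum f F = (\<integral>\<^sup>+x. f x \<partial>count_space F)"
    using assms by (simp add: nn_integral_count_space_finite)
  also have "\<dots> = (\<integral>\<^sup>+x. f x * indicator F x \<partial>count_space UNIV)"
    by (rule nn_integral_count_space_indicator) simp
  also have "\<dots> \<le> (\<integral>\<^sup>+x. f x \<partial>count_space UNIV)"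
    by (intro nn_integral_mono) (auto simp: indicator_def)
  finally show ?thesis .
qed

lemma nn_integral_nat_pair_le:
  fixes f :: "nat \<times> nat \<Rightarrow> ennreal"
  assumes "\<And>M. sum f ({..<M} \<times> {..<M}) \<le> K"
  shows "(\<integral>\<^sup>+x. f x \<partial>count_space UNIV) \<le> K"
proof -
  have "(\<integral>\<^sup>+x. f x \<partial>count_space UNIV) = (\<Sum>I. \<Sum>J. f (I, J))"
    by (simp add: nn_integral_nat_pair)
  also have "\<dots> \<le> K"
  proof (intro suminf_le_const)
    fix M
    have "(\<Sum>I<M. \<Sum>J. f (I, J)) = (\<Sum>J. \<Sum>I<M. f (I, J))"
      by (rule suminf_sum [symmetric]) simp
    also have "\<dots> \<le> K"
    proof (intro suminf_le_const)
      fix M'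
      have "(\<Sum>J<M'. \<Sum>I<M. f (I, J)) = sum f ({..<M} \<times> {..<M'})"
        by (subst sum.swap) (simp add: sum.cartesian_product)
      also have "\<dots> \<le> sum f ({..<max M M'} \<times> {..<max M M'})"
        by (intro sum_mono2) auto
      finally show "(\<Sum>J<M'. \<Sum>I<M. f (I, J)) \<le> K" using assms by (rule order_trans)
    qed auto
    finally show "(\<Sum>I<M. \<Sum>J. f (I, J)) \<le> K" .
  qed auto
  finally show ?thesis .
qed

lemma suminf_inj_le:
  fixes f :: "nat \<Rightarrow> ennreal"
  assumes "inj g"
  shows "(\<Sum>j. f (g j)) \<le> suminf f"
proof (rule suminf_le_const)
  fix K
  have "(\<Sum>j<K. f (g j)) = sum f (g ` {..<K})"
    using assms by (subst sum.reindex) (auto intro: inj_on_subset)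
  also have "\<dots> \<le> suminf f"
    by (intro sum_le_suminf) auto
  finally show "(\<Sum>j<K. f (g j)) \<le> suminf f" .
qed auto

text \<open>Truncated subtraction sends both \<open>0\<close> and \<open>1\<close> to
  \<open>0\<close>; the repeated term accounts for the factor \<open>2\<close>.\<close>

lemma suminf_pred_le:
  fixes f :: "nat \<Rightarrow> ennreal"
  shows "(\<Sum>j. f (j - 1)) \<le> 2 * suminf f"
proof -
  have "(\<Sum>j. f (j - 1)) = f 0 + suminf f"
    using suminf_offset [of "\<lambda>j. f (j - 1)" 1] by simp
  also have "f 0 \<le> suminf f"
    using sum_le_suminf [of f "{0}"] by simp
  finally show ?thesis by (simp add: mult_2 add_right_mono)
qed

lemma double_suminf_dyadic:
  fixes h :: "nat \<Rightarrow> nat \<Rightarrow> ennreal"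
  shows "(\<Sum>m. \<Sum>n. h (Suc m) (Suc n)) = (\<Sum>I. \<Sum>J. \<Sum>m\<in>dyadic I. \<Sum>n\<in>dyadic J. h m n)"
proof -
  have "(\<Sum>m. \<Sum>n. h (Suc m) (Suc n)) = (\<Sum>m. \<Sum>J. \<Sum>n\<in>dyadic J. h (Suc m) n)"
    by (simp add: suminf_dyadic [of "h _"])
  also have "\<dots> = (\<Sum>I. \<Sum>m\<in>dyadic I. \<Sum>J. \<Sum>n\<in>dyadic J. h m n)"
    by (rule suminf_dyadic)
  also have "\<dots> = (\<Sum>I. \<Sum>J. \<Sum>m\<in>dyadic I. \<Sum>n\<in>dyadic J. h m n)"
    by (subst suminf_sum) auto
  finally show ?thesis .
qed

text \<open>Abstract form of what testing against Dirichlet kernels yields: a bound for coefficient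
  sums over rectangles of limited size. Their position must be free, since the good subblock is
  found by pigeonhole.\<close>

definition block_bound :: "(nat \<Rightarrow> nat \<Rightarrow> real) \<Rightarrow> (nat \<times> nat \<Rightarrow> real) \<Rightarrow> bool" where
  "block_bound a T \<longleftrightarrow> (\<forall>I J m0 n0 r s. 1 \<le> m0 \<longrightarrow> 1 \<le> n0 \<longrightarrow> r \<le> 2 ^ I \<longrightarrow> s \<le> 2 ^ J \<longrightarrow>
     \<bar>\<Sum>m=m0..<m0 + r. \<Sum>n=n0..<n0 + s. a m n\<bar> \<le> dscale (I, J) * T (I, J))"

text \<open>With \<open>\<sigma> = 1 / p'\<close>, a block of \<open>dscale x\<close> entries of
  size \<open>alpha\<close> and weight \<open>dscale x powr (q * \<sigma> - 1)\<close> contributes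
  \<open>wcoeff \<sigma> a x powr q\<close>. This is the block form of the coefficient norm.\<close>

definition wcoeff :: "real \<Rightarrow> (nat \<Rightarrow> nat \<Rightarrow> real) \<Rightarrow> nat \<times> nat \<Rightarrow> real" where
  "wcoeff \<sigma> a x = dscale x powr \<sigma> * alpha a (fst x) (snd x)"

lemma wcoeff_nonneg [simp]: "0 \<le> wcoeff \<sigma> a x"
  by (simp add: wcoeff_def)

lemma block_bound_nonneg: "block_bound a T \<Longrightarrow> 0 \<le> T x"
proof -
  assume "block_bound a T"
  from this [unfolded block_bound_def, rule_format, of 1 1 0 "fst x" 0 "snd x"]
  have "0 \<le> dscale x * T x" by simp
  moreover have "0 < dscale x" by simp
  ultimately show "0 \<le> T x" by (meson mult_pos_neg not_le)
qed

lemma tends_to_zero2_bounded: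
  assumes "tends_to_zero2 a"
  obtains B where "0 < B" "\<And>m n. 1 \<le> m \<Longrightarrow> 1 \<le> n \<Longrightarrow> \<bar>a m n\<bar> \<le> B"
proof -
  obtain N where N: "\<And>m n. 1 \<le> m \<Longrightarrow> 1 \<le> n \<Longrightarrow> N \<le> m + n \<Longrightarrow> \<bar>a m n\<bar> < 1"
    using assms unfolding tends_to_zero2_def by (metis zero_less_one)
  define B where "B = 1 + (\<Sum>m<N. \<Sum>n<N. \<bar>a m n\<bar>)"
  have "\<bar>a m n\<bar> \<le> B" if "1 \<le> m" "1 \<le> n" for m n
  proof (cases "N \<le> m + n")
    case True
    then have "\<bar>a m n\<bar> \<le> 1" using N that by (simp add: less_imp_le)
    then show ?thesis unfolding B_def by (intro add_increasing2) (auto intro!: sum_nonneg)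
  next
    case False
    then have "\<bar>a m n\<bar> \<le> (\<Sum>n<N. \<bar>a m n\<bar>)" by (intro member_le_sum) auto
    also have "\<dots> \<le> (\<Sum>m<N. \<Sum>n<N. \<bar>a m n\<bar>)"
      using False by (intro member_le_sum [of m _ "\<lambda>m. \<Sum>n<N. \<bar>a m n\<bar>"]) (auto intro!: sum_nonneg)
    finally show ?thesis by (simp add: B_def)
  qed
  moreover have "0 < B"
    unfolding B_def by (intro add_pos_nonneg sum_nonneg) auto
  ultimately show thesis by (rule that [rotated])
qed

context gm_sequence
begin

text \<open>The corner in the error term: \<open>(I - 1, J - 1)\<close> for \<open>e = 0\<close>,
  with truncated subtraction, but \<open>(I + 1, J - 1)\<close> for \<open>e = 1\<close>, so that
  its iterates run off to infinity in the first variable.\<close>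

definition nbr :: "nat \<times> nat \<Rightarrow> nat \<times> nat" where
  "nbr x = (fst x + e - 1 + e, snd x - 1)"

lemma dscale_nbr: "dscale x \<le> 4 * dscale (nbr x)" "dscale (nbr x) \<le> 2 * dscale x"
proof -
  have 1: "(2::real) ^ i \<le> 2 * 2 ^ (i - 1)" "(2::real) ^ (i - 1) \<le> 2 ^ i" for i
    by (cases i; simp)+
  have 2: "(2::real) ^ i \<le> 2 * 2 ^ (i + e - 1 + e)" "(2::real) ^ (i + e - 1 + e) \<le> 2 * 2 ^ i" for i
  proof -
    consider "e = 0" | "e = 1" using e by linarith
    then show "(2::real) ^ i \<le> 2 * 2 ^ (i + e - 1 + e)" using 1 [of i] by cases auto
  next
    consider "e = 0" | "e = 1" using e by linarith
    moreover have "(2::real) ^ (i - 1) \<le> 2 * 2 ^ i" by (cases i) auto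
    ultimately show "(2::real) ^ (i + e - 1 + e) \<le> 2 * 2 ^ i" by cases auto
  qed
  have "dscale x \<le> (2 * 2 ^ (fst x + e - 1 + e)) * (2 * 2 ^ (snd x - 1))"
    unfolding dscale_def by (intro mult_mono 1 2) auto
  then show "dscale x \<le> 4 * dscale (nbr x)" by (simp add: dscale_def nbr_def)
  have "dscale (nbr x) \<le> (2 * 2 ^ fst x) * 2 ^ snd x"
    unfolding dscale_def nbr_def fst_conv snd_conv by (intro mult_mono 1 2) auto
  then show "dscale (nbr x) \<le> 2 * dscale x" by (simp add: dscale_def)
qed

text \<open>The block estimate multiplied by \<open>dscale x powr \<sigma>\<close>. Passing to the
  neighbour costs at most \<open>4 powr \<sigma> \<le> 4\<close>, which with \<open>2 * C\<close>
  gives \<open>8 * C\<close>; the factor \<open>1 / real N\<close> is the one that can be made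
  small.\<close>

lemma wcoeff_recursion:
  assumes T: "block_bound a T" and N: "1 \<le> N" and s: "0 < \<sigma>" "\<sigma> < 1"
  shows "wcoeff \<sigma> a x \<le> 8 * C * (1 + 2 * C) / real N * wcoeff \<sigma> a (nbr x)
    + 16 * (1 + 2 * C) * (real N)\<^sup>2 * (dscale (fst x + e, snd x) powr \<sigma> * T (fst x + e, snd x))"
proof -
  define y where "y = (fst x + e, snd x)"
  have le: "alpha a (fst x) (snd x) \<le> (1 + 2 * C) * (2 * C / real N * alpha a (fst (nbr x)) (snd (nbr x)) + 16 * (real N)\<^sup>2 * T y)"
    unfolding nbr_def y_def fst_conv snd_conv using T
    by (intro alpha_le_block_sum N) (auto simp: block_bound_def dscale_def)
  have "dscale x powr \<sigma> \<le> (4 * dscale (nbr x)) powr \<sigma>"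
    using s by (intro powr_mono2 dscale_nbr) (auto intro: less_imp_le)
  also have "\<dots> = 4 powr \<sigma> * dscale (nbr x) powr \<sigma>"
    by (simp add: powr_mult less_imp_le)
  also have "\<dots> \<le> 4 * dscale (nbr x) powr \<sigma>"
    using s powr_mono [of \<sigma> 1 4] by (intro mult_right_mono) auto
  finally have 1: "dscale x powr \<sigma> \<le> 4 * dscale (nbr x) powr \<sigma>" .
  have 2: "dscale x powr \<sigma> \<le> dscale y powr \<sigma>"
    unfolding y_def dscale_def using s by (intro powr_mono2) (auto intro!: mult_right_mono)
  have "wcoeff \<sigma> a x \<le> dscale x powr \<sigma> * ((1 + 2 * C) * (2 * C / real N * alpha a (fst (nbr x)) (snd (nbr x)) + 16 * (real N)\<^sup>2 * T y))"
    unfolding wcoeff_def by (intro mult_left_mono le) auto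
  also have "\<dots> = dscale x powr \<sigma> * ((1 + 2 * C) * (2 * C / real N) * alpha a (fst (nbr x)) (snd (nbr x)))
      + dscale x powr \<sigma> * ((1 + 2 * C) * 16 * (real N)\<^sup>2 * T y)"
    by (simp add: algebra_simps)
  also have "\<dots> \<le> 4 * dscale (nbr x) powr \<sigma> * ((1 + 2 * C) * (2 * C / real N) * alpha a (fst (nbr x)) (snd (nbr x)))
      + dscale y powr \<sigma> * ((1 + 2 * C) * 16 * (real N)\<^sup>2 * T y)"
    using C block_bound_nonneg [OF T] by (intro add_mono mult_right_mono 1 2) auto
  also have "\<dots> = 8 * C * (1 + 2 * C) / real N * wcoeff \<sigma> a (nbr x)
      + 16 * (1 + 2 * C) * (real N)\<^sup>2 * (dscale y powr \<sigma> * T y)"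
    by (simp add: wcoeff_def algebra_simps add_divide_distrib)
  finally show ?thesis by (simp add: y_def)
qed

text \<open>Bounded coefficients and \<open>\<sigma> < 1\<close> suffice. The constant
  \<open>B\<close> depends on the sequence, the rate of growth does not, and only the rate
  influences the choice of \<open>N\<close>.\<close>

lemma wcoeff_growth:
  assumes s: "0 < \<sigma>" "\<sigma> < 1"
  obtains B where "0 < B" "\<And>x. wcoeff \<sigma> a x \<le> B * dscale x"
proof -
  obtain B where B: "0 < B" "\<And>m n. 1 \<le> m \<Longrightarrow> 1 \<le> n \<Longrightarrow> \<bar>a m n\<bar> \<le> B"
    using tends_to_zero2_bounded [OF tz] by blast
  have "wcoeff \<sigma> a x \<le> B * dscale x" for x
  proof -
    have "1 \<le> dscale x" unfolding dscale_def by (simp add: mult_ge1_I)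
    then have "dscale x powr \<sigma> \<le> dscale x"
      using s powr_mono [of \<sigma> 1 "dscale x"] by simp
    then have "wcoeff \<sigma> a x \<le> dscale x * B"
      unfolding wcoeff_def alpha_def by (intro mult_mono B) (auto intro: less_imp_le)
    then show ?thesis by (simp add: mult.commute)
  qed
  with B(1) show thesis by (rule that)
qed

text \<open>Each coordinate map repeats a value at most once, whence \<open>2 * 2\<close>; the
  enlargement to \<open>Suc M\<close> accommodates the outward shift for
  \<open>e = 1\<close>.\<close>

lemma sum_nbr_le:
  fixes g :: "nat \<times> nat \<Rightarrow> real"
  assumes g: "\<And>x. 0 \<le> g x"
  shows "(\<Sum>x\<in>{..<M} \<times> {..<M}. g (nbr x)) \<le> 4 * (\<Sum>x\<in>{..<Suc M} \<times> {..<Suc M}. g x)"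
proof -
  have pred: "(\<Sum>i<M. f (i - 1)) \<le> 2 * (\<Sum>i<Suc M. f i)" if f: "\<And>i. 0 \<le> f i" for f :: "nat \<Rightarrow> real"
  proof (cases M)
    case (Suc M')
    have "(\<Sum>i<M. f (i - 1)) = f 0 + (\<Sum>i<M'. f i)"
      unfolding Suc by (subst sum.lessThan_Suc_shift) simp
    also have "f 0 \<le> (\<Sum>i<Suc M. f i)" using f by (intro member_le_sum) auto
    also have "(\<Sum>i<M'. f i) \<le> (\<Sum>i<Suc M. f i)" using f Suc by (intro sum_mono2) auto
    finally show ?thesis by simp
  qed (use f in simp)
  have shift: "(\<Sum>i<M. f (i + e - 1 + e)) \<le> 2 * (\<Sum>i<Suc M. f i)" if f: "\<And>i. 0 \<le> f i" for f :: "nat \<Rightarrow> real"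
  proof (cases "e = 0")
    case True
    then show ?thesis using pred [of f] f by simp
  next
    case False
    then have "e = 1" using e by simp
    then have "(\<Sum>i<M. f (i + e - 1 + e)) = (\<Sum>i<M. f (Suc i))" by simp
    also have "\<dots> \<le> (\<Sum>i<Suc M. f i)"
      using f [of 0] by (subst sum.lessThan_Suc_shift) simp
    also have "\<dots> \<le> 2 * (\<Sum>i<Suc M. f i)"
      using sum_nonneg [of "{..<Suc M}" f] f by simp
    finally show ?thesis .
  qed
  have "(\<Sum>x\<in>{..<M} \<times> {..<M}. g (nbr x)) = (\<Sum>i<M. \<Sum>j<M. g (i + e - 1 + e, j - 1))"
    by (simp add: sum.cartesian_product nbr_def case_prod_beta)
  also have "\<dots> \<le> 2 * (\<Sum>i<Suc M. \<Sum>j<M. g (i, j - 1))"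
    using g by (intro shift sum_nonneg) auto
  also have "\<dots> \<le> 2 * (\<Sum>i<Suc M. 2 * (\<Sum>j<Suc M. g (i, j)))"
    using g by (intro mult_left_mono sum_mono pred) auto
  also have "\<dots> = 4 * (\<Sum>x\<in>{..<Suc M} \<times> {..<Suc M}. g x)"
    by (simp add: sum_distrib_left [symmetric] sum.cartesian_product del: sum.lessThan_Suc)
  finally show ?thesis .
qed

end

section \<open>Coefficient sums over dyadic blocks\<close>

text \<open>The truncated sums of \<open>wcoeff powr q\<close> over growing squares of block indices
  satisfy the hypotheses of the absorption lemma. \<open>N\<close> is chosen from \<open>C\<close>
  and \<open>q\<close> alone, so \<open>c\<close> serves all sequences of both classes.\<close>

lemma wcoeff_powr_le_blocks:
  fixes q \<sigma> C :: real
  assumes q: "1 \<le> q" and s: "0 < \<sigma>" "\<sigma> < 1" and C: "1 \<le> C"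
  obtains c where "0 < c"
    "\<And>a e T. gm_sequence a C e \<Longrightarrow> block_bound a T \<Longrightarrow>
      psum (\<lambda>x. wcoeff \<sigma> a x powr q)
      \<le> ennreal c * psum (\<lambda>x. (dscale x powr \<sigma> * T x) powr q)"
proof -
  define c0 where "c0 = 8 * C * (1 + 2 * C)"
  \<comment> \<open>Growth rate of the truncated sums: \<open>M * M \<le> 4 ^ M\<close> terms, each
    at most \<open>(B * 4 ^ M) powr q\<close>.\<close>
  define Q where "Q = 4 * 4 powr q"
  define N where "N = nat \<lceil>16 * c0 * Q\<rceil> + 1"
  define K2 where "K2 = 16 * (1 + 2 * C) * (real N)\<^sup>2"
  \<comment> \<open>The leading \<open>4\<close> is the overlap count of the neighbour map, the
    inner \<open>2\<close> comes from splitting the power of a sum. The choice of \<open>N\<close>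
    gives \<open>\<eta> * Q \<le> 1 / 2\<close>.\<close>
  define \<eta> where "\<eta> = 4 * (2 * c0 / real N) powr q"
  have c0: "0 < c0" using C by (simp add: c0_def)
  have Q: "4 \<le> Q" using q by (simp add: Q_def ge_one_powr_ge_zero)
  have N1: "1 \<le> N" by (simp add: N_def)
  have NQ: "16 * c0 * Q \<le> real N" unfolding N_def by linarith
  have "4 * c0 \<le> c0 * Q" using Q c0 by simp
  then have "2 * c0 \<le> real N" using NQ c0 by linarith
  then have "2 * c0 / real N \<le> 1" using N1 by simp
  then have "(2 * c0 / real N) powr q \<le> (2 * c0 / real N) powr 1"
    using powr_mono' [of 1 q "2 * c0 / real N"] q c0 by simp
  then have "\<eta> \<le> 4 * (2 * c0 / real N)"
    using c0 by (simp add: \<eta>_def)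
  also have "\<dots> \<le> 1 / (2 * Q)"
    using NQ N1 Q by (simp add: field_simps)
  finally have eta: "\<eta> \<le> 1 / (2 * Q)" .
  have eta0: "0 \<le> \<eta>" by (simp add: \<eta>_def)
  have "1 / (2 * Q) \<le> 1 / 2" using Q by (simp add: field_simps)
  then have eta1: "\<eta> \<le> 1 / 2" using eta by linarith
  have etaQ: "\<eta> * Q < 1"
    using mult_right_mono [OF eta, of Q] Q by simp
  define c where "c = 2 * (2 powr q * K2 powr q)"
  have K2: "0 < K2" using C N1 by (simp add: K2_def)
  have c: "0 < c" using K2 by (simp add: c_def)
  have "psum (\<lambda>x. wcoeff \<sigma> a x powr q)
      \<le> ennreal c * psum (\<lambda>x. (dscale x powr \<sigma> * T x) powr q)"
    if "gm_sequence a C e" and T: "block_bound a T" for a e T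
  proof -
    interpret gm_sequence a C e by fact
    define t where "t x = dscale x powr \<sigma> * T x" for x
    have t0: "0 \<le> t x" for x using block_bound_nonneg [OF T] by (simp add: t_def)
    define sh where "sh x = (fst x + e, snd x)" for x :: "nat \<times> nat"
    let ?I = "psum (\<lambda>x. t x powr q)"
    show ?thesis
    proof (cases ?I)
      case top
      then show ?thesis using c by (simp add: t_def ennreal_mult_top)
    next
      case (real tot)
      define S where "S M = (\<Sum>x\<in>{..<M} \<times> {..<M}. wcoeff \<sigma> a x powr q)" for M :: nat
      obtain B where B: "0 < B" "\<And>x. wcoeff \<sigma> a x \<le> B * dscale x"
        using wcoeff_growth [OF s] by blast
      have rec: "wcoeff \<sigma> a x \<le> c0 / real N * wcoeff \<sigma> a (nbr x) + K2 * t (sh x)" for x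
        using wcoeff_recursion [OF T N1 s, of x] by (simp add: c0_def K2_def t_def sh_def)
      have rec_q: "wcoeff \<sigma> a x powr q
          \<le> \<eta> / 4 * wcoeff \<sigma> a (nbr x) powr q + 2 powr q * K2 powr q * t (sh x) powr q" for x
      proof -
        have "wcoeff \<sigma> a x powr q \<le> (c0 / real N * wcoeff \<sigma> a (nbr x) + K2 * t (sh x)) powr q"
          using q by (intro powr_mono2 rec) auto
        also have "\<dots> \<le> 2 powr q * ((c0 / real N * wcoeff \<sigma> a (nbr x)) powr q + (K2 * t (sh x)) powr q)"
          using q c0 K2 t0 by (intro powr_add_le) auto
        also have "\<dots> = \<eta> / 4 * wcoeff \<sigma> a (nbr x) powr q + 2 powr q * K2 powr q * t (sh x) powr q"
          using c0 K2 t0 by (simp add: powr_mult powr_divide \<eta>_def algebra_simps)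
        finally show ?thesis .
      qed
      have tsum: "(\<Sum>x\<in>{..<M} \<times> {..<M}. t (sh x) powr q) \<le> tot" for M :: nat
      proof -
        have "inj_on sh ({..<M} \<times> {..<M})" by (auto simp: inj_on_def sh_def)
        then have "ennreal (\<Sum>x\<in>{..<M} \<times> {..<M}. t (sh x) powr q) = (\<Sum>x\<in>sh ` ({..<M} \<times> {..<M}). ennreal (t x powr q))"
          by (simp add: sum.reindex sum_ennreal)
        also have "\<dots> \<le> ?I" by (rule finite_sum_le_nn_integral_count_space) simp
        finally show ?thesis using real by simp
      qed
      have "S M \<le> 2 * (2 powr q * K2 powr q * tot)" for M
      proof (rule absorb_iteration [OF _ _ eta0 eta1 _ etaQ])
        fix M
        have "S M \<le> (\<Sum>x\<in>{..<M} \<times> {..<M}. \<eta> / 4 * wcoeff \<sigma> a (nbr x) powr q + 2 powr q * K2 powr q * t (sh x) powr q)"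
          unfolding S_def by (intro sum_mono rec_q)
        also have "\<dots> = \<eta> / 4 * (\<Sum>x\<in>{..<M} \<times> {..<M}. wcoeff \<sigma> a (nbr x) powr q)
            + 2 powr q * K2 powr q * (\<Sum>x\<in>{..<M} \<times> {..<M}. t (sh x) powr q)"
          by (simp add: sum.distrib sum_distrib_left)
        also have "\<dots> \<le> \<eta> / 4 * (4 * S (Suc M)) + 2 powr q * K2 powr q * tot"
          unfolding S_def using eta0 by (intro add_mono mult_left_mono sum_nbr_le tsum) auto
        finally show "S M \<le> \<eta> * S (Suc M) + 2 powr q * K2 powr q * tot" by simp
      next
        fix M
        have "S M \<le> (\<Sum>x\<in>{..<M} \<times> {..<M}. (B * 4 ^ M) powr q)"
          unfolding S_def
        proof (intro sum_mono powr_mono2)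
          fix x :: "nat \<times> nat" assume "x \<in> {..<M} \<times> {..<M}"
          then have "dscale x \<le> 2 ^ M * 2 ^ M"
            unfolding dscale_def by (intro mult_mono power_increasing) auto
          then have "B * dscale x \<le> B * 4 ^ M"
            using B by (intro mult_left_mono) (auto simp: power_mult_distrib [symmetric])
          with B(2) show "wcoeff \<sigma> a x \<le> B * 4 ^ M" by (rule order_trans)
        qed (use q in auto)
        also have "\<dots> = real (M * M) * (B * 4 ^ M) powr q" by simp
        also have "\<dots> \<le> 4 ^ M * (B * 4 ^ M) powr q"
        proof (intro mult_right_mono)
          have "M * M \<le> 2 ^ M * 2 ^ M" by (intro mult_mono) (auto intro: less_imp_le)
          also have "\<dots> = 4 ^ M" by (simp add: power_mult_distrib [symmetric])
          finally show "real (M * M) \<le> 4 ^ M"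
            using of_nat_mono [of "M * M" "4 ^ M", where ?'a = real] by simp
        qed auto
        also have "(B * 4 ^ M) powr q = B powr q * (4 powr q) ^ M"
          using B by (simp add: powr_mult powr_power powr_powr flip: powr_realpow) (simp add: mult.commute)
        finally show "S M \<le> B powr q * Q ^ M" by (simp add: Q_def power_mult_distrib mult_ac)
      qed (use Q K2 real in auto)
      then have "ennreal (S M) \<le> ennreal (c * tot)" for M
        by (intro ennreal_leI) (simp add: c_def mult.assoc)
      then have "psum (\<lambda>x. wcoeff \<sigma> a x powr q) \<le> ennreal (c * tot)"
        by (intro nn_integral_nat_pair_le) (simp add: S_def sum_ennreal)
      also have "\<dots> = ennreal c * ennreal tot" using c real by (simp add: ennreal_mult)
      finally show ?thesis using real by (simp add: t_def)
    qed
  qed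
  with c show thesis by (rule that)
qed

text \<open>For the supremum there is nothing to sum: the recursion is followed along the orbit of
  one index under \<open>nbr\<close>. A step at most doubles \<open>dscale\<close>, so the growth
  rate is \<open>2\<close> and \<open>c0 / real N \<le> 1 / 4\<close> is small enough.\<close>

lemma wcoeff_le_blocks:
  fixes \<sigma> C :: real
  assumes s: "0 < \<sigma>" "\<sigma> < 1" and C: "1 \<le> C"
  obtains c where "0 < c"
    "\<And>a e T F x. gm_sequence a C e \<Longrightarrow> block_bound a T \<Longrightarrow> (\<And>x. dscale x powr \<sigma> * T x \<le> F)
      \<Longrightarrow> wcoeff \<sigma> a x \<le> c * F"
proof -
  define c0 where "c0 = 8 * C * (1 + 2 * C)"
  define N where "N = nat \<lceil>4 * c0\<rceil> + 1"
  define K2 where "K2 = 16 * (1 + 2 * C) * (real N)\<^sup>2"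
  have c0: "0 < c0" using C by (simp add: c0_def)
  have N1: "1 \<le> N" by (simp add: N_def)
  have "4 * c0 \<le> real N" unfolding N_def by linarith
  then have eta: "c0 / real N \<le> 1 / 4" using N1 by (simp add: field_simps)
  have K2: "0 < K2" using C N1 by (simp add: K2_def)
  have "wcoeff \<sigma> a x \<le> 2 * K2 * F"
    if "gm_sequence a C e" and T: "block_bound a T" and F: "\<And>x. dscale x powr \<sigma> * T x \<le> F" for a e T F x
  proof -
    interpret gm_sequence a C e by fact
    obtain B where B: "0 < B" "\<And>x. wcoeff \<sigma> a x \<le> B * dscale x"
      using wcoeff_growth [OF s] by blast
    have F0: "0 \<le> F" using F [of x] block_bound_nonneg [OF T, of x]
      by (meson dual_order.trans mult_nonneg_nonneg powr_ge_zero)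
    have "wcoeff \<sigma> a ((nbr ^^ 0) x) \<le> 2 * (K2 * F)"
    proof (rule absorb_iteration [of "\<lambda>r. wcoeff \<sigma> a ((nbr ^^ r) x)" "c0 / real N" "K2 * F" "B * dscale x" 2])
      fix r
      let ?y = "(nbr ^^ r) x"
      have "wcoeff \<sigma> a ?y \<le> c0 / real N * wcoeff \<sigma> a (nbr ?y)
          + K2 * (dscale (fst ?y + e, snd ?y) powr \<sigma> * T (fst ?y + e, snd ?y))"
        using wcoeff_recursion [OF T N1 s, of ?y] by (simp add: c0_def K2_def)
      also have "\<dots> \<le> c0 / real N * wcoeff \<sigma> a (nbr ?y) + K2 * F"
        using K2 by (intro add_left_mono mult_left_mono F) auto
      finally show "wcoeff \<sigma> a ?y \<le> c0 / real N * wcoeff \<sigma> a ((nbr ^^ Suc r) x) + K2 * F"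
        by simp
    next
      fix r
      have "dscale ((nbr ^^ r) x) \<le> dscale x * 2 ^ r"
      proof (induction r)
        case (Suc r)
        then show ?case using dscale_nbr(2) [of "(nbr ^^ r) x"] by simp
      qed simp
      then have "B * dscale ((nbr ^^ r) x) \<le> B * dscale x * 2 ^ r"
        using B by simp
      with B(2) show "wcoeff \<sigma> a ((nbr ^^ r) x) \<le> B * dscale x * 2 ^ r" by (rule order_trans)
    next
      show "c0 / real N \<le> 1 / 2" using eta by linarith
      show "c0 / real N * 2 < 1" using eta by linarith
    qed (use c0 K2 F0 in auto)
    then show ?thesis by simp
  qed
  moreover have "0 < 2 * K2" using K2 by simp
  ultimately show thesis by (rule that [rotated])
qed

definition coeff_powr_sum :: "real \<Rightarrow> real \<Rightarrow> (nat \<Rightarrow> nat \<Rightarrow> real) \<Rightarrow> ennreal" where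
  "coeff_powr_sum \<sigma> q a = (\<Sum>m. \<Sum>n. ennreal (\<bar>a (Suc m) (Suc n)\<bar> powr q
     * (real (Suc m) * real (Suc n)) powr (q * \<sigma> - 1)))"

context gm_sequence
begin

text \<open>Every entry of a block is at most a constant times \<open>alpha a (I + e) J\<close>, and
  the number of entries turns the exponent \<open>q * \<sigma> - 1\<close> into
  \<open>q * \<sigma>\<close>. The index shift by \<open>e\<close> is injective and costs nothing in
  the sum.\<close>

lemma coeff_powr_sum_le:
  assumes q: "1 \<le> q" and s: "0 < \<sigma>"
  shows "coeff_powr_sum \<sigma> q a
    \<le> ennreal (4 powr \<bar>q * \<sigma> - 1\<bar> * (1 + 2 * C) powr q) * psum (\<lambda>x. wcoeff \<sigma> a x powr q)"
proof -
  define \<kappa> where "\<kappa> = q * \<sigma> - 1"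
  define c where "c = 4 powr \<bar>\<kappa>\<bar> * (1 + 2 * C) powr q"
  have c0: "0 \<le> c" by (simp add: c_def)
  define h where "h m n = \<bar>a m n\<bar> powr q * (real m * real n) powr \<kappa>" for m n
  have h0: "0 \<le> h m n" for m n by (simp add: h_def)
  have block: "(\<Sum>m\<in>dyadic I. \<Sum>n\<in>dyadic J. ennreal (h m n))
      \<le> ennreal c * ennreal (wcoeff \<sigma> a (I + e, J) powr q)" for I J
  proof -
    define S where "S = dscale (I, J)"
    have S: "0 < S" by (simp add: S_def)
    have "h m n \<le> c * (alpha a (I + e) J powr q * S powr \<kappa>)" if "m \<in> dyadic I" "n \<in> dyadic J" for m n
    proof -
      have bnd: "2 ^ I \<le> real m" "real m \<le> 2 * 2 ^ I" "2 ^ J \<le> real n" "real n \<le> 2 * 2 ^ J"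
        using that by (auto simp: dyadic_def numeral_power_le_of_nat_cancel_iff
            dest!: less_imp_le [of m] less_imp_le [of n] of_nat_mono [where ?'a = real])
      have "S \<le> real m * real n" unfolding S_def dscale_def fst_conv snd_conv
        using bnd by (intro mult_mono) auto
      moreover have "real m * real n \<le> (2 * 2 ^ I) * (2 * 2 ^ J)"
        using bnd by (intro mult_mono) auto
      then have "real m * real n \<le> 4 * S" by (simp add: S_def dscale_def)
      ultimately have "(real m * real n) powr \<kappa> \<le> 4 powr \<bar>\<kappa>\<bar> * S powr \<kappa>"
        using S by (intro powr_doubling_upper) auto
      moreover have "\<bar>a m n\<bar> powr q \<le> ((1 + 2 * C) * alpha a (I + e) J) powr q"
        using q that by (intro powr_mono2 abs_le_alpha) auto
      ultimately have "h m n \<le> ((1 + 2 * C) * alpha a (I + e) J) powr q * (4 powr \<bar>\<kappa>\<bar> * S powr \<kappa>)"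
        unfolding h_def by (intro mult_mono) auto
      then show ?thesis using C by (simp add: c_def powr_mult mult_ac)
    qed
    then have "(\<Sum>m\<in>dyadic I. \<Sum>n\<in>dyadic J. h m n)
        \<le> (\<Sum>m\<in>dyadic I. \<Sum>n\<in>dyadic J. c * (alpha a (I + e) J powr q * S powr \<kappa>))"
      by (intro sum_mono)
    also have "\<dots> = c * (alpha a (I + e) J powr q * (S * S powr \<kappa>))"
      by (simp add: S_def dscale_def)
    also have "S * S powr \<kappa> = (S powr \<sigma>) powr q"
      using S by (simp add: \<kappa>_def powr_diff powr_powr mult.commute)
    also have "c * (alpha a (I + e) J powr q * (S powr \<sigma>) powr q)
        \<le> c * (alpha a (I + e) J powr q * (dscale (I + e, J) powr \<sigma>) powr q)"
      using S s q C by (intro mult_left_mono powr_mono2) (auto simp: S_def dscale_def c_def)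
    also have "\<dots> = c * wcoeff \<sigma> a (I + e, J) powr q"
      by (simp add: wcoeff_def powr_mult mult.commute)
    finally have "ennreal (\<Sum>m\<in>dyadic I. \<Sum>n\<in>dyadic J. h m n) \<le> ennreal (c * wcoeff \<sigma> a (I + e, J) powr q)"
      by (rule ennreal_leI)
    then show ?thesis
      using c0 by (simp add: sum_ennreal h0 sum_nonneg ennreal_mult)
  qed
  have "coeff_powr_sum \<sigma> q a = (\<Sum>I. \<Sum>J. \<Sum>m\<in>dyadic I. \<Sum>n\<in>dyadic J. ennreal (h m n))"
    unfolding double_suminf_dyadic [symmetric] coeff_powr_sum_def h_def \<kappa>_def ..
  also have "\<dots> \<le> (\<Sum>I. \<Sum>J. ennreal c * ennreal (wcoeff \<sigma> a (I + e, J) powr q))"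
    by (intro suminf_le block) auto
  also have "\<dots> = ennreal c * (\<Sum>I. \<Sum>J. ennreal (wcoeff \<sigma> a (I + e, J) powr q))"
    by simp
  also have "\<dots> \<le> ennreal c * (\<Sum>I. \<Sum>J. ennreal (wcoeff \<sigma> a (I, J) powr q))"
    by (intro mult_left_mono suminf_inj_le [of "\<lambda>I. I + e"]) auto
  also have "(\<Sum>I. \<Sum>J. ennreal (wcoeff \<sigma> a (I, J) powr q)) = psum (\<lambda>x. wcoeff \<sigma> a x powr q)"
    by (simp add: nn_integral_nat_pair)
  finally show ?thesis by (simp add: c_def \<kappa>_def)
qed

text \<open>The corner is compared with \<open>a (2 ^ e * j) n\<close> for all \<open>(j, n)\<close>
  in the preceding block, and the comparison is averaged. \<open>4 powr (q * \<sigma>)\<close> and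
  the power of \<open>8\<close> come from the ratios of \<open>dscale (I, J)\<close> and of
  \<open>2 ^ e * j * n\<close> to the size of that block; the leading \<open>4\<close> comes from
  the truncated predecessor in both variables.\<close>

lemma wcoeff_powr_sum_le:
  assumes q: "1 \<le> q" and s: "0 < \<sigma>"
  shows "psum (\<lambda>x. wcoeff \<sigma> a x powr q)
    \<le> ennreal (4 * 4 powr (q * \<sigma>) * 8 powr \<bar>q * \<sigma> - 1\<bar> * (1 + 2 * C) powr q) * coeff_powr_sum \<sigma> q a"
proof -
  define \<kappa> where "\<kappa> = q * \<sigma> - 1"
  define c where "c = 4 powr (q * \<sigma>) * 8 powr \<bar>\<kappa>\<bar> * (1 + 2 * C) powr q"
  define h where "h m n = \<bar>a m n\<bar> powr q * (real m * real n) powr \<kappa>" for m n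
  have h0: "0 \<le> h m n" for m n by (simp add: h_def)
  define G where "G I J = (\<Sum>j\<in>dyadic I. \<Sum>n\<in>dyadic J. ennreal (h (2 ^ e * j) n))" for I J
  have c0: "0 \<le> c" by (simp add: c_def)
  have pw: "2 ^ K \<le> 2 * (2::real) ^ (K - 1)" for K :: nat
    by (cases K; simp)
  have block: "ennreal (wcoeff \<sigma> a (I, J) powr q) \<le> ennreal c * G (I - 1) (J - 1)" for I J
  proof -
    define S where "S = dscale (I - 1, J - 1)"
    have S: "0 < S" by (simp add: S_def)
    have dS: "dscale (I, J) \<le> 4 * S"
    proof -
      have "dscale (I, J) \<le> (2 * 2 ^ (I - 1)) * (2 * 2 ^ (J - 1))"
        unfolding dscale_def fst_conv snd_conv by (intro mult_mono pw) auto
      then show ?thesis by (simp add: S_def dscale_def)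
    qed
    have "alpha a I J powr q * S powr \<kappa> \<le> (1 + 2 * C) powr q * 8 powr \<bar>\<kappa>\<bar> * h (2 ^ e * j) n"
      if j: "j \<in> dyadic (I - 1)" and n: "n \<in> dyadic (J - 1)" for j n
    proof -
      have bnd: "2 ^ (I - 1) \<le> real j" "real j \<le> 2 * 2 ^ (I - 1)" "2 ^ (J - 1) \<le> real n" "real n \<le> 2 * 2 ^ (J - 1)"
        using j n by (auto simp: dyadic_def numeral_power_le_of_nat_cancel_iff
            dest!: less_imp_le [of j] less_imp_le [of n] of_nat_mono [where ?'a = real])
      have "j \<le> 2 ^ I" "n \<le> 2 ^ J"
        using j n by (cases I; cases J; auto simp: dyadic_def)+
      then have "alpha a I J \<le> (1 + 2 * C) * \<bar>a (2 ^ e * j) n\<bar>"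
        using j n by (intro alpha_le_abs) (auto simp: dyadic_def)
      then have 1: "alpha a I J powr q \<le> ((1 + 2 * C) * \<bar>a (2 ^ e * j) n\<bar>) powr q"
        using q by (intro powr_mono2) auto
      have pe: "1 \<le> real (2 ^ e)" "real (2 ^ e) \<le> 2"
        using e by (cases e; simp)+
      have "1 * (2 ^ (I - 1) * 2 ^ (J - 1)) \<le> real (2 ^ e) * (real j * real n)"
        using bnd pe by (intro mult_mono) auto
      then have "S \<le> real (2 ^ e * j) * real n"
        unfolding S_def dscale_def fst_conv snd_conv by simp
      moreover have "real (2 ^ e) * (real j * real n) \<le> 2 * ((2 * 2 ^ (I - 1)) * (2 * 2 ^ (J - 1)))"
        using bnd pe by (intro mult_mono) auto
      then have "real (2 ^ e * j) * real n \<le> 8 * S"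
        by (simp add: S_def dscale_def)
      ultimately have 2: "S powr \<kappa> \<le> 8 powr \<bar>\<kappa>\<bar> * (real (2 ^ e * j) * real n) powr \<kappa>"
        using S by (intro powr_doubling_lower) auto
      have "alpha a I J powr q * S powr \<kappa>
        \<le> ((1 + 2 * C) * \<bar>a (2 ^ e * j) n\<bar>) powr q * (8 powr \<bar>\<kappa>\<bar> * (real (2 ^ e * j) * real n) powr \<kappa>)"
        by (intro mult_mono 1 2) auto
      then show ?thesis using C by (simp add: h_def powr_mult mult_ac)
    qed
    then have "(\<Sum>j\<in>dyadic (I - 1). \<Sum>n\<in>dyadic (J - 1). alpha a I J powr q * S powr \<kappa>)
        \<le> (\<Sum>j\<in>dyadic (I - 1). \<Sum>n\<in>dyadic (J - 1). (1 + 2 * C) powr q * 8 powr \<bar>\<kappa>\<bar> * h (2 ^ e * j) n)"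
      by (intro sum_mono)
    then have sum_le: "S * (alpha a I J powr q * S powr \<kappa>)
        \<le> (1 + 2 * C) powr q * 8 powr \<bar>\<kappa>\<bar> * (\<Sum>j\<in>dyadic (I - 1). \<Sum>n\<in>dyadic (J - 1). h (2 ^ e * j) n)"
      by (simp add: S_def dscale_def sum_distrib_left mult_ac)
    have "wcoeff \<sigma> a (I, J) powr q = dscale (I, J) powr (q * \<sigma>) * alpha a I J powr q"
      by (simp add: wcoeff_def powr_mult powr_powr mult.commute)
    also have "\<dots> \<le> (4 * S) powr (q * \<sigma>) * alpha a I J powr q"
      using q s dS by (intro mult_right_mono powr_mono2) (auto intro: less_imp_le)
    also have "\<dots> = 4 powr (q * \<sigma>) * (S * (alpha a I J powr q * S powr \<kappa>))"
      using S by (simp add: powr_mult \<kappa>_def powr_diff)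
    also have "\<dots> \<le> 4 powr (q * \<sigma>) * ((1 + 2 * C) powr q * 8 powr \<bar>\<kappa>\<bar> * (\<Sum>j\<in>dyadic (I - 1). \<Sum>n\<in>dyadic (J - 1). h (2 ^ e * j) n))"
      by (intro mult_left_mono sum_le) auto
    also have "\<dots> = c * (\<Sum>j\<in>dyadic (I - 1). \<Sum>n\<in>dyadic (J - 1). h (2 ^ e * j) n)"
      by (simp add: c_def mult_ac)
    finally have "ennreal (wcoeff \<sigma> a (I, J) powr q) \<le> ennreal (c * (\<Sum>j\<in>dyadic (I - 1). \<Sum>n\<in>dyadic (J - 1). h (2 ^ e * j) n))"
      by (rule ennreal_leI)
    then show ?thesis
      using c0 by (simp add: G_def sum_ennreal h0 sum_nonneg ennreal_mult)
  qed
  have "psum (\<lambda>x. wcoeff \<sigma> a x powr q) = (\<Sum>I. \<Sum>J. ennreal (wcoeff \<sigma> a (I, J) powr q))"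
    by (simp add: nn_integral_nat_pair)
  also have "\<dots> \<le> (\<Sum>I. \<Sum>J. ennreal c * G (I - 1) (J - 1))"
    by (intro suminf_le block) auto
  also have "\<dots> = ennreal c * (\<Sum>I. \<Sum>J. G (I - 1) (J - 1))"
    by simp
  also have "(\<Sum>I. \<Sum>J. G (I - 1) (J - 1)) \<le> (\<Sum>I. 2 * (\<Sum>J. G (I - 1) J))"
    by (intro suminf_le suminf_pred_le) auto
  also have "\<dots> = 2 * (\<Sum>I. \<Sum>J. G (I - 1) J)"
    by simp
  also have "(\<Sum>I. \<Sum>J. G (I - 1) J) \<le> 2 * (\<Sum>I. \<Sum>J. G I J)"
    by (rule suminf_pred_le)
  also have "(\<Sum>I. \<Sum>J. G I J) = (\<Sum>j. \<Sum>n. ennreal (h (2 ^ e * Suc j) (Suc n)))"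
    unfolding G_def by (rule double_suminf_dyadic [symmetric])
  \<comment> \<open>For \<open>e = 1\<close> only rows with even first index occur. They are an
    injective selection from all rows, so the full coefficient sum is a bound.\<close>
  also have "\<dots> = (\<Sum>j. (\<lambda>m. \<Sum>n. ennreal (h (Suc m) (Suc n))) (2 ^ e * Suc j - 1))"
    by (simp del: mult_Suc_right)
  also have "\<dots> \<le> (\<Sum>m. \<Sum>n. ennreal (h (Suc m) (Suc n)))"
  proof (rule suminf_inj_le, rule injI)
    fix x y :: nat assume "2 ^ e * Suc x - 1 = 2 ^ e * Suc y - 1"
    then show "x = y" using pow_e by auto
  qed
  also have "\<dots> = coeff_powr_sum \<sigma> q a"
    unfolding coeff_powr_sum_def h_def \<kappa>_def ..
  finally have "psum (\<lambda>x. wcoeff \<sigma> a x powr q) \<le> ennreal c * (2 * (2 * coeff_powr_sum \<sigma> q a))"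
    by (simp add: mult_left_mono)
  also have "\<dots> = ennreal (4 * c) * coeff_powr_sum \<sigma> q a"
    using c0 by (simp add: ennreal_mult mult_ac)
  finally show ?thesis by (simp add: c_def \<kappa>_def mult.assoc)
qed

section \<open>Supremum versions of the comparison, for infinite exponent\<close>

lemma abs_le_of_wcoeff_le:
  assumes F: "\<And>x. wcoeff \<sigma> a x \<le> F" and s: "0 < \<sigma>" and mn: "1 \<le> m" "1 \<le> n"
  shows "(real m * real n) powr \<sigma> * \<bar>a m n\<bar> \<le> 4 powr \<sigma> * (1 + 2 * C) * F"
proof -
  obtain I J where I: "m \<in> dyadic I" and J: "n \<in> dyadic J"
    using ex_power_ivl1 [of 2 m] ex_power_ivl1 [of 2 n] mn by (auto simp: dyadic_def)
  have "real m \<le> 2 * 2 ^ I" "real n \<le> 2 * 2 ^ J"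
    using I J by (auto simp: dyadic_def
        dest!: less_imp_le [of m] less_imp_le [of n] of_nat_mono [where ?'a = real])
  then have "real m * real n \<le> (2 * 2 ^ I) * (2 * 2 ^ J)" by (intro mult_mono) auto
  also have "\<dots> \<le> 4 * dscale (I + e, J)" by (simp add: dscale_def)
  finally have "(real m * real n) powr \<sigma> \<le> (4 * dscale (I + e, J)) powr \<sigma>"
    using s by (intro powr_mono2) auto
  then have "(real m * real n) powr \<sigma> * \<bar>a m n\<bar> \<le> (4 * dscale (I + e, J)) powr \<sigma> * ((1 + 2 * C) * alpha a (I + e) J)"
    using I J by (intro mult_mono abs_le_alpha) auto
  also have "\<dots> = 4 powr \<sigma> * (1 + 2 * C) * wcoeff \<sigma> a (I + e, J)"
    by (simp add: wcoeff_def powr_mult less_imp_le)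
  also have "\<dots> \<le> 4 powr \<sigma> * (1 + 2 * C) * F"
    using C by (intro mult_left_mono F) auto
  finally show ?thesis .
qed

lemma wcoeff_le_of_abs_le:
  assumes F: "\<And>m n. 1 \<le> m \<Longrightarrow> 1 \<le> n \<Longrightarrow> (real m * real n) powr \<sigma> * \<bar>a m n\<bar> \<le> F" and s: "0 < \<sigma>"
  shows "wcoeff \<sigma> a x \<le> 4 powr \<sigma> * (1 + 2 * C) * F"
proof -
  define m n :: nat where "m = 2 ^ e * 2 ^ (fst x - 1)" and "n = 2 ^ (snd x - 1)"
  have pe: "1 \<le> real (2 ^ e)" by simp
  have pw: "2 ^ K \<le> 2 * (2::real) ^ (K - 1)" for K :: nat
    by (cases K; simp)
  have "dscale x \<le> (2 * 2 ^ (fst x - 1)) * (2 * 2 ^ (snd x - 1))"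
    unfolding dscale_def by (intro mult_mono pw) auto
  also have "\<dots> = 4 * (1 * (2 ^ (fst x - 1) * 2 ^ (snd x - 1)))" by simp
  also have "\<dots> \<le> 4 * (real (2 ^ e) * (2 ^ (fst x - 1) * 2 ^ (snd x - 1)))"
    using pe by (intro mult_left_mono mult_right_mono) auto
  also have "\<dots> = 4 * (real m * real n)" by (simp add: m_def n_def)
  finally have "dscale x powr \<sigma> \<le> (4 * (real m * real n)) powr \<sigma>"
    using s by (intro powr_mono2) (auto intro: less_imp_le)
  moreover have "alpha a (fst x) (snd x) \<le> (1 + 2 * C) * \<bar>a m n\<bar>"
    unfolding m_def n_def by (intro alpha_le_abs) (auto intro!: power_increasing)
  ultimately have "wcoeff \<sigma> a x \<le> (4 * (real m * real n)) powr \<sigma> * ((1 + 2 * C) * \<bar>a m n\<bar>)"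
    unfolding wcoeff_def by (intro mult_mono) auto
  also have "\<dots> = 4 powr \<sigma> * (1 + 2 * C) * ((real m * real n) powr \<sigma> * \<bar>a m n\<bar>)"
    by (simp add: powr_mult)
  also have "\<dots> \<le> 4 powr \<sigma> * (1 + 2 * C) * F"
    using C by (intro mult_left_mono F) (auto simp: m_def n_def)
  finally show ?thesis .
qed

end

section \<open>Lower bound for the weighted norm\<close>

abbreviation GM_family :: "real \<Rightarrow> (nat \<Rightarrow> nat \<Rightarrow> nat \<Rightarrow> nat \<Rightarrow> real) \<Rightarrow> bool" where
  "GM_family C a \<equiv> \<forall>i<2. \<forall>j<2. GMc1_const C (a i j) \<or> GMc2_const C (a i j)"

text \<open>\<open>max C 1\<close> meets the normalisation of the locale, and enlarging the constant
  only weakens the inequality. The exponent \<open>e\<close> records which class holds.\<close>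

lemma gm_sequence_of_GMc:
  assumes "GMc1_const C a \<or> GMc2_const C a"
  obtains e where "gm_sequence a (max C 1) e"
proof -
  have le: "ennreal (C * \<bar>x\<bar>) \<le> ennreal (max C 1 * \<bar>x\<bar>)" for x :: real
    by (intro ennreal_leI mult_right_mono) auto
  from assms show thesis
  proof
    assume "GMc1_const C a"
    then have "gm_sequence a (max C 1) 0"
      by unfold_locales (auto simp: GMc1_const_def intro: order_trans [OF _ le])
    then show thesis by (rule that)
  next
    assume "GMc2_const C a"
    then have "gm_sequence a (max C 1) 1"
      by unfold_locales (auto simp: GMc2_const_def intro: order_trans [OF _ le])
    then show thesis by (rule that)
  qed
qed

section \<open>Null sets, measurability and kernel means\<close>

lemma AE_coordinates_nonzero: "AE z in lborel. fst z \<noteq> (0::real) \<and> snd z \<noteq> (0::real)"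
proof -
  have "emeasure lborel ({0 :: real} \<times> (UNIV :: real set)) = 0" "emeasure lborel ((UNIV :: real set) \<times> {0 :: real}) = 0"
    using lborel.emeasure_pair_measure_Times [of "{0::real}" "lborel :: real measure" "UNIV :: real set"]
      lborel.emeasure_pair_measure_Times [of "UNIV :: real set" "lborel :: real measure" "{0::real}"]
    by (simp_all add: lborel_prod)
  moreover have "{0 :: real} \<times> (UNIV :: real set) \<in> sets lborel" "(UNIV :: real set) \<times> {0 :: real} \<in> sets lborel"
    by (auto intro!: borel_closed closed_Times)
  ultimately have "{0 :: real} \<times> (UNIV :: real set) \<in> null_sets lborel" "(UNIV :: real set) \<times> {0 :: real} \<in> null_sets lborel"
    by (auto simp: null_sets_def)
  from AE_not_in [OF this(1)] AE_not_in [OF this(2)] show ?thesis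
    by eventually_elim auto
qed

lemma square_borel [measurable]: "square \<in> sets borel"
  unfolding square_def by (intro borel_closed closed_Times) auto

lemma borel_measurable_trig [measurable]: "trig i \<in> borel_measurable borel"
  by (cases "i = 0") (auto simp: trig_def [abs_def])

lemma borel_measurable_fst_snd [measurable]:
  "(fst :: real \<times> real \<Rightarrow> real) \<in> borel_measurable borel" "(snd :: real \<times> real \<Rightarrow> real) \<in> borel_measurable borel"
  by (auto intro!: borel_measurable_continuous_onI continuous_intros)

definition kernel_mean :: "(real \<times> real \<Rightarrow> real) \<Rightarrow> nat \<times> nat \<Rightarrow> real" where
  "kernel_mean g x = (\<integral>z. \<bar>g z\<bar> * dker2 x z \<partial>lborel)"

lemma integrable_mult_bounded:
  fixes g k :: "real \<times> real \<Rightarrow> real"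
  assumes "integrable lborel g" and [measurable]: "k \<in> borel_measurable borel" and "\<And>z. \<bar>k z\<bar> \<le> 1"
  shows "integrable lborel (\<lambda>z. g z * k z)"
proof (rule Bochner_Integration.integrable_bound [OF assms(1)])
  show "AE z in lborel. norm (g z * k z) \<le> norm (g z)"
    using assms(3) by (auto simp: abs_mult intro!: mult_left_le)
qed (use assms(1) in measurable)

lemma nn_integral_kernel_mean:
  assumes "integrable lborel g"
  shows "pint (\<lambda>z. dker2 x z * \<bar>g z\<bar>) = ennreal (kernel_mean g x)"
proof -
  have "integrable lborel (\<lambda>z. \<bar>g z\<bar> * dker2 x z)"
    using assms by (intro integrable_mult_bounded) (auto simp: dker2_le_1)
  from nn_integral_eq_integral [OF this] show ?thesis
    by (simp add: kernel_mean_def mult.commute)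
qed

lemma kernel_mean_nonneg [simp]: "0 \<le> kernel_mean g x"
  unfolding kernel_mean_def by (intro integral_nonneg_AE) auto

text \<open>Coefficient sums over rectangles are integrals of \<open>f\<close> against products of
  trigonometric sums, which \<open>dscale * dker2\<close> dominates almost everywhere on the square.
  The kernel mean can serve as \<open>T\<close>, and it is the same for all four pairs
  \<open>(i, j)\<close>.\<close>

lemma block_bound_fourier:
  fixes f :: "real \<times> real \<Rightarrow> real"
  assumes f: "has_fourier_series f a" and ij: "i < 2" "j < 2"
  defines "g \<equiv> \<lambda>z. indicator square z * f z"
  shows "block_bound (a i j) (kernel_mean g)"
  unfolding block_bound_def
proof (intro allI impI)
  fix I J m0 n0 r s :: nat
  assume rs: "1 \<le> m0" "1 \<le> n0" "r \<le> 2 ^ I" "s \<le> 2 ^ J"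
  have g: "integrable lborel g"
    using f by (simp add: has_fourier_series_def set_integrable_def g_def)
  have [measurable]: "g \<in> borel_measurable borel" using g by auto
  define c where "c m n z = trig i (real m * fst z) * trig j (real n * snd z)" for m n z
  have [measurable]: "c m n \<in> borel_measurable borel" for m n
    unfolding c_def by measurable
  have c1: "\<bar>c m n z\<bar> \<le> 1" for m n z
    by (simp add: c_def abs_mult mult_le_one trig_le_1)
  have int_c: "integrable lborel (\<lambda>z. g z * c m n z)" for m n
    using g c1 by (intro integrable_mult_bounded) auto
  have coeff: "a i j m n = (\<integral>z. g z * c m n z \<partial>lborel) / pi\<^sup>2" if "1 \<le> m" "1 \<le> n" for m n
  proof -
    have "a i j m n = fourier_coeff f i j m n"
      using f ij that by (simp add: has_fourier_series_def)
    also have "\<dots> = (\<integral>z. g z * c m n z \<partial>lborel) / pi\<^sup>2"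
      unfolding fourier_coeff_def set_lebesgue_integral_def
      by (intro arg_cong2 [of _ _ _ _ "(/)"] Bochner_Integration.integral_cong) (auto simp: g_def c_def)
    finally show ?thesis .
  qed
  define D where "D z = (\<Sum>m=m0..<m0 + r. trig i (real m * fst z)) * (\<Sum>n=n0..<n0 + s. trig j (real n * snd z))" for z
  have D: "(\<Sum>m=m0..<m0 + r. \<Sum>n=n0..<n0 + s. c m n z) = D z" for z
    by (simp add: D_def c_def sum_product)
  have "(\<Sum>m=m0..<m0 + r. \<Sum>n=n0..<n0 + s. a i j m n)
      = (\<Sum>m=m0..<m0 + r. \<Sum>n=n0..<n0 + s. (\<integral>z. g z * c m n z \<partial>lborel) / pi\<^sup>2)"
    using rs by (intro sum.cong refl coeff) auto
  also have "\<dots> = (\<Sum>m=m0..<m0 + r. \<Sum>n=n0..<n0 + s. (\<integral>z. g z * c m n z \<partial>lborel)) / pi\<^sup>2"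
    by (simp add: sum_divide_distrib)
  also have "(\<Sum>m=m0..<m0 + r. \<Sum>n=n0..<n0 + s. (\<integral>z. g z * c m n z \<partial>lborel))
      = (\<integral>z. (\<Sum>m=m0..<m0 + r. \<Sum>n=n0..<n0 + s. g z * c m n z) \<partial>lborel)"
    using int_c by (simp add: Bochner_Integration.integral_sum)
  also have "\<dots> = (\<integral>z. g z * D z \<partial>lborel)"
    by (simp add: D [symmetric] sum_distrib_left)
  finally have "\<bar>\<Sum>m=m0..<m0 + r. \<Sum>n=n0..<n0 + s. a i j m n\<bar> = \<bar>\<integral>z. g z * D z \<partial>lborel\<bar> / pi\<^sup>2"
    by simp
  \<comment> \<open>The normalising factor is dropped, as \<open>pi\<^sup>2 \<ge> 1\<close>.\<close>
  also have "\<dots> \<le> \<bar>\<integral>z. g z * D z \<partial>lborel\<bar> / 1"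
    using pi_ge_two by (intro divide_left_mono) (auto intro!: one_le_power)
  also have "\<dots> \<le> (\<integral>z. \<bar>g z * D z\<bar> \<partial>lborel)"
    by simp
  also have "\<dots> \<le> (\<integral>z. dscale (I, J) * (\<bar>g z\<bar> * dker2 (I, J) z) \<partial>lborel)"
  proof (rule integral_mono_AE)
    show "integrable lborel (\<lambda>z. dscale (I, J) * (\<bar>g z\<bar> * dker2 (I, J) z))"
      using g by (intro integrable_mult_right integrable_mult_bounded) (auto simp: dker2_le_1)
    have "integrable lborel (\<lambda>z. \<Sum>m=m0..<m0 + r. \<Sum>n=n0..<n0 + s. g z * c m n z)"
      by (intro Bochner_Integration.integrable_sum int_c)
    then show "integrable lborel (\<lambda>z. \<bar>g z * D z\<bar>)"
      by (simp add: D [symmetric] sum_distrib_left)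
    show "AE z in lborel. \<bar>g z * D z\<bar> \<le> dscale (I, J) * (\<bar>g z\<bar> * dker2 (I, J) z)"
      using AE_coordinates_nonzero
    proof eventually_elim
      case (elim z)
      show ?case
      proof (cases "z \<in> square")
        case True
        then have "\<bar>fst z\<bar> \<le> pi" "\<bar>snd z\<bar> \<le> pi" by (auto simp: square_def)
        then have "\<bar>D z\<bar> \<le> (2 ^ I * dker I (fst z)) * (2 ^ J * dker J (snd z))"
          unfolding D_def abs_mult using elim rs by (intro mult_mono trig_sum_le_dker) auto
        then have "\<bar>g z\<bar> * \<bar>D z\<bar> \<le> \<bar>g z\<bar> * ((2 ^ I * dker I (fst z)) * (2 ^ J * dker J (snd z)))"
          by (intro mult_left_mono) auto
        then show ?thesis by (simp add: abs_mult dscale_def dker2_def mult_ac)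
      qed (simp add: g_def)
    qed
  qed
  also have "\<dots> = dscale (I, J) * kernel_mean g (I, J)"
    by (simp add: kernel_mean_def)
  finally show "\<bar>\<Sum>m=m0..<m0 + r. \<Sum>n=n0..<n0 + s. a i j m n\<bar> \<le> dscale (I, J) * kernel_mean g (I, J)" .
qed

text \<open>Schur test from the plane to block indices. The choice
  \<open>v = |ts| powr (1 / p)\<close> makes the row integrals a power of \<open>dscale\<close>, and
  \<open>w * h powr (q - 1)\<close> collapses to \<open>dscale powr (1 - 1 / p)\<close>, so the
  column bound is a kernel sum whose exponent does not depend on \<open>q\<close>.\<close>

lemma kernel_mean_powr_sum_le:
  fixes p q :: real
  assumes p: "1 < p" and q: "1 \<le> q"
  obtains c where "0 < c"
    "\<And>g. integrable lborel g \<Longrightarrow>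
      psum (\<lambda>x. (dscale x powr (1 - 1 / p) * kernel_mean g x) powr q)
      \<le> ennreal c * pint (\<lambda>z. absprod z powr (q / p - 1) * \<bar>g z\<bar> powr q)"
proof -
  have p1: "0 < 1 / p" "1 / p < 1" using p by auto
  obtain A where A: "0 < A"
    "\<And>x. pint (\<lambda>z. dker2 x z * absprod z powr - (1 / p)) \<le> ennreal (A * dscale x powr (1 / p - 1))"
    using dker2_integral_bound [OF p1] by blast
  have "0 < 1 - 1 / p" "1 - 1 / p < 1" using p1 by auto
  from dker2_sum_bound [OF this] obtain B where B: "0 < B"
    "\<And>z. fst z \<noteq> 0 \<Longrightarrow> snd z \<noteq> 0 \<Longrightarrow>
       psum (\<lambda>x. dker2 x z * dscale x powr (1 - 1 / p)) \<le> ennreal (B * absprod z powr - (1 - 1 / p))"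
    by blast
  have "psum (\<lambda>x. (dscale x powr (1 - 1 / p) * kernel_mean g x) powr q)
      \<le> ennreal (A powr (q - 1) * B) * pint (\<lambda>z. absprod z powr (q / p - 1) * \<bar>g z\<bar> powr q)"
    if g: "integrable lborel g" for g
  proof -
    have [measurable]: "g \<in> borel_measurable borel" using g by auto
    define v where "v z = absprod z powr (1 / p)" for z :: "real \<times> real"
    define w where "w x = dscale x powr ((1 - 1 / p) * q)" for x
    define h where "h x = dscale x powr (1 / p - 1)" for x
    define gg where "gg z = absprod z powr - (1 - 1 / p)" for z :: "real \<times> real"
    have [measurable]: "v \<in> borel_measurable borel" "gg \<in> borel_measurable borel"
      unfolding v_def gg_def by measurable
    have "psum (\<lambda>x. w x * kernel_mean g x powr q)
       \<le> ennreal (A powr (q - 1) * B) * pint (\<lambda>z. \<bar>g z\<bar> powr q * v z powr (q - 1) * gg z)"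
    proof (rule schur_test [where K = dker2 and h = h])
      show "sigma_finite_measure (count_space (UNIV :: (nat \<times> nat) set))"
        by (intro sigma_finite_measure_count_space_countable) auto
      show "sigma_finite_measure (lborel :: (real \<times> real) measure)"
        by (rule lborel.sigma_finite_measure_axioms)
      show "case_prod dker2 \<in> borel_measurable (count_space UNIV \<Otimes>\<^sub>M lborel)"
        by (rule measurable_pair_measure_countable1) auto
      show "AE z in lborel. 0 < v z"
        using AE_coordinates_nonzero by eventually_elim (simp add: v_def)
      show "AE x in count_space UNIV. ennreal (kernel_mean g x) \<le> pint (\<lambda>z. dker2 x z * \<bar>g z\<bar>)"
        using nn_integral_kernel_mean [OF g] by simp
      show "AE x in count_space UNIV. pint (\<lambda>z. dker2 x z / v z) \<le> ennreal (A * h x)"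
        using A(2) by (simp add: v_def h_def powr_minus divide_inverse)
      show "AE z in lborel. psum (\<lambda>x. dker2 x z * (w x * h x powr (q - 1))) \<le> ennreal (B * gg z)"
        using AE_coordinates_nonzero
      proof eventually_elim
        case (elim z)
        have "w x * h x powr (q - 1) = dscale x powr (1 - 1 / p)" for x
        proof -
          have "(1 - 1 / p) * q + (1 / p - 1) * (q - 1) = 1 - 1 / p"
            by (simp add: algebra_simps diff_divide_distrib)
          then show ?thesis
            by (simp add: w_def h_def powr_powr powr_add [symmetric])
        qed
        then show ?case using B(2) [of z] elim by (simp add: gg_def)
      qed
    qed (use q A B in \<open>auto simp: w_def h_def v_def gg_def\<close>)
    also have "pint (\<lambda>z. \<bar>g z\<bar> powr q * v z powr (q - 1) * gg z)
        = pint (\<lambda>z. absprod z powr (q / p - 1) * \<bar>g z\<bar> powr q)"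
    proof (intro nn_integral_cong arg_cong [where f = ennreal])
      fix z :: "real \<times> real"
      have "v z powr (q - 1) * gg z = absprod z powr ((q - 1) / p + (1 / p - 1))"
        by (simp add: v_def gg_def powr_powr powr_add [symmetric])
      also have "(q - 1) / p + (1 / p - 1) = q / p - 1"
        by (simp add: diff_divide_distrib)
      finally have "v z powr (q - 1) * gg z = absprod z powr (q / p - 1)" .
      then show "\<bar>g z\<bar> powr q * v z powr (q - 1) * gg z = absprod z powr (q / p - 1) * \<bar>g z\<bar> powr q"
        by (simp add: mult.assoc mult.commute)
    qed
    also have "psum (\<lambda>x. w x * kernel_mean g x powr q)
      = psum (\<lambda>x. (dscale x powr (1 - 1 / p) * kernel_mean g x) powr q)"
      by (simp add: w_def powr_mult powr_powr)
    finally show ?thesis .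
  qed
  moreover have "0 < A powr (q - 1) * B" using A B by simp
  ultimately show thesis by (rule that [rotated])
qed

text \<open>An essential bound means \<open>|g| \<le> F * |ts| powr (- 1 / p)\<close> almost
  everywhere, and this majorant has kernel means of order
  \<open>dscale powr (1 / p - 1)\<close>.\<close>

lemma kernel_mean_le_esssup:
  fixes p :: real
  assumes p: "1 < p"
  obtains c where "0 < c"
    "\<And>g F x. integrable lborel g \<Longrightarrow> 0 \<le> F \<Longrightarrow> (AE z in lborel. absprod z powr (1 / p) * \<bar>g z\<bar> \<le> F)
      \<Longrightarrow> dscale x powr (1 - 1 / p) * kernel_mean g x \<le> c * F"
proof -
  have p1: "0 < 1 / p" "1 / p < 1" using p by auto
  obtain A where A: "0 < A"
    "\<And>x. pint (\<lambda>z. dker2 x z * absprod z powr - (1 / p)) \<le> ennreal (A * dscale x powr (1 / p - 1))"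
    using dker2_integral_bound [OF p1] by blast
  have "dscale x powr (1 - 1 / p) * kernel_mean g x \<le> A * F"
    if g: "integrable lborel g" and F0: "0 \<le> F" and F: "AE z in lborel. absprod z powr (1 / p) * \<bar>g z\<bar> \<le> F" for g F x
  proof -
    have "ennreal (kernel_mean g x) = pint (\<lambda>z. dker2 x z * \<bar>g z\<bar>)"
      using nn_integral_kernel_mean [OF g] by simp
    also have "\<dots> \<le> (\<integral>\<^sup>+z. ennreal F * ennreal (dker2 x z * absprod z powr - (1 / p)) \<partial>lborel)"
    proof (rule nn_integral_mono_AE)
      show "AE z in lborel. ennreal (dker2 x z * \<bar>g z\<bar>) \<le> ennreal F * ennreal (dker2 x z * absprod z powr - (1 / p))"
        using F AE_coordinates_nonzero
      proof eventually_elim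
        case (elim z)
        then have "\<bar>g z\<bar> \<le> F * absprod z powr - (1 / p)"
          by (simp add: powr_minus field_simps)
        then have "dker2 x z * \<bar>g z\<bar> \<le> dker2 x z * (F * absprod z powr - (1 / p))"
          by (intro mult_left_mono) auto
        then show ?case
          using F0 by (simp add: ennreal_mult [symmetric] ennreal_leI mult_ac)
      qed
    qed
    also have "\<dots> = ennreal F * pint (\<lambda>z. dker2 x z * absprod z powr - (1 / p))"
      by (rule nn_integral_cmult) measurable
    also have "\<dots> \<le> ennreal F * ennreal (A * dscale x powr (1 / p - 1))"
      by (intro mult_left_mono A) auto
    also have "\<dots> = ennreal (F * (A * dscale x powr (1 / p - 1)))"
      using F0 A by (simp add: ennreal_mult)
    finally have "kernel_mean g x \<le> F * (A * dscale x powr (1 / p - 1))"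
      using F0 A by simp
    then have "dscale x powr (1 - 1 / p) * kernel_mean g x \<le> dscale x powr (1 - 1 / p) * (F * (A * dscale x powr (1 / p - 1)))"
      by (intro mult_left_mono) auto
    also have "\<dots> = A * F * (dscale x powr (1 - 1 / p) * dscale x powr (1 / p - 1))"
      by (simp add: mult_ac)
    also have "dscale x powr (1 - 1 / p) * dscale x powr (1 / p - 1) = 1"
      by (simp add: powr_add [symmetric] less_imp_neq [symmetric])
    finally show ?thesis by simp
  qed
  with A(1) show thesis by (rule that)
qed


lemma conj_exp_inverse: "1 < p \<Longrightarrow> 1 / conj_exp p = 1 - 1 / p"
  by (simp add: conj_exp_def field_simps)

lemma coeff_sum_finite_exponent:
  "1 < p \<Longrightarrow> coeff_sum p (ereal q) a = enn2ereal (\<Sum>i<2. \<Sum>j<2. coeff_powr_sum (1 - 1 / p) q (a i j))"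
  using conj_exp_inverse [of p] by (simp add: coeff_sum_def coeff_powr_sum_def divide_inverse mult_ac)

theorem coefficients_lower_bound:
  fixes p :: real and q :: ereal
  assumes p: "1 < p" and q: "1 \<le> q"
  obtains c where "0 < c"
    "\<And>a f. GM_family C a \<Longrightarrow>
        has_fourier_series f a \<Longrightarrow> wnorm_pow p q f \<ge> ereal c * coeff_sum p q a"
proof -
  define \<sigma> where "\<sigma> = 1 - 1 / p"
  have s: "0 < \<sigma>" "\<sigma> < 1" using p by (auto simp: \<sigma>_def)
  have C: "1 \<le> max C 1" by simp
  show thesis
  proof (cases q)
    case (real r)
    with q have r: "1 \<le> r" by simp
    obtain c1 where c1: "0 < c1" "\<And>a e T. gm_sequence a (max C 1) e \<Longrightarrow> block_bound a T \<Longrightarrow>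
        psum (\<lambda>x. wcoeff \<sigma> a x powr r)
        \<le> ennreal c1 * psum (\<lambda>x. (dscale x powr \<sigma> * T x) powr r)"
      using wcoeff_powr_le_blocks [OF r s C] by blast
    obtain c2 where c2: "0 < c2" "\<And>g. integrable lborel g \<Longrightarrow>
        psum (\<lambda>x. (dscale x powr \<sigma> * kernel_mean g x) powr r)
        \<le> ennreal c2 * pint (\<lambda>z. absprod z powr (r / p - 1) * \<bar>g z\<bar> powr r)"
      using kernel_mean_powr_sum_le [OF p r] unfolding \<sigma>_def by blast
    define c3 where "c3 = 4 powr \<bar>r * \<sigma> - 1\<bar> * (1 + 2 * max C 1) powr r"
    have c3: "0 < c3" by (simp add: c3_def)
    \<comment> \<open>The \<open>4\<close> counts the pairs \<open>(i, j)\<close>, each bounded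
      separately by the same integral.\<close>
    define K where "K = 4 * (c3 * (c1 * c2))"
    have K: "0 < K" using c1 c2 c3 by (simp add: K_def)
    have "wnorm_pow p q f \<ge> ereal (1 / K) * coeff_sum p q a"
      if gm: "GM_family C a" and f: "has_fourier_series f a" for a f
    proof -
      define g where "g z = indicator square z * f z" for z
      have g: "integrable lborel g"
        using f by (simp add: has_fourier_series_def set_integrable_def g_def [abs_def])
      define W where "W = pint (\<lambda>z. absprod z powr (r / p - 1) * \<bar>g z\<bar> powr r)"
      have norm: "wnorm_pow p q f = enn2ereal W"
        unfolding W_def wnorm_pow_def real
        by (auto simp: g_def indicator_def intro!: arg_cong [where f = enn2ereal] nn_integral_cong)
      have "coeff_powr_sum \<sigma> r (a i j) \<le> ennreal (c3 * (c1 * c2)) * W" if ij: "i < 2" "j < 2" for i j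
      proof -
        obtain e where "gm_sequence (a i j) (max C 1) e"
          using gm_sequence_of_GMc gm ij by blast
        then interpret gm_sequence "a i j" "max C 1" e .
        have "coeff_powr_sum \<sigma> r (a i j) \<le> ennreal c3 * psum (\<lambda>x. wcoeff \<sigma> (a i j) x powr r)"
          unfolding c3_def by (rule coeff_powr_sum_le [OF r s(1)])
        also have "\<dots> \<le> ennreal c3 * (ennreal c1 * psum (\<lambda>x. (dscale x powr \<sigma> * kernel_mean g x) powr r))"
          using block_bound_fourier [OF f ij]
          by (intro mult_left_mono c1(2) [OF gm_sequence_axioms]) (auto simp: g_def [abs_def])
        also have "\<dots> \<le> ennreal c3 * (ennreal c1 * (ennreal c2 * W))"
          unfolding W_def by (intro mult_left_mono c2 g) auto
        also have "\<dots> = ennreal (c3 * (c1 * c2)) * W"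
          using c1 c2 c3 by (simp add: ennreal_mult mult.assoc)
        finally show ?thesis .
      qed
      then have "(\<Sum>i<2. \<Sum>j<2. coeff_powr_sum \<sigma> r (a i j)) \<le> (\<Sum>i<2::nat. \<Sum>j<2::nat. ennreal (c3 * (c1 * c2)) * W)"
        by (intro sum_mono) auto
      also have "\<dots> = ennreal K * W"
        using c1 c2 c3 by (simp add: K_def ennreal_mult mult.assoc [symmetric])
      finally have "ennreal (1 / K) * (\<Sum>i<2. \<Sum>j<2. coeff_powr_sum \<sigma> r (a i j)) \<le> ennreal (1 / K) * (ennreal K * W)"
        by (intro mult_left_mono) auto
      also have "\<dots> = W"
        using K by (simp add: mult.assoc [symmetric] ennreal_mult [symmetric])
      finally have "enn2ereal (ennreal (1 / K) * (\<Sum>i<2. \<Sum>j<2. coeff_powr_sum \<sigma> r (a i j))) \<le> enn2ereal W"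
        by (simp add: less_eq_ennreal.rep_eq)
      then show ?thesis
        using K norm by (simp add: real coeff_sum_finite_exponent [OF p] \<sigma>_def times_ennreal.rep_eq enn2ereal_ennreal)
    qed
    with K show thesis by (intro that [of "1 / K"]) auto
  next
    case PInf
    obtain c1 where c1: "0 < c1" "\<And>a e T F x. gm_sequence a (max C 1) e \<Longrightarrow> block_bound a T \<Longrightarrow>
        (\<And>x. dscale x powr \<sigma> * T x \<le> F) \<Longrightarrow> wcoeff \<sigma> a x \<le> c1 * F"
      using wcoeff_le_blocks [OF s C] by blast
    obtain c2 where c2: "0 < c2" "\<And>g F x. integrable lborel g \<Longrightarrow> 0 \<le> F \<Longrightarrow>
        (AE z in lborel. absprod z powr (1 / p) * \<bar>g z\<bar> \<le> F) \<Longrightarrow> dscale x powr \<sigma> * kernel_mean g x \<le> c2 * F"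
      using kernel_mean_le_esssup [OF p] unfolding \<sigma>_def by blast
    define c3 where "c3 = 4 powr \<sigma> * (1 + 2 * max C 1)"
    have c3: "0 < c3" by (simp add: c3_def add_pos_nonneg)
    define K where "K = 4 * (c3 * (c1 * c2))"
    have K: "0 < K" using c1 c2 c3 by (simp add: K_def)
    have "wnorm_pow p q f \<ge> ereal (1 / K) * coeff_sum p q a"
      if gm: "GM_family C a" and f: "has_fourier_series f a" for a f
    proof -
      define g where "g z = indicator square z * f z" for z
      have g: "integrable lborel g"
        using f by (simp add: has_fourier_series_def set_integrable_def g_def [abs_def])
      define E where "E = wnorm_pow p q f"
      have sq: "square \<inter> space lborel \<in> sets (lborel :: (real \<times> real) measure)" by simp
      have "AE z in restrict_space lborel square. ereal (absprod z powr (1/p) * \<bar>f z\<bar>) \<le> E"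
        unfolding E_def wnorm_pow_def using PInf by (simp add: esssup_AE)
      then have AE_E: "AE z in lborel. z \<in> square \<longrightarrow> ereal (absprod z powr (1/p) * \<bar>f z\<bar>) \<le> E"
        by (subst (asm) AE_restrict_space_iff [OF sq])
      \<comment> \<open>Over a null set an essential supremum would be \<open>- \<infinity>\<close>;
        the positive measure of the square excludes a negative value.\<close>
      have E0: "0 \<le> E"
      proof (rule ccontr)
        assume neg: "\<not> 0 \<le> E"
        have "AE z in lborel. z \<notin> square"
          using AE_E
        proof eventually_elim
          case (elim z)
          have "0 \<le> ereal (absprod z powr (1/p) * \<bar>f z\<bar>)" by simp
          then show ?case using elim neg order_trans by blast
        qed
        then have "emeasure lborel square = 0"
          by (subst (asm) AE_iff_measurable [OF _ refl]) auto
        moreover have "emeasure lborel square = ennreal (2 * pi) * ennreal (2 * pi)"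
          unfolding square_def by (subst lborel_prod [symmetric], subst lborel.emeasure_pair_measure_Times) auto
        ultimately show False using pi_gt_zero by (simp add: ennreal_mult [symmetric])
      qed
      show ?thesis
      proof (cases E)
        case (real F)
        with E0 have F0: "0 \<le> F" by simp
        have F: "AE z in lborel. absprod z powr (1 / p) * \<bar>g z\<bar> \<le> F"
          using AE_E by eventually_elim (use F0 real in \<open>auto simp: g_def indicator_def\<close>)
        have bnd: "(SUP mn\<in>{1..}\<times>{1..}. ereal ((real (fst mn) * real (snd mn)) powr (1 / conj_exp p) * \<bar>a i j (fst mn) (snd mn)\<bar>))
            \<le> ereal (c3 * (c1 * c2) * F)" if ij: "i < 2" "j < 2" for i j
        proof (rule SUP_least)
          fix mn :: "nat \<times> nat" assume mn: "mn \<in> {1..}\<times>{1..}"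
          obtain e where "gm_sequence (a i j) (max C 1) e"
            using gm_sequence_of_GMc gm ij by blast
          then interpret gm_sequence "a i j" "max C 1" e .
          have "wcoeff \<sigma> (a i j) x \<le> c1 * (c2 * F)" for x
          proof (rule c1(2) [OF gm_sequence_axioms])
            show "block_bound (a i j) (kernel_mean g)"
              using block_bound_fourier [OF f ij] by (simp add: g_def [abs_def])
            show "dscale x powr \<sigma> * kernel_mean g x \<le> c2 * F" for x
              by (intro c2 g F0 F)
          qed
          then have "(real (fst mn) * real (snd mn)) powr \<sigma> * \<bar>a i j (fst mn) (snd mn)\<bar> \<le> 4 powr \<sigma> * (1 + 2 * max C 1) * (c1 * (c2 * F))"
            using mn s by (intro abs_le_of_wcoeff_le) auto
          then show "ereal ((real (fst mn) * real (snd mn)) powr (1 / conj_exp p) * \<bar>a i j (fst mn) (snd mn)\<bar>) \<le> ereal (c3 * (c1 * c2) * F)"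
            using conj_exp_inverse [OF p] by (simp add: \<sigma>_def c3_def mult_ac)
        qed
        have "coeff_sum p q a \<le> (\<Sum>i<2::nat. \<Sum>j<2::nat. ereal (c3 * (c1 * c2) * F))"
          unfolding coeff_sum_def if_P [OF PInf] by (intro sum_mono bnd) simp_all
        also have "\<dots> = ereal (K * F)"
          by (simp add: K_def numeral_2_eq_2)
        finally have "ereal (1 / K) * coeff_sum p q a \<le> ereal (1 / K) * ereal (K * F)"
          using K by (intro ereal_mult_left_mono) auto
        then show ?thesis using K real by (simp add: E_def)
      qed (use E0 in \<open>auto simp: E_def\<close>)
    qed
    with K show thesis by (intro that [of "1 / K"]) auto
  qed (use q in auto)
qed

section \<open>Convergence and summation by parts\<close>

definition rect_sum :: "nat \<Rightarrow> nat \<Rightarrow> (nat \<Rightarrow> nat \<Rightarrow> real) \<Rightarrow> nat \<Rightarrow> nat \<Rightarrow> real \<times> real \<Rightarrow> real" where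
  "rect_sum i j a M N z =
     (\<Sum>m=1..M. \<Sum>n=1..N. a m n * trig i (real m * fst z) * trig j (real n * snd z))"

lemma partial_sum_eq: "partial_sum a M N x y = (\<Sum>i<2. \<Sum>j<2. rect_sum i j (a i j) M N (x, y))"
  by (simp add: partial_sum_def rect_sum_def)

definition dvar :: "(nat \<Rightarrow> nat \<Rightarrow> real) \<Rightarrow> nat \<times> nat \<Rightarrow> real" where
  "dvar a x = (\<Sum>m\<in>dyadic (fst x). \<Sum>n\<in>dyadic (snd x). \<bar>Delta11 a m n\<bar>)"

text \<open>Extension by zero, so that series over positive indices become integrals for the
  counting measure on all pairs and dominated convergence is available.\<close>

definition Delta_pos :: "(nat \<Rightarrow> nat \<Rightarrow> real) \<Rightarrow> nat \<times> nat \<Rightarrow> real" where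
  "Delta_pos a x = (if 1 \<le> fst x \<and> 1 \<le> snd x then Delta11 a (fst x) (snd x) else 0)"

text \<open>The minimum carries the cut-off of the partial sum through the summation by parts; once
  \<open>M \<ge> k\<close> the value no longer depends on \<open>M\<close>.\<close>

definition trig_partial :: "nat \<Rightarrow> nat \<Rightarrow> nat \<Rightarrow> real \<Rightarrow> real" where
  "trig_partial i M k t = (\<Sum>m=1..<1 + min M k. trig i (real m * t))"

abbreviation Delta_summable :: "(nat \<Rightarrow> nat \<Rightarrow> real) \<Rightarrow> bool" where
  "Delta_summable a \<equiv> integrable (count_space UNIV) (Delta_pos a)"

lemma dvar_nonneg [simp]: "0 \<le> dvar a x"
  by (simp add: dvar_def sum_nonneg)

text \<open>Within a block \<open>u\<close> is replaced by its majorant \<open>U\<close>, and what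
  remains of the mixed differences is \<open>dvar\<close>. Terms with a zero index vanish by the
  definition of \<open>Delta_pos\<close>.\<close>

lemma nn_integral_Delta_le:
  assumes U: "\<And>I J m n. m \<in> dyadic I \<Longrightarrow> n \<in> dyadic J \<Longrightarrow> u (m, n) \<le> U (I, J)"
    and u: "\<And>x. 0 \<le> u x" and U0: "\<And>x. 0 \<le> U x"
  shows "psum (\<lambda>x. \<bar>Delta_pos a x\<bar> * u x)
    \<le> psum (\<lambda>x. dvar a x * U x)"
proof -
  define h where "h m n = ennreal (\<bar>Delta_pos a (m, n)\<bar> * u (m, n))" for m n
  have offset: "suminf f = (\<Sum>n. f (Suc n))" if "f 0 = 0" for f :: "nat \<Rightarrow> ennreal"
    using suminf_offset [of f 1] that by simp
  have "psum (\<lambda>x. \<bar>Delta_pos a x\<bar> * u x) = (\<Sum>m. \<Sum>n. h m n)"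
    by (simp add: nn_integral_fst_count_space [symmetric] nn_integral_count_space_nat h_def)
  also have "\<dots> = (\<Sum>m. \<Sum>n. h (Suc m) n)"
    by (rule offset) (simp add: h_def Delta_pos_def)
  also have "\<dots> = (\<Sum>m. \<Sum>n. h (Suc m) (Suc n))"
    by (intro arg_cong [where f = suminf] ext offset) (simp add: h_def Delta_pos_def)
  also have "\<dots> = (\<Sum>I. \<Sum>J. \<Sum>m\<in>dyadic I. \<Sum>n\<in>dyadic J. h m n)"
    by (rule double_suminf_dyadic)
  also have "\<dots> \<le> (\<Sum>I. \<Sum>J. ennreal (dvar a (I, J) * U (I, J)))"
  proof (intro suminf_le)
    fix I J
    have "(\<Sum>m\<in>dyadic I. \<Sum>n\<in>dyadic J. h m n) = ennreal (\<Sum>m\<in>dyadic I. \<Sum>n\<in>dyadic J. \<bar>Delta_pos a (m, n)\<bar> * u (m, n))"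
      using u by (simp add: h_def sum_ennreal sum_nonneg)
    also have "\<dots> \<le> ennreal (\<Sum>m\<in>dyadic I. \<Sum>n\<in>dyadic J. \<bar>Delta11 a m n\<bar> * U (I, J))"
      using u U by (intro ennreal_leI sum_mono mult_mono) (auto simp: Delta_pos_def)
    also have "\<dots> = ennreal (dvar a (I, J) * U (I, J))"
      by (simp add: dvar_def sum_distrib_right)
    finally show "(\<Sum>m\<in>dyadic I. \<Sum>n\<in>dyadic J. h m n) \<le> ennreal (dvar a (I, J) * U (I, J))" .
  qed auto
  also have "\<dots> = psum (\<lambda>x. dvar a x * U x)"
    by (simp add: nn_integral_nat_pair)
  finally show ?thesis .
qed

section \<open>Partial sums as integrals over mixed differences\<close>

lemma dker_Suc_le: "dker (Suc I) t \<le> dker I t"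
proof (cases "t = 0")
  case False
  then have "pi / (2 ^ Suc I * \<bar>t\<bar>) \<le> pi / (2 ^ I * \<bar>t\<bar>)"
    by (intro divide_left_mono) auto
  then show ?thesis unfolding dker_def by linarith
qed (simp add: dker_def)

text \<open>For \<open>k\<close> in the block of level \<open>I\<close> up to
  \<open>2 ^ Suc I\<close> terms may occur, so the kernel bound is taken at level
  \<open>Suc I\<close>; returning to level \<open>I\<close> leaves the factor
  \<open>2\<close>.\<close>

lemma trig_partial_le_dker:
  assumes "\<bar>t\<bar> \<le> pi" "t \<noteq> 0" "k \<in> dyadic I"
  shows "\<bar>trig_partial i M k t\<bar> \<le> 2 * (2 ^ I * dker I t)"
proof -
  have "min M k \<le> 2 ^ Suc I" using assms(3) by (auto simp: dyadic_def)
  then have "\<bar>trig_partial i M k t\<bar> \<le> 2 ^ Suc I * dker (Suc I) t"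
    unfolding trig_partial_def using assms by (intro trig_sum_le_dker) auto
  also have "\<dots> \<le> 2 ^ Suc I * dker I t"
    by (intro mult_left_mono dker_Suc_le) auto
  finally show ?thesis by simp
qed

lemma Delta_rectangle_sum:
  assumes "m \<le> R" "n \<le> R"
  shows "(\<Sum>\<mu>=m..<R. \<Sum>\<nu>=n..<R. Delta11 a \<mu> \<nu>) = a m n - a R n - a m R + a R R"
proof -
  have "(\<Sum>\<nu>=n..<R. Delta11 a \<mu> \<nu>) = - (\<Sum>\<nu>=n..<R. (a \<mu> (Suc \<nu>) - a (Suc \<mu>) (Suc \<nu>)) - (a \<mu> \<nu> - a (Suc \<mu>) \<nu>))" for \<mu>
    unfolding sum_negf [symmetric] by (intro sum.cong) (auto simp: Delta11_def)
  also have "\<dots> \<mu> = - ((a \<mu> R - a (Suc \<mu>) R) - (a \<mu> n - a (Suc \<mu>) n))" for \<mu>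
    using assms by (subst sum_Suc_diff' [of n R "\<lambda>\<nu>. a \<mu> \<nu> - a (Suc \<mu>) \<nu>"]) auto
  finally have inner: "(\<Sum>\<nu>=n..<R. Delta11 a \<mu> \<nu>) = - ((a \<mu> R - a (Suc \<mu>) R) - (a \<mu> n - a (Suc \<mu>) n))" for \<mu> .
  have "(\<Sum>\<mu>=m..<R. \<Sum>\<nu>=n..<R. Delta11 a \<mu> \<nu>)
      = (\<Sum>\<mu>=m..<R. (a (Suc \<mu>) R - a (Suc \<mu>) n) - (a \<mu> R - a \<mu> n))"
    by (intro sum.cong refl, subst inner) simp
  also have "\<dots> = (a R R - a R n) - (a m R - a m n)"
    using assms by (subst sum_Suc_diff' [of m R "\<lambda>\<mu>. a \<mu> R - a \<mu> n"]) auto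
  finally show ?thesis by simp
qed

lemma tends_to_zero2_diagonal:
  assumes "tends_to_zero2 a"
  shows "(\<lambda>R. a R R) \<longlonglongrightarrow> 0"
proof (rule LIMSEQ_I)
  fix e :: real assume "0 < e"
  with assms obtain N where N: "\<And>m n. 1 \<le> m \<Longrightarrow> 1 \<le> n \<Longrightarrow> N \<le> m + n \<Longrightarrow> \<bar>a m n\<bar> < e"
    unfolding tends_to_zero2_def by meson
  show "\<exists>no. \<forall>n\<ge>no. norm (a n n - 0) < e"
    using N by (intro exI [of _ "Suc N"]) auto
qed

text \<open>Telescoping over a finite square up to \<open>R\<close> leaves four corner values, three
  of which vanish as \<open>R\<close> grows. Absolute summability of the mixed differences carries
  the limit to the infinite sum.\<close>

lemma coefficient_eq_tail_sum:
  assumes tz: "tends_to_zero2 a" and int: "Delta_summable a" and mn: "1 \<le> m" "1 \<le> n"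
  shows "a m n = (\<integral>x. Delta_pos a x * of_bool (m \<le> fst x \<and> n \<le> snd x) \<partial>count_space UNIV)"
proof -
  define F where "F R x = Delta_pos a x * of_bool (m \<le> fst x \<and> n \<le> snd x \<and> fst x < R \<and> snd x < R)" for R x
  have lim1: "(\<lambda>R. integral\<^sup>L (count_space UNIV) (F R)) \<longlonglongrightarrow> (\<integral>x. Delta_pos a x * of_bool (m \<le> fst x \<and> n \<le> snd x) \<partial>count_space UNIV)"
  proof (rule integral_dominated_convergence [where w = "\<lambda>x. \<bar>Delta_pos a x\<bar>"])
    show "AE x in count_space UNIV. (\<lambda>R. F R x) \<longlonglongrightarrow> Delta_pos a x * of_bool (m \<le> fst x \<and> n \<le> snd x)"
    proof (intro AE_I2 tendsto_eventually)
      fix x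
      show "\<forall>\<^sub>F R in sequentially. F R x = Delta_pos a x * of_bool (m \<le> fst x \<and> n \<le> snd x)"
        using eventually_gt_at_top [of "fst x"] eventually_gt_at_top [of "snd x"]
        by eventually_elim (simp add: F_def)
    qed
    show "AE x in count_space UNIV. norm (F R x) \<le> \<bar>Delta_pos a x\<bar>" for R
      by (auto simp: F_def)
  qed (use int in auto)
  have ev: "\<forall>\<^sub>F R in sequentially. integral\<^sup>L (count_space UNIV) (F R) = a m n - a R n - a m R + a R R"
    using eventually_ge_at_top [of "max m n"]
  proof eventually_elim
    case (elim R)
    have sub: "{x \<in> UNIV. F R x \<noteq> 0} \<subseteq> {m..<R} \<times> {n..<R}"
      by (auto simp: F_def)
    then have "integral\<^sup>L (count_space UNIV) (F R) = (\<Sum>x | x \<in> UNIV \<and> F R x \<noteq> 0. F R x)"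
      by (intro lebesgue_integral_count_space_finite_support) (rule finite_subset, auto)
    also have "\<dots> = (\<Sum>x\<in>{m..<R} \<times> {n..<R}. F R x)"
      using sub by (intro sum.mono_neutral_left) auto
    also have "\<dots> = (\<Sum>\<mu>=m..<R. \<Sum>\<nu>=n..<R. Delta11 a \<mu> \<nu>)"
      unfolding sum.cartesian_product using mn
      by (intro sum.cong refl) (auto simp: F_def Delta_pos_def)
    also have "\<dots> = a m n - a R n - a m R + a R R"
      using elim by (intro Delta_rectangle_sum) auto
    finally show ?case .
  qed
  have "(\<lambda>R. a m n - a R n - a m R + a R R) \<longlonglongrightarrow> a m n - 0 - 0 + 0"
    using mn by (intro tendsto_intros tendsto_zero_row tendsto_zero_col tends_to_zero2_diagonal tz)
  then have "(\<lambda>R. integral\<^sup>L (count_space UNIV) (F R)) \<longlonglongrightarrow> a m n"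
    by (subst tendsto_cong [OF ev]) simp
  then show ?thesis using lim1 by (rule LIMSEQ_unique)
qed

text \<open>Summation by parts: no boundary terms occur, since every coefficient is the full sum of
  the mixed differences beyond it.\<close>

lemma rect_sum_eq_integral:
  assumes tz: "tends_to_zero2 a" and int: "Delta_summable a"
  shows "rect_sum i j a M N z
    = (\<integral>x. Delta_pos a x * (trig_partial i M (fst x) (fst z) * trig_partial j N (snd x) (snd z)) \<partial>count_space UNIV)"
proof -
  define T where "T m n = trig i (real m * fst z) * trig j (real n * snd z)" for m n
  have intb: "integrable (count_space UNIV) (\<lambda>x. Delta_pos a x * of_bool (m \<le> fst x \<and> n \<le> snd x))" for m n
    by (rule Bochner_Integration.integrable_bound [OF int]) auto
  have tp: "trig_partial i M k t = (\<Sum>m=1..M. of_bool (m \<le> k) * trig i (real m * t))" for i M k t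
  proof -
    have "(\<Sum>m=1..M. of_bool (m \<le> k) * trig i (real m * t)) = (\<Sum>m\<in>{m\<in>{1..M}. m \<le> k}. trig i (real m * t))"
      by (intro sum.mono_neutral_cong_right) auto
    also have "{m\<in>{1..M}. m \<le> k} = {1..<1 + min M k}" by auto
    finally show ?thesis by (simp add: trig_partial_def)
  qed
  have "rect_sum i j a M N z = (\<Sum>m=1..M. \<Sum>n=1..N. T m n * a m n)"
    by (simp add: rect_sum_def T_def mult_ac)
  also have "\<dots> = (\<Sum>m=1..M. \<Sum>n=1..N. T m n * (\<integral>x. Delta_pos a x * of_bool (m \<le> fst x \<and> n \<le> snd x) \<partial>count_space UNIV))"
    using coefficient_eq_tail_sum [OF tz int] by (intro sum.cong refl arg_cong2 [of _ _ _ _ "(*)"]) auto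
  also have "\<dots> = (\<integral>x. (\<Sum>m=1..M. \<Sum>n=1..N. T m n * (Delta_pos a x * of_bool (m \<le> fst x \<and> n \<le> snd x))) \<partial>count_space UNIV)"
    using intb by (simp add: Bochner_Integration.integral_sum)
  also have "\<dots> = (\<integral>x. Delta_pos a x * (trig_partial i M (fst x) (fst z) * trig_partial j N (snd x) (snd z)) \<partial>count_space UNIV)"
  proof (intro Bochner_Integration.integral_cong refl)
    fix x
    have "Delta_pos a x * (trig_partial i M (fst x) (fst z) * trig_partial j N (snd x) (snd z))
      = (\<Sum>m=1..M. \<Sum>n=1..N. Delta_pos a x * ((of_bool (m \<le> fst x) * trig i (real m * fst z)) * (of_bool (n \<le> snd x) * trig j (real n * snd z))))"
      unfolding tp sum_product by (simp only: sum_distrib_left)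
    also have "\<dots> = (\<Sum>m=1..M. \<Sum>n=1..N. T m n * (Delta_pos a x * of_bool (m \<le> fst x \<and> n \<le> snd x)))"
      by (intro sum.cong refl) (simp add: T_def)
    finally show "(\<Sum>m=1..M. \<Sum>n=1..N. T m n * (Delta_pos a x * of_bool (m \<le> fst x \<and> n \<le> snd x)))
      = Delta_pos a x * (trig_partial i M (fst x) (fst z) * trig_partial j N (snd x) (snd z))" by simp
  qed
  finally show ?thesis .
qed

lemma rect_sum_le:
  assumes tz: "tends_to_zero2 a" and int: "Delta_summable a"
    and z: "\<bar>fst z\<bar> \<le> pi" "\<bar>snd z\<bar> \<le> pi" "fst z \<noteq> 0" "snd z \<noteq> 0"
  shows "ennreal \<bar>rect_sum i j a M N z\<bar> \<le> psum (\<lambda>x. dker2 x z * (4 * dscale x * dvar a x))"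
proof -
  let ?u = "\<lambda>x. trig_partial i M (fst x) (fst z) * trig_partial j N (snd x) (snd z)"
  let ?g = "\<lambda>x. Delta_pos a x * ?u x"
  have "ennreal \<bar>rect_sum i j a M N z\<bar> \<le> psum (\<lambda>x. norm (?g x))"
  \<comment> \<open>Without integrability the Bochner integral is zero by convention and the bound
    is trivial.\<close>
  proof (cases "integrable (count_space UNIV) ?g")
    case True
    have "ennreal (norm (integral\<^sup>L (count_space UNIV) ?g)) \<le> psum (\<lambda>x. norm (?g x))"
      using True by (rule integral_norm_bound_ennreal)
    then show ?thesis by (simp only: rect_sum_eq_integral [OF tz int] real_norm_def)
  next
    case False
    then have "rect_sum i j a M N z = 0"
      unfolding rect_sum_eq_integral [OF tz int] by (rule not_integrable_integral_eq)
    then show ?thesis by simp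
  qed
  also have "\<dots> = psum (\<lambda>x. \<bar>Delta_pos a x\<bar> * \<bar>?u x\<bar>)"
    by (simp add: abs_mult)
  also have "\<dots> \<le> psum (\<lambda>x. dvar a x * (4 * dscale x * dker2 x z))"
  proof (rule nn_integral_Delta_le)
    fix I J m n assume "m \<in> dyadic I" "n \<in> dyadic J"
    then have "\<bar>trig_partial i M m (fst z)\<bar> * \<bar>trig_partial j N n (snd z)\<bar>
        \<le> (2 * (2 ^ I * dker I (fst z))) * (2 * (2 ^ J * dker J (snd z)))"
      using z by (intro mult_mono trig_partial_le_dker) auto
    then show "\<bar>trig_partial i M (fst (m, n)) (fst z) * trig_partial j N (snd (m, n)) (snd z)\<bar>
        \<le> 4 * dscale (I, J) * dker2 (I, J) z"
      by (simp add: abs_mult dscale_def dker2_def mult_ac)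
  qed (auto intro!: mult_nonneg_nonneg less_imp_le [OF dscale_pos])
  finally show ?thesis by (simp add: mult_ac)
qed

text \<open>\<open>lim\<close> along the diagonal is total and measurable in \<open>z\<close>;
  wherever the double limit exists, it is this value.\<close>

definition rect_limit :: "nat \<Rightarrow> nat \<Rightarrow> (nat \<Rightarrow> nat \<Rightarrow> real) \<Rightarrow> real \<times> real \<Rightarrow> real" where
  "rect_limit i j a z = lim (\<lambda>N. rect_sum i j a N N z)"

text \<open>Dominated convergence over index pairs: each term is eventually constant, and the
  half-angle sines bound the trigonometric factors by \<open>1 / c\<close> uniformly in
  \<open>M\<close> and \<open>N\<close>. This settles all sequences whose \<open>k\<close>-th
  members are at least \<open>k\<close> in both components; a failure of the double limit would
  produce such a sequence staying away from \<open>L\<close>.\<close>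

lemma rect_sum_tendsto:
  assumes tz: "tends_to_zero2 a" and int: "Delta_summable a"
    and z: "sin (fst z / 2) \<noteq> 0" "sin (snd z / 2) \<noteq> 0"
  shows "((\<lambda>(M, N). rect_sum i j a M N z) \<longlongrightarrow> rect_limit i j a z) (sequentially \<times>\<^sub>F sequentially)"
proof -
  define P where "P M N x = trig_partial i M (fst x) (fst z) * trig_partial j N (snd x) (snd z)" for M N and x :: "nat \<times> nat"
  define Q where "Q x = P (fst x) (snd x) x" for x
  define L where "L = (\<integral>x. Delta_pos a x * Q x \<partial>count_space UNIV)"
  define c where "c = \<bar>sin (fst z / 2)\<bar> * \<bar>sin (snd z / 2)\<bar>"
  have c: "0 < c" using z by (simp add: c_def)
  have P_le: "\<bar>P M N x\<bar> \<le> 1 / c" for M N x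
  proof -
    have "c * \<bar>P M N x\<bar> = (\<bar>sin (fst z / 2)\<bar> * \<bar>trig_partial i M (fst x) (fst z)\<bar>)
        * (\<bar>sin (snd z / 2)\<bar> * \<bar>trig_partial j N (snd x) (snd z)\<bar>)"
      by (simp add: c_def P_def abs_mult)
    also have "\<dots> \<le> 1"
      unfolding trig_partial_def by (intro mult_le_one trig_sum_le_sin) auto
    finally show ?thesis using c by (simp add: field_simps)
  qed
  have seq: "(\<lambda>k. rect_sum i j a (f k) (g k) z) \<longlonglongrightarrow> L"
    if f: "\<And>k. k \<le> f k" and g: "\<And>k. k \<le> g k" for f g :: "nat \<Rightarrow> nat"
    unfolding rect_sum_eq_integral [OF tz int] L_def P_def [symmetric]
  proof (rule integral_dominated_convergence [where w = "\<lambda>x. \<bar>Delta_pos a x\<bar> * (1 / c)"])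
    show "AE x in count_space UNIV. (\<lambda>k. Delta_pos a x * P (f k) (g k) x) \<longlonglongrightarrow> Delta_pos a x * Q x"
    proof (intro AE_I2 tendsto_eventually)
      fix x
      show "\<forall>\<^sub>F k in sequentially. Delta_pos a x * P (f k) (g k) x = Delta_pos a x * Q x"
        using eventually_ge_at_top [of "max (fst x) (snd x)"]
      proof eventually_elim
        case (elim k)
        then have "fst x \<le> f k" "snd x \<le> g k" using f [of k] g [of k] by auto
        then show ?case by (simp add: P_def Q_def trig_partial_def min_absorb2)
      qed
    qed
    show "AE x in count_space UNIV. norm (Delta_pos a x * P (f k) (g k) x) \<le> \<bar>Delta_pos a x\<bar> * (1 / c)" for k
      using P_le by (intro AE_I2) (simp add: abs_mult mult_left_mono del: times_divide_eq_right)
    show "integrable (count_space UNIV) (\<lambda>x. \<bar>Delta_pos a x\<bar> * (1 / c))"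
      using int by (intro integrable_mult_left integrable_abs)
  qed auto
  have lim: "rect_limit i j a z = L"
    unfolding rect_limit_def by (intro limI seq) auto
  show ?thesis
    unfolding lim tendsto_iff
  proof (intro allI impI, rule ccontr)
    fix e :: real assume "0 < e"
      and "\<not> (\<forall>\<^sub>F x in sequentially \<times>\<^sub>F sequentially. dist (case x of (M, N) \<Rightarrow> rect_sum i j a M N z) L < e)"
    then have "\<forall>k. \<exists>M N. k \<le> M \<and> k \<le> N \<and> e \<le> dist (rect_sum i j a M N z) L"
      by (simp add: eventually_prod_sequentially not_less) blast
    then obtain f g where fg: "\<And>k. k \<le> f k" "\<And>k. k \<le> g k" "\<And>k. e \<le> dist (rect_sum i j a (f k) (g k) z) L"
      by metis
    have "\<forall>\<^sub>F k in sequentially. dist (rect_sum i j a (f k) (g k) z) L < e"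
      using tendstoD [OF seq [of f g] \<open>0 < e\<close>] fg by auto
    then obtain k where "dist (rect_sum i j a (f k) (g k) z) L < e"
      by (auto simp: eventually_sequentially)
    with fg(3) [of k] show False by simp
  qed
qed

lemma rect_sum_diag_tendsto:
  assumes "tends_to_zero2 a" "Delta_summable a"
    "sin (fst z / 2) \<noteq> 0" "sin (snd z / 2) \<noteq> 0"
  shows "(\<lambda>N. rect_sum i j a N N z) \<longlonglongrightarrow> rect_limit i j a z"
proof -
  have "LIM N sequentially. (N, N) :> sequentially \<times>\<^sub>F sequentially"
    by (intro filterlim_Pair filterlim_ident)
  from filterlim_compose [OF rect_sum_tendsto [OF assms] this] show ?thesis by simp
qed

lemma sin_half_nonzero:
  assumes "\<bar>t\<bar> \<le> pi" "t \<noteq> 0"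
  shows "sin (t / 2) \<noteq> 0"
proof -
  have "2 / pi * (\<bar>t\<bar> / 2) \<le> sin (\<bar>t\<bar> / 2)"
    using assms by (intro jordan_inequality) auto
  moreover have "0 < 2 / pi * (\<bar>t\<bar> / 2)" using assms by simp
  ultimately have "sin (\<bar>t\<bar> / 2) \<noteq> 0" by linarith
  then show ?thesis by (cases "t \<ge> 0") auto
qed

lemma rect_limit_le:
  assumes "tends_to_zero2 a" "Delta_summable a"
    and z: "\<bar>fst z\<bar> \<le> pi" "\<bar>snd z\<bar> \<le> pi" "fst z \<noteq> 0" "snd z \<noteq> 0"
  shows "ennreal \<bar>rect_limit i j a z\<bar> \<le> psum (\<lambda>x. dker2 x z * (4 * dscale x * dvar a x))"
proof (rule LIMSEQ_le_const2)
  show "(\<lambda>N. ennreal \<bar>rect_sum i j a N N z\<bar>) \<longlonglongrightarrow> ennreal \<bar>rect_limit i j a z\<bar>"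
    using assms by (intro tendsto_ennrealI tendsto_rabs rect_sum_diag_tendsto sin_half_nonzero) auto
  show "\<exists>N. \<forall>n\<ge>N. ennreal \<bar>rect_sum i j a n n z\<bar> \<le> psum (\<lambda>x. dker2 x z * (4 * dscale x * dvar a x))"
    using rect_sum_le [OF assms] by blast
qed

lemma borel_measurable_rect_sum [measurable]: "rect_sum i j a M N \<in> borel_measurable borel"
  unfolding rect_sum_def [abs_def] by measurable

lemma borel_measurable_rect_limit [measurable]: "rect_limit i j a \<in> borel_measurable borel"
  unfolding rect_limit_def [abs_def] by measurable

text \<open>The hypothesis bounds each \<open>dvar a x\<close> by a multiple of
  \<open>dscale x powr - \<sigma>\<close>, and summability of these powers is read off from the
  kernel sum bound at a single point.\<close>

lemma integrable_Delta_pos: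
  assumes s: "0 < \<sigma>" "\<sigma> < 1" and B: "\<And>x. dscale x powr \<sigma> * dvar a x \<le> B"
  shows "Delta_summable a"
proof (rule integrableI_bounded)
  have "0 < 1 - \<sigma>" "1 - \<sigma> < 1" using s by auto
  from dker2_sum_bound [OF this] obtain c where c: "0 < c"
    "\<And>z. fst z \<noteq> 0 \<Longrightarrow> snd z \<noteq> 0 \<Longrightarrow>
       psum (\<lambda>x. dker2 x z * dscale x powr (1 - \<sigma>)) \<le> ennreal (c * absprod z powr - (1 - \<sigma>))"
    by blast
  \<comment> \<open>At \<open>(pi, pi)\<close> the kernel is exactly \<open>1 / dscale\<close>,
    which turns the exponent \<open>1 - \<sigma>\<close> into \<open>- \<sigma>\<close>.\<close>
  have "dker I pi = 1 / 2 ^ I" for I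
    by (simp add: dker_def min_absorb2)
  then have dk: "dker2 x (pi, pi) = 1 / dscale x" for x
    by (simp add: dker2_def dscale_def)
  have "psum (\<lambda>x. norm (Delta_pos a x))
      = psum (\<lambda>x. \<bar>Delta_pos a x\<bar> * 1)" by simp
  also have "\<dots> \<le> psum (\<lambda>x. dvar a x * 1)"
    by (rule nn_integral_Delta_le) auto
  also have "\<dots> \<le> (\<integral>\<^sup>+x. ennreal B * ennreal (dker2 x (pi, pi) * dscale x powr (1 - \<sigma>)) \<partial>count_space UNIV)"
  proof (rule nn_integral_mono)
    fix x
    have "0 \<le> dscale x powr \<sigma> * dvar a x" by simp
    then have B0: "0 \<le> B" using B [of x] by linarith
    have "dvar a x = dscale x powr - \<sigma> * (dscale x powr \<sigma> * dvar a x)"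
      by (simp add: powr_minus less_imp_neq [symmetric])
    also have "\<dots> \<le> dscale x powr - \<sigma> * B"
      by (intro mult_left_mono B) auto
    also have "\<dots> = B * (dker2 x (pi, pi) * dscale x powr (1 - \<sigma>))"
      by (simp add: dk powr_diff powr_minus_divide less_imp_le less_imp_neq [symmetric])
    finally show "ennreal (dvar a x * 1) \<le> ennreal B * ennreal (dker2 x (pi, pi) * dscale x powr (1 - \<sigma>))"
      using B0 by (simp add: ennreal_mult [symmetric] ennreal_leI)
  qed
  also have "\<dots> = ennreal B * psum (\<lambda>x. dker2 x (pi, pi) * dscale x powr (1 - \<sigma>))"
    by (rule nn_integral_cmult) simp
  also have "\<dots> < \<infinity>"
    using c(2) [of "(pi, pi)"] by (auto simp: ennreal_mult_less_top intro: le_less_trans)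
  finally show "psum (\<lambda>x. norm (Delta_pos a x)) < \<infinity>" .
qed auto

text \<open>The pointwise form of the upper estimate. With \<open>1 - \<sigma> = 1 / p\<close> the
  majorant is integrable on the square; it supplies the dominating function for the partial sums and
  settles the norm estimate for infinite exponent.\<close>

lemma kernel_sum_le:
  fixes \<sigma> :: real
  assumes s: "0 < \<sigma>" "\<sigma> < 1"
  obtains c where "0 < c"
    "\<And>a B z. (\<And>x. dscale x powr \<sigma> * dvar a x \<le> B) \<Longrightarrow> fst z \<noteq> 0 \<Longrightarrow> snd z \<noteq> 0 \<Longrightarrow>
      psum (\<lambda>x. dker2 x z * (4 * dscale x * dvar a x))
      \<le> ennreal (c * B * absprod z powr - (1 - \<sigma>))"
proof -
  have "0 < 1 - \<sigma>" "1 - \<sigma> < 1" using s by auto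
  from dker2_sum_bound [OF this] obtain c where c: "0 < c"
    "\<And>z. fst z \<noteq> 0 \<Longrightarrow> snd z \<noteq> 0 \<Longrightarrow>
       psum (\<lambda>x. dker2 x z * dscale x powr (1 - \<sigma>)) \<le> ennreal (c * absprod z powr - (1 - \<sigma>))"
    by blast
  have "psum (\<lambda>x. dker2 x z * (4 * dscale x * dvar a x))
      \<le> ennreal (4 * c * B * absprod z powr - (1 - \<sigma>))"
    if B: "\<And>x. dscale x powr \<sigma> * dvar a x \<le> B" and z: "fst z \<noteq> 0" "snd z \<noteq> 0" for a B z
  proof -
    have "0 \<le> dscale (0, 0) powr \<sigma> * dvar a (0, 0)" by simp
    then have B0: "0 \<le> B" using B [of "(0, 0)"] by linarith
    have "psum (\<lambda>x. dker2 x z * (4 * dscale x * dvar a x))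
        \<le> (\<integral>\<^sup>+x. ennreal (4 * B) * ennreal (dker2 x z * dscale x powr (1 - \<sigma>)) \<partial>count_space UNIV)"
    proof (rule nn_integral_mono)
      fix x
      have "dscale x * dvar a x = dscale x powr (1 - \<sigma>) * (dscale x powr \<sigma> * dvar a x)"
        by (simp add: powr_diff less_imp_le less_imp_neq [symmetric])
      also have "\<dots> \<le> dscale x powr (1 - \<sigma>) * B"
        by (intro mult_left_mono B) auto
      finally have "dker2 x z * (4 * (dscale x * dvar a x)) \<le> dker2 x z * (4 * (dscale x powr (1 - \<sigma>) * B))"
        by (intro mult_left_mono) auto
      then show "ennreal (dker2 x z * (4 * dscale x * dvar a x)) \<le> ennreal (4 * B) * ennreal (dker2 x z * dscale x powr (1 - \<sigma>))"
        using B0 by (simp add: ennreal_mult' [symmetric] ennreal_leI mult_ac)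
    qed
    also have "\<dots> = ennreal (4 * B) * psum (\<lambda>x. dker2 x z * dscale x powr (1 - \<sigma>))"
      by (rule nn_integral_cmult) simp
    also have "\<dots> \<le> ennreal (4 * B) * ennreal (c * absprod z powr - (1 - \<sigma>))"
      using z by (intro mult_left_mono c) auto
    also have "\<dots> = ennreal (4 * c * B * absprod z powr - (1 - \<sigma>))"
      using B0 c by (simp add: ennreal_mult' [symmetric] mult_ac)
    finally show ?thesis .
  qed
  moreover have "0 < 4 * c" using c by simp
  ultimately show thesis by (rule that [rotated])
qed

section \<open>Fourier coefficients of the sum\<close>

lemma has_integral_cos_int:
  "has_bochner_integral lborel (\<lambda>t. cos (of_int k * t) * indicator {-pi..pi} t) (if k = 0 then 2 * pi else 0)"
proof (cases "k = 0")
  case True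
  have "has_bochner_integral lborel (\<lambda>t. 1 * indicator {-pi..pi} t) (pi - (-pi))"
    by (rule has_bochner_integral_FTC_Icc_real) (auto intro!: derivative_eq_intros)
  with True show ?thesis by simp
next
  case False
  have "has_bochner_integral lborel (\<lambda>t. cos (of_int k * t) * indicator {-pi..pi} t)
      (sin (of_int k * pi) / of_int k - sin (of_int k * (-pi)) / of_int k)"
    using False by (intro has_bochner_integral_FTC_Icc_real) (auto intro!: derivative_eq_intros)
  moreover have "sin (of_int k * pi) = 0" using sin_npi_int [of k] by (simp add: mult.commute)
  ultimately show ?thesis using False by simp
qed

lemma has_integral_sin_int:
  "has_bochner_integral lborel (\<lambda>t. sin (of_int k * t) * indicator {-pi..pi} t) 0"
proof (cases "k = 0")
  case False
  have "has_bochner_integral lborel (\<lambda>t. sin (of_int k * t) * indicator {-pi..pi} t)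
      (- cos (of_int k * pi) / of_int k - - cos (of_int k * (-pi)) / of_int k)"
    using False by (intro has_bochner_integral_FTC_Icc_real) (auto intro!: derivative_eq_intros)
  then show ?thesis by simp
qed (simp add: has_bochner_integral_zero)

text \<open>Product-to-sum formulas with frequencies \<open>m - n\<close> and \<open>m + n\<close>.
  Requiring \<open>1 \<le> m\<close> keeps \<open>m + n\<close> nonzero, while \<open>n = 0\<close>
  stays allowed, because coefficients with a zero index must be shown to vanish.\<close>

lemma trig_orthogonality:
  assumes "i < 2" "j < 2" "1 \<le> m"
  shows "has_bochner_integral lborel (\<lambda>t. trig i (real m * t) * trig j (real n * t) * indicator {-pi..pi} t)
    (if i = j \<and> m = n then pi else 0)"
proof -
  define d s :: int where "d = int m - int n" and "s = int m + int n"
  define X where "X k t = cos (of_int k * t) * indicator {-pi..pi} t" for k :: int and t :: real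
  define Y where "Y k t = sin (of_int k * t) * indicator {-pi..pi} t" for k :: int and t :: real
  have hX: "has_bochner_integral lborel (X k) (if k = 0 then 2 * pi else 0)" for k
    unfolding X_def [abs_def] by (rule has_integral_cos_int)
  have hY: "has_bochner_integral lborel (Y k) 0" for k
    unfolding Y_def [abs_def] by (rule has_integral_sin_int)
  have s0: "s \<noteq> 0" and d0: "d = 0 \<longleftrightarrow> m = n" using assms by (auto simp: s_def d_def)
  have rd: "of_int d * t = real m * t - real n * t" "of_int s * t = real m * t + real n * t" for t :: real
    by (simp_all add: d_def s_def algebra_simps)
  consider "i = 0" "j = 0" | "i = 1" "j = 1" | "i = 0" "j = 1" | "i = 1" "j = 0"
    using assms by linarith
  then show ?thesis
  proof cases
    case 1
    have "has_bochner_integral lborel (\<lambda>t. (1/2) * (X d t - X s t)) ((1/2) * ((if d = 0 then 2 * pi else 0) - (if s = 0 then 2 * pi else 0)))"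
      by (intro has_bochner_integral_mult_right has_bochner_integral_diff hX)
    moreover have "(1/2) * (X d t - X s t) = trig i (real m * t) * trig j (real n * t) * indicator {-pi..pi} t" for t
      unfolding X_def rd using 1 by (simp add: trig_def cos_add cos_diff algebra_simps)
    ultimately show ?thesis using 1 s0 d0 by (cases "m = n") simp_all
  next
    case 2
    have "has_bochner_integral lborel (\<lambda>t. (1/2) * (X d t + X s t)) ((1/2) * ((if d = 0 then 2 * pi else 0) + (if s = 0 then 2 * pi else 0)))"
      by (intro has_bochner_integral_mult_right has_bochner_integral_add hX)
    moreover have "(1/2) * (X d t + X s t) = trig i (real m * t) * trig j (real n * t) * indicator {-pi..pi} t" for t
      unfolding X_def rd using 2 by (simp add: trig_def cos_add cos_diff algebra_simps)
    ultimately show ?thesis using 2 s0 d0 by (cases "m = n") simp_all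
  next
    case 3
    have "has_bochner_integral lborel (\<lambda>t. (1/2) * (Y s t + Y d t)) ((1/2) * (0 + 0))"
      by (intro has_bochner_integral_mult_right has_bochner_integral_add hY)
    moreover have "(1/2) * (Y s t + Y d t) = trig i (real m * t) * trig j (real n * t) * indicator {-pi..pi} t" for t
      unfolding Y_def rd using 3 by (simp add: trig_def sin_add sin_diff algebra_simps)
    ultimately show ?thesis using 3 by simp
  next
    case 4
    have "has_bochner_integral lborel (\<lambda>t. (1/2) * (Y s t - Y d t)) ((1/2) * (0 - 0))"
      by (intro has_bochner_integral_mult_right has_bochner_integral_diff hY)
    moreover have "(1/2) * (Y s t - Y d t) = trig i (real m * t) * trig j (real n * t) * indicator {-pi..pi} t" for t
      unfolding Y_def rd using 4 by (simp add: trig_def sin_add sin_diff algebra_simps)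
    ultimately show ?thesis using 4 by simp
  qed
qed

lemma has_integral_lborel_mult:
  fixes f g :: "real \<Rightarrow> real"
  assumes f: "has_bochner_integral lborel f u" and g: "has_bochner_integral lborel g v"
  shows "has_bochner_integral lborel (\<lambda>z. f (fst z) * g (snd z)) (u * v)"
proof -
  have [measurable]: "f \<in> borel_measurable borel" "g \<in> borel_measurable borel"
    using f g by (auto dest: borel_measurable_has_bochner_integral)
  have fi: "integrable lborel f" "integrable lborel g" and ui: "integral\<^sup>L lborel f = u" "integral\<^sup>L lborel g = v"
    using f g by (auto simp: has_bochner_integral_iff)
  have int: "integrable (lborel \<Otimes>\<^sub>M lborel) (\<lambda>z. f (fst z) * g (snd z))"
  proof (rule integrableI_bounded)
    have "(\<integral>\<^sup>+z. ennreal (norm (f (fst z) * g (snd z))) \<partial>(lborel \<Otimes>\<^sub>M lborel))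
        = (\<integral>\<^sup>+z. ennreal \<bar>f (fst z)\<bar> * ennreal \<bar>g (snd z)\<bar> \<partial>lborel)"
      by (simp add: lborel_prod abs_mult ennreal_mult)
    also have "\<dots> = (\<integral>\<^sup>+t. ennreal \<bar>f t\<bar> \<partial>lborel) * (\<integral>\<^sup>+t. ennreal \<bar>g t\<bar> \<partial>lborel)"
      by (rule nn_integral_lborel_mult) auto
    also have "\<dots> < \<infinity>"
      using fi by (auto simp: integrable_iff_bounded ennreal_mult_less_top)
    finally show "(\<integral>\<^sup>+z. ennreal (norm (f (fst z) * g (snd z))) \<partial>(lborel \<Otimes>\<^sub>M lborel)) < \<infinity>" .
  qed measurable
  have "(\<integral>z. f (fst z) * g (snd z) \<partial>(lborel \<Otimes>\<^sub>M lborel)) = (\<integral>x. \<integral>y. f x * g y \<partial>lborel \<partial>lborel)"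
    using lborel_pair.integral_fst' [OF int] by simp
  also have "\<dots> = u * v" by (simp add: ui)
  finally show ?thesis using int by (simp add: lborel_prod has_bochner_integral_iff)
qed

lemma has_integral_rect_sum:
  assumes "i < 2" "j < 2" "i' < 2" "j' < 2"
  shows "has_bochner_integral lborel
      (\<lambda>z. indicator square z * (rect_sum i' j' a M N z * (trig i (real m * fst z) * trig j (real n * snd z))))
      (if i = i' \<and> j = j' \<and> m \<in> {1..M} \<and> n \<in> {1..N} then pi\<^sup>2 * a m n else 0)"
proof -
  define T where "T i' m' i m t = trig i' (real m' * t) * trig i (real m * t) * indicator {-pi..pi} t" for i' m' i m t
  have eq: "indicator square z * (rect_sum i' j' a M N z * (trig i (real m * fst z) * trig j (real n * snd z)))
      = (\<Sum>m'=1..M. \<Sum>n'=1..N. a m' n' * (T i' m' i m (fst z) * T j' n' j n (snd z)))" for z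
  proof -
    have "indicator square z = indicator {-pi..pi} (fst z) * (indicator {-pi..pi} (snd z) :: real)"
      by (cases z) (auto simp: square_def indicator_def)
    then show ?thesis
      by (simp add: rect_sum_def T_def sum_distrib_left sum_distrib_right mult_ac)
  qed
  have "has_bochner_integral lborel (\<lambda>z. \<Sum>m'=1..M. \<Sum>n'=1..N. a m' n' * (T i' m' i m (fst z) * T j' n' j n (snd z)))
      (\<Sum>m'=1..M. \<Sum>n'=1..N. a m' n' * ((if i' = i \<and> m' = m then pi else 0) * (if j' = j \<and> n' = n then pi else 0)))"
    unfolding T_def using assms
    by (intro has_bochner_integral_sum has_bochner_integral_mult_right has_integral_lborel_mult trig_orthogonality) auto
  also have "(\<Sum>m'=1..M. \<Sum>n'=1..N. a m' n' * ((if i' = i \<and> m' = m then pi else 0) * (if j' = j \<and> n' = n then pi else 0)))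
      = (\<Sum>m'=1..M. if m' = m then (\<Sum>n'=1..N. if n' = n then (if i' = i \<and> j' = j then pi\<^sup>2 * a m n else 0) else 0) else 0)"
  proof (intro sum.cong refl)
    fix m'
    have "a m' n' * ((if i' = i \<and> m' = m then pi else 0) * (if j' = j \<and> n' = n then pi else 0))
        = (if m' = m then if n' = n then if i' = i \<and> j' = j then pi\<^sup>2 * a m n else 0 else 0 else 0)" for n'
      by (auto simp: power2_eq_square)
    then show "(\<Sum>n'=1..N. a m' n' * ((if i' = i \<and> m' = m then pi else 0) * (if j' = j \<and> n' = n then pi else 0)))
        = (if m' = m then (\<Sum>n'=1..N. if n' = n then (if i' = i \<and> j' = j then pi\<^sup>2 * a m n else 0) else 0) else 0)"
      by simp
  qed
  also have "\<dots> = (if i = i' \<and> j = j' \<and> m \<in> {1..M} \<and> n \<in> {1..N} then pi\<^sup>2 * a m n else 0)"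
    by (auto simp: sum.delta)
  finally show ?thesis by (simp add: eq)
qed

text \<open>By orthogonality the integrals of the partial sums against a trigonometric product are
  eventually constant; dominated convergence identifies the constant with the integral of the limit.
  Testing with the constant one gives integrability of \<open>f\<close>.\<close>

lemma has_fourier_seriesI:
  assumes [measurable]: "f \<in> borel_measurable borel"
    and w: "integrable lborel (\<lambda>z. indicator square z * w z)"
    and lim: "AE z in lborel. z \<in> square \<longrightarrow> (\<lambda>N. partial_sum a N N (fst z) (snd z)) \<longlonglongrightarrow> f z"
    and bound: "AE z in lborel. z \<in> square \<longrightarrow> (\<forall>N. \<bar>partial_sum a N N (fst z) (snd z)\<bar> \<le> w z)"
  shows "has_fourier_series f a"
proof -
  define S where "S N z = (\<Sum>i<2. \<Sum>j<2. rect_sum i j (a i j) N N z)" for N z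
  have S: "S N z = partial_sum a N N (fst z) (snd z)" for N z
    by (simp add: S_def partial_sum_eq)
  have [measurable]: "S N \<in> borel_measurable borel" for N
    unfolding S_def [abs_def] by measurable
  have conv: "(\<lambda>N. \<integral>z. indicator square z * (S N z * k z) \<partial>lborel) \<longlonglongrightarrow> (\<integral>z. indicator square z * (f z * k z) \<partial>lborel)
      \<and> integrable lborel (\<lambda>z. indicator square z * (f z * k z))"
    if [measurable]: "k \<in> borel_measurable borel" and k: "\<And>z. \<bar>k z\<bar> \<le> 1" for k
  proof -
    have 1: "AE z in lborel. (\<lambda>N. indicator square z * (S N z * k z)) \<longlonglongrightarrow> indicator square z * (f z * k z)"
      using lim
    proof eventually_elim
      case (elim z)
      then show ?case unfolding S by (cases "z \<in> square") (auto intro!: tendsto_intros)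
    qed
    have 2: "AE z in lborel. norm (indicator square z * (S N z * k z)) \<le> indicator square z * w z" for N
      using bound
    proof eventually_elim
      case (elim z)
      show ?case
      proof (cases "z \<in> square")
        case True
        with elim have "\<bar>S N z\<bar> \<le> w z" by (simp add: S)
        then have "\<bar>S N z\<bar> * \<bar>k z\<bar> \<le> w z * 1" by (intro mult_mono k) auto
        with True show ?thesis by (simp add: abs_mult)
      qed simp
    qed
    show ?thesis
    proof
      show "(\<lambda>N. \<integral>z. indicator square z * (S N z * k z) \<partial>lborel) \<longlonglongrightarrow> (\<integral>z. indicator square z * (f z * k z) \<partial>lborel)"
        by (rule integral_dominated_convergence [OF _ _ w 1 2]) measurable
      show "integrable lborel (\<lambda>z. indicator square z * (f z * k z))"
        by (rule integrable_dominated_convergence [OF _ _ w 1 2]) measurable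
    qed
  qed
  have "set_integrable lborel square f"
    using conv [of "\<lambda>_. 1"] by (simp add: set_integrable_def)
  moreover have "fourier_coeff f i j m n = (if 1 \<le> m \<and> 1 \<le> n then a i j m n else 0)"
    if ij: "i < 2" "j < 2" for i j m n
  proof -
    define k where "k z = trig i (real m * fst z) * trig j (real n * snd z)" for z
    have [measurable]: "k \<in> borel_measurable borel" unfolding k_def [abs_def] by measurable
    have k1: "\<bar>k z\<bar> \<le> 1" for z by (simp add: k_def abs_mult mult_le_one trig_le_1)
    let ?v = "\<lambda>N. \<Sum>i'<2. \<Sum>j'<2. if i = i' \<and> j = j' \<and> m \<in> {1..N} \<and> n \<in> {1..N} then pi\<^sup>2 * a i' j' m n else 0"
    have "has_bochner_integral lborel (\<lambda>z. \<Sum>i'<2. \<Sum>j'<2. indicator square z * (rect_sum i' j' (a i' j') N N z * k z)) (?v N)" for N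
      unfolding k_def using ij by (intro has_bochner_integral_sum has_integral_rect_sum) auto
    then have iS: "(\<integral>z. indicator square z * (S N z * k z) \<partial>lborel) = ?v N" for N
      by (simp add: S_def sum_distrib_left sum_distrib_right has_bochner_integral_iff)
    have "\<forall>\<^sub>F N in sequentially. ?v N = (if 1 \<le> m \<and> 1 \<le> n then pi\<^sup>2 * a i j m n else 0)"
      using eventually_ge_at_top [of "max m n"]
    proof eventually_elim
      case (elim N)
      have "?v N = (\<Sum>i'<2. if i' = i then (\<Sum>j'<2. if j' = j then (if m \<in> {1..N} \<and> n \<in> {1..N} then pi\<^sup>2 * a i j m n else 0) else 0) else 0)"
        by (intro sum.cong refl) (auto intro!: sum.cong sum.neutral)
      also have "\<dots> = (if m \<in> {1..N} \<and> n \<in> {1..N} then pi\<^sup>2 * a i j m n else 0)"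
        using ij by (simp add: sum.delta)
      finally show ?case using elim by auto
    qed
    then have "(\<lambda>N. \<integral>z. indicator square z * (S N z * k z) \<partial>lborel) \<longlonglongrightarrow> (if 1 \<le> m \<and> 1 \<le> n then pi\<^sup>2 * a i j m n else 0)"
      unfolding iS by (rule tendsto_eventually)
    moreover have "(\<lambda>N. \<integral>z. indicator square z * (S N z * k z) \<partial>lborel) \<longlonglongrightarrow> (\<integral>z. indicator square z * (f z * k z) \<partial>lborel)"
      using conv [of k] k1 by simp
    ultimately have "(\<integral>z. indicator square z * (f z * k z) \<partial>lborel) = (if 1 \<le> m \<and> 1 \<le> n then pi\<^sup>2 * a i j m n else 0)"
      by (intro LIMSEQ_unique)
    then show ?thesis
      by (simp add: fourier_coeff_def set_lebesgue_integral_def k_def mult.assoc)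
  qed
  ultimately show ?thesis by (simp add: has_fourier_series_def)
qed

text \<open>On the square \<open>pi / |t| \<ge> 1\<close> off the axes, so
  \<open>dker2 (0, 0)\<close> is one there and the kernel integral bound at level zero
  applies.\<close>

lemma integrable_square_powr:
  fixes g :: real
  assumes "0 < g" "g < 1"
  shows "integrable lborel (\<lambda>z. indicator square z * (c * absprod z powr - g))"
proof -
  obtain A where A: "0 < A"
    "\<And>x. pint (\<lambda>z. dker2 x z * absprod z powr - g) \<le> ennreal (A * dscale x powr (g - 1))"
    using dker2_integral_bound [OF assms] by blast
  have "integrable lborel (\<lambda>z. indicator square z * absprod z powr - g)"
  proof (rule integrableI_bounded)
    have "pint (\<lambda>z. norm (indicator square z * absprod z powr - g))
        \<le> pint (\<lambda>z. dker2 (0, 0) z * absprod z powr - g)"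
    proof (rule nn_integral_mono_AE)
      show "AE z in lborel. ennreal (norm (indicator square z * absprod z powr - g))
          \<le> ennreal (dker2 (0, 0) z * absprod z powr - g)"
        using AE_coordinates_nonzero
      proof eventually_elim
        case (elim z)
        have "dker2 (0, 0) z = 1" if "z \<in> square"
        proof -
          from that have "\<bar>fst z\<bar> \<le> pi" "\<bar>snd z\<bar> \<le> pi" by (auto simp: square_def)
          then show ?thesis using elim by (simp add: dker2_def dker_def min_absorb1)
        qed
        then show ?case by (cases "z \<in> square") auto
      qed
    qed
    also have "\<dots> \<le> ennreal (A * dscale (0, 0) powr (g - 1))" by (rule A)
    also have "\<dots> < \<infinity>" by simp
    finally show "pint (\<lambda>z. norm (indicator square z * absprod z powr - g)) < \<infinity>" .
  qed measurable
  then have "integrable lborel (\<lambda>z. c * (indicator square z * absprod z powr - g))"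
    by (rule integrable_mult_right)
  then show ?thesis by (simp add: mult.left_commute)
qed

lemma (in gm_sequence) dvar_le_wcoeff:
  assumes "0 < \<sigma>"
  shows "dscale x powr \<sigma> * dvar a x \<le> C * wcoeff \<sigma> a (fst x + e, snd x)"
proof -
  have "dvar a x \<le> C * alpha a (fst x + e) (snd x)"
    unfolding dvar_def by (rule Delta11_block)
  moreover have "dscale x powr \<sigma> \<le> dscale (fst x + e, snd x) powr \<sigma>"
    using assms by (intro powr_mono2) (auto simp: dscale_def intro!: mult_right_mono)
  ultimately have "dscale x powr \<sigma> * dvar a x \<le> dscale (fst x + e, snd x) powr \<sigma> * (C * alpha a (fst x + e) (snd x))"
    by (intro mult_mono) auto
  then show ?thesis by (simp add: wcoeff_def mult_ac)
qed

text \<open>Schur test in the opposite direction, from block indices to the plane, with the two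
  kernel estimates exchanged: rows use the kernel sum with exponent \<open>1 / p\<close>, columns
  the kernel integral with exponent \<open>1 - 1 / p\<close>.\<close>

lemma rect_limit_norm_le:
  fixes p q :: real
  assumes p: "1 < p" and q: "1 \<le> q" and C: "1 \<le> C"
  obtains c where "0 < c"
    "\<And>a e i j. gm_sequence a C e \<Longrightarrow> Delta_summable a \<Longrightarrow>
      pint (\<lambda>z. indicator square z * absprod z powr (q / p - 1) * (indicator square z * \<bar>rect_limit i j a z\<bar>) powr q)
      \<le> ennreal c * coeff_powr_sum (1 - 1 / p) q a"
proof -
  define \<sigma> where "\<sigma> = 1 - 1 / p"
  have p1: "0 < 1 / p" "1 / p < 1" and s: "0 < \<sigma>" "\<sigma> < 1" using p by (auto simp: \<sigma>_def)
  obtain A where A: "0 < A"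
    "\<And>z. fst z \<noteq> 0 \<Longrightarrow> snd z \<noteq> 0 \<Longrightarrow>
       psum (\<lambda>x. dker2 x z * dscale x powr (1 / p)) \<le> ennreal (A * absprod z powr - (1 / p))"
    using dker2_sum_bound [OF p1] by blast
  obtain B where B: "0 < B"
    "\<And>x. pint (\<lambda>z. dker2 x z * absprod z powr - \<sigma>) \<le> ennreal (B * dscale x powr (\<sigma> - 1))"
    using dker2_integral_bound [OF s] by blast
  define c1 where "c1 = A powr (q - 1) * B"
  define c2 where "c2 = 4 * 4 powr (q * \<sigma>) * 8 powr \<bar>q * \<sigma> - 1\<bar> * (1 + 2 * C) powr q"
  define c where "c = c1 * ((4 * C) powr q * c2)"
  have cpos: "0 < c1" "0 < c2" "0 < c" using A B C by (auto simp: c1_def c2_def c_def)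
  have "pint (\<lambda>z. indicator square z * absprod z powr (q / p - 1) * (indicator square z * \<bar>rect_limit i j a z\<bar>) powr q)
      \<le> ennreal c * coeff_powr_sum \<sigma> q a"
    if "gm_sequence a C e" and int: "Delta_summable a" for a e i j
  proof -
    interpret gm_sequence a C e by fact
    define w where "w z = indicator square z * absprod z powr (q / p - 1)" for z
    define h where "h z = absprod z powr - (1 / p)" for z :: "real \<times> real"
    define F where "F x = 4 * dscale x * dvar a x" for x
    define v where "v x = dscale x powr - (1 / p)" for x
    have [measurable]: "w \<in> borel_measurable borel" "h \<in> borel_measurable borel"
      unfolding w_def [abs_def] h_def [abs_def] by measurable
    have "pint (\<lambda>z. w z * (indicator square z * \<bar>rect_limit i j a z\<bar>) powr q)
       \<le> ennreal (A powr (q - 1) * B) * psum (\<lambda>x. F x powr q * v x powr (q - 1) * dscale x powr (\<sigma> - 1))"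
    proof (rule schur_test [where K = "\<lambda>z x. dker2 x z" and h = h])
      show "sigma_finite_measure (count_space (UNIV :: (nat \<times> nat) set))"
        by (intro sigma_finite_measure_count_space_countable) auto
      show "sigma_finite_measure (lborel :: (real \<times> real) measure)"
        by (rule lborel.sigma_finite_measure_axioms)
      have "(\<lambda>y. dker2 (snd y) (fst y)) \<in> borel_measurable ((lborel :: (real \<times> real) measure) \<Otimes>\<^sub>M count_space UNIV)"
        by (rule measurable_compose_countable' [where f = "\<lambda>x y. dker2 x (fst y)" and g = snd and I = UNIV]) auto
      then show "(\<lambda>(z, x). dker2 x z) \<in> borel_measurable (lborel \<Otimes>\<^sub>M count_space UNIV)"
        by (simp add: case_prod_beta)
      show "AE z in lborel. ennreal (indicator square z * \<bar>rect_limit i j a z\<bar>) \<le> psum (\<lambda>x. dker2 x z * F x)"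
        using AE_coordinates_nonzero
      proof eventually_elim
        case (elim z)
        show ?case
        proof (cases "z \<in> square")
          case True
          then have "\<bar>fst z\<bar> \<le> pi" "\<bar>snd z\<bar> \<le> pi" by (auto simp: square_def)
          then show ?thesis unfolding F_def using elim True rect_limit_le [OF tz int, of z] by simp
        qed simp
      qed
      show "AE z in lborel. psum (\<lambda>x. dker2 x z / v x) \<le> ennreal (A * h z)"
        using AE_coordinates_nonzero
      proof eventually_elim
        case (elim z)
        then show ?case using A(2) [of z] by (simp add: v_def h_def powr_minus divide_inverse)
      qed
      show "AE x in count_space UNIV. pint (\<lambda>z. dker2 x z * (w z * h z powr (q - 1))) \<le> ennreal (B * dscale x powr (\<sigma> - 1))"
      proof (intro AE_I2)
        fix x
        have "dker2 x z * (w z * h z powr (q - 1)) \<le> dker2 x z * absprod z powr - \<sigma>" for z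
        proof (intro mult_left_mono)
          have "w z * h z powr (q - 1) \<le> absprod z powr (q / p - 1) * h z powr (q - 1)"
            unfolding w_def by (intro mult_right_mono) (auto simp: indicator_def)
          also have "\<dots> = absprod z powr (q / p - 1 + - (1 / p) * (q - 1))"
            by (simp add: h_def powr_powr powr_add [symmetric])
          also have "q / p - 1 + - (1 / p) * (q - 1) = - \<sigma>"
            by (simp add: \<sigma>_def diff_divide_distrib)
          finally show "w z * h z powr (q - 1) \<le> absprod z powr - \<sigma>" .
        qed simp
        then have "pint (\<lambda>z. dker2 x z * (w z * h z powr (q - 1)))
            \<le> pint (\<lambda>z. dker2 x z * absprod z powr - \<sigma>)"
          by (intro nn_integral_mono ennreal_leI)
        also have "\<dots> \<le> ennreal (B * dscale x powr (\<sigma> - 1))" by (rule B)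
        finally show "pint (\<lambda>z. dker2 x z * (w z * h z powr (q - 1))) \<le> ennreal (B * dscale x powr (\<sigma> - 1))" .
      qed
    qed (use q A B in \<open>auto simp: w_def h_def v_def F_def less_imp_le\<close>)
    also have "psum (\<lambda>x. F x powr q * v x powr (q - 1) * dscale x powr (\<sigma> - 1))
        \<le> (\<integral>\<^sup>+x. ennreal ((4 * C) powr q) * ennreal (wcoeff \<sigma> a (fst x + e, snd x) powr q) \<partial>count_space UNIV)"
    proof (rule nn_integral_mono)
      fix x
      \<comment> \<open>The exponents of \<open>dscale\<close> collected from \<open>F\<close>,
        \<open>v\<close> and the column weight; they add up to the exponent in
        \<open>wcoeff powr q\<close>.\<close>
      have ex: "q + (- (1 / p) * (q - 1) + (\<sigma> - 1)) = \<sigma> * q"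
        by (simp add: \<sigma>_def algebra_simps diff_divide_distrib)
      have "F x powr q * v x powr (q - 1) * dscale x powr (\<sigma> - 1)
          = 4 powr q * dvar a x powr q * (dscale x powr q * (dscale x powr (- (1 / p) * (q - 1)) * dscale x powr (\<sigma> - 1)))"
        by (simp add: F_def v_def powr_mult powr_powr less_imp_le mult_ac)
      also have "dscale x powr q * (dscale x powr (- (1 / p) * (q - 1)) * dscale x powr (\<sigma> - 1)) = dscale x powr (\<sigma> * q)"
        by (simp only: powr_add [symmetric] ex)
      also have "4 powr q * dvar a x powr q * dscale x powr (\<sigma> * q) = (4 * (dscale x powr \<sigma> * dvar a x)) powr q"
        by (simp add: powr_mult powr_powr mult_ac)
      also have "\<dots> \<le> (4 * (C * wcoeff \<sigma> a (fst x + e, snd x))) powr q"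
        using q s by (intro powr_mono2 mult_left_mono dvar_le_wcoeff) auto
      also have "\<dots> = (4 * C) powr q * wcoeff \<sigma> a (fst x + e, snd x) powr q"
        using C by (simp add: powr_mult)
      finally show "ennreal (F x powr q * v x powr (q - 1) * dscale x powr (\<sigma> - 1))
          \<le> ennreal ((4 * C) powr q) * ennreal (wcoeff \<sigma> a (fst x + e, snd x) powr q)"
        by (simp add: ennreal_mult [symmetric] ennreal_leI)
    qed
    also have "\<dots> = ennreal ((4 * C) powr q) * psum (\<lambda>x. wcoeff \<sigma> a (fst x + e, snd x) powr q)"
      by (rule nn_integral_cmult) simp
    also have "psum (\<lambda>x. wcoeff \<sigma> a (fst x + e, snd x) powr q)
        \<le> psum (\<lambda>x. wcoeff \<sigma> a x powr q)"
      unfolding nn_integral_nat_pair fst_conv snd_conv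
      by (rule suminf_inj_le [of "\<lambda>I. I + e" "\<lambda>I. \<Sum>J. ennreal (wcoeff \<sigma> a (I, J) powr q)"]) simp
    also have "\<dots> \<le> ennreal c2 * coeff_powr_sum \<sigma> q a"
      unfolding c2_def using q s by (intro wcoeff_powr_sum_le)
    finally have "pint (\<lambda>z. w z * (indicator square z * \<bar>rect_limit i j a z\<bar>) powr q)
        \<le> ennreal c1 * (ennreal ((4 * C) powr q) * (ennreal c2 * coeff_powr_sum \<sigma> q a))"
      by (simp add: c1_def mult_left_mono)
    also have "\<dots> = ennreal c * coeff_powr_sum \<sigma> q a"
      using cpos by (simp add: c_def ennreal_mult mult.assoc)
    finally show ?thesis by (simp add: w_def)
  qed
  with cpos(3) show thesis unfolding \<sigma>_def by (rule that)
qed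

section \<open>Upper bound for the weighted norm\<close>

lemma powr_sum_le:
  fixes y :: "'a \<Rightarrow> real"
  assumes S: "finite S" and y: "\<And>s. s \<in> S \<Longrightarrow> 0 \<le> y s" and q: "0 \<le> q"
  shows "(\<Sum>s\<in>S. y s) powr q \<le> real (card S) powr q * (\<Sum>s\<in>S. y s powr q)"
proof (cases "S = {}")
  case False
  define M where "M = Max (y ` S)"
  have "M \<in> y ` S" unfolding M_def using S False by (intro Max_in) auto
  then obtain s0 where s0: "s0 \<in> S" "M = y s0" by auto
  have "y s \<le> M" if "s \<in> S" for s
    unfolding M_def using S that by (intro Max_ge) auto
  then have "(\<Sum>s\<in>S. y s) \<le> real (card S) * M"
    using sum_bounded_above [of S y M] by simp
  then have "(\<Sum>s\<in>S. y s) powr q \<le> (real (card S) * M) powr q"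
    using y q by (intro powr_mono2 sum_nonneg) auto
  also have "\<dots> = real (card S) powr q * y s0 powr q"
    using y s0 by (simp add: powr_mult)
  also have "y s0 powr q \<le> (\<Sum>s\<in>S. y s powr q)"
    using S s0 by (intro member_le_sum) auto
  finally show ?thesis by (simp add: mult_left_mono)
qed simp

lemma sin_half_nonzero_iff:
  assumes "\<forall>k::int. x \<noteq> 2 * pi * real_of_int k"
  shows "sin (x / 2) \<noteq> 0"
proof
  assume "sin (x / 2) = 0"
  then obtain k :: int where "x / 2 = of_int k * pi" by (auto simp: sin_zero_iff_int2)
  then have "x = 2 * pi * real_of_int k" by simp
  with assms show False by blast
qed

definition series_limit :: "(nat \<Rightarrow> nat \<Rightarrow> nat \<Rightarrow> nat \<Rightarrow> real) \<Rightarrow> real \<times> real \<Rightarrow> real" where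
  "series_limit a z = (\<Sum>i<2. \<Sum>j<2. rect_limit i j (a i j) z)"

lemma borel_measurable_series_limit [measurable]: "series_limit a \<in> borel_measurable borel"
  unfolding series_limit_def [abs_def] by measurable

lemma partial_sum_tendsto:
  assumes "\<And>i j. i < 2 \<Longrightarrow> j < 2 \<Longrightarrow> tends_to_zero2 (a i j)"
    and "\<And>i j. i < 2 \<Longrightarrow> j < 2 \<Longrightarrow> Delta_summable (a i j)"
    and "sin (x / 2) \<noteq> 0" "sin (y / 2) \<noteq> 0"
  shows "((\<lambda>(M, N). partial_sum a M N x y) \<longlongrightarrow> series_limit a (x, y)) (sequentially \<times>\<^sub>F sequentially)"
proof -
  have "((\<lambda>u. \<Sum>i<2. \<Sum>j<2. case u of (M, N) \<Rightarrow> rect_sum i j (a i j) M N (x, y)) \<longlongrightarrow> series_limit a (x, y)) (sequentially \<times>\<^sub>F sequentially)"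
    unfolding series_limit_def using assms by (intro tendsto_sum rect_sum_tendsto) auto
  then show ?thesis by (simp add: partial_sum_eq case_prod_beta')
qed

text \<open>Limit and majorant are available off the axes, which is enough for integration. The
  bounds \<open>B\<close> may depend on the sequence, since only integrability is at stake
  here.\<close>

lemma has_fourier_series_series_limit:
  assumes p: "1 < p"
    and tz: "\<And>i j. i < 2 \<Longrightarrow> j < 2 \<Longrightarrow> tends_to_zero2 (a i j)"
    and int: "\<And>i j. i < 2 \<Longrightarrow> j < 2 \<Longrightarrow> Delta_summable (a i j)"
    and B: "\<And>i j x. i < 2 \<Longrightarrow> j < 2 \<Longrightarrow> dscale x powr (1 - 1 / p) * dvar (a i j) x \<le> B i j"
  shows "has_fourier_series (series_limit a) a"
proof -
  have p1: "0 < 1 / p" "1 / p < 1" "0 < 1 - 1 / p" "1 - 1 / p < 1" using p by auto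
  obtain c where c: "0 < c"
    "\<And>a B z. (\<And>x. dscale x powr (1 - 1 / p) * dvar a x \<le> B) \<Longrightarrow> fst z \<noteq> 0 \<Longrightarrow> snd z \<noteq> 0 \<Longrightarrow>
      psum (\<lambda>x. dker2 x z * (4 * dscale x * dvar a x))
      \<le> ennreal (c * B * absprod z powr - (1 - (1 - 1 / p)))"
    using kernel_sum_le [OF p1(3,4)] by blast
  define D where "D = (\<Sum>i<2::nat. \<Sum>j<2::nat. c * B i j)"
  have B0: "0 \<le> B i j" if "i < 2" "j < 2" for i j
  proof -
    have "0 \<le> dscale (0, 0) powr (1 - 1 / p) * dvar (a i j) (0, 0)" by simp
    with B [OF that, of "(0, 0)"] show ?thesis by linarith
  qed
  show ?thesis
  proof (rule has_fourier_seriesI [where w = "\<lambda>z. D * absprod z powr - (1 / p)"])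
    show "integrable lborel (\<lambda>z. indicator square z * (D * absprod z powr - (1 / p)))"
      by (rule integrable_square_powr [OF p1(1,2)])
    show "AE z in lborel. z \<in> square \<longrightarrow> (\<lambda>N. partial_sum a N N (fst z) (snd z)) \<longlonglongrightarrow> series_limit a z"
      using AE_coordinates_nonzero
    proof eventually_elim
      case (elim z)
      show ?case
      proof
        assume "z \<in> square"
        then have "\<bar>fst z\<bar> \<le> pi" "\<bar>snd z\<bar> \<le> pi" by (auto simp: square_def)
        then show "(\<lambda>N. partial_sum a N N (fst z) (snd z)) \<longlonglongrightarrow> series_limit a z"
          unfolding partial_sum_eq series_limit_def prod.collapse using elim tz int
          by (intro tendsto_sum rect_sum_diag_tendsto sin_half_nonzero) auto
      qed
    qed
    show "AE z in lborel. z \<in> square \<longrightarrow> (\<forall>N. \<bar>partial_sum a N N (fst z) (snd z)\<bar> \<le> D * absprod z powr - (1 / p))"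
      using AE_coordinates_nonzero
    proof eventually_elim
      case (elim z)
      show ?case
      proof (intro impI allI)
        fix N assume "z \<in> square"
        then have z: "\<bar>fst z\<bar> \<le> pi" "\<bar>snd z\<bar> \<le> pi" by (auto simp: square_def)
        have le: "\<bar>rect_sum i j (a i j) N N z\<bar> \<le> c * B i j * absprod z powr - (1 / p)" if ij: "i < 2" "j < 2" for i j
        proof -
          have "ennreal \<bar>rect_sum i j (a i j) N N z\<bar> \<le> psum (\<lambda>x. dker2 x z * (4 * dscale x * dvar (a i j) x))"
            using elim z ij by (intro rect_sum_le tz int) auto
          also have "\<dots> \<le> ennreal (c * B i j * absprod z powr - (1 - (1 - 1 / p)))"
            using elim ij by (intro c B) auto
          finally show ?thesis using c B0 [OF ij] by simp
        qed
        have "\<bar>partial_sum a N N (fst z) (snd z)\<bar> \<le> (\<Sum>i<2. \<Sum>j<2. \<bar>rect_sum i j (a i j) N N z\<bar>)"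
          unfolding partial_sum_eq prod.collapse by (intro order_trans [OF sum_abs] sum_mono sum_abs)
        also have "\<dots> \<le> (\<Sum>i<2. \<Sum>j<2. c * B i j * absprod z powr - (1 / p))"
          by (intro sum_mono le) auto
        also have "\<dots> = D * absprod z powr - (1 / p)"
          by (simp add: D_def sum_distrib_right)
        finally show "\<bar>partial_sum a N N (fst z) (snd z)\<bar> \<le> D * absprod z powr - (1 / p)" .
      qed
    qed
  qed measurable
qed

text \<open>A finite sum of \<open>q\<close>-th powers bounds each of its terms. This turns the
  finite coefficient norm into the block bound required for absolute summability and for the
  majorant.\<close>

lemma (in gm_sequence) dvar_bounded_of_coeff_sum:
  assumes q: "1 \<le> q" and s: "0 < \<sigma>" and fin: "coeff_powr_sum \<sigma> q a < \<infinity>"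
  obtains B where "\<And>x. dscale x powr \<sigma> * dvar a x \<le> B"
proof -
  let ?I = "psum (\<lambda>x. wcoeff \<sigma> a x powr q)"
  have "?I < \<infinity>"
    by (rule le_less_trans [OF wcoeff_powr_sum_le [OF q s]])
      (use fin in \<open>auto simp: ennreal_mult_less_top\<close>)
  then obtain R where R: "?I = ennreal R" "0 \<le> R" by (cases ?I) auto
  have "wcoeff \<sigma> a x \<le> R powr (1 / q)" for x
  proof -
    have "ennreal (wcoeff \<sigma> a x powr q) \<le> ennreal R"
      using finite_sum_le_nn_integral_count_space [of "{x}" "\<lambda>x. ennreal (wcoeff \<sigma> a x powr q)"] R by simp
    then have "wcoeff \<sigma> a x powr q \<le> R" using R by simp
    then have "(wcoeff \<sigma> a x powr q) powr (1 / q) \<le> R powr (1 / q)"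
      using q by (intro powr_mono2) auto
    then show ?thesis using q by (simp add: powr_powr)
  qed
  then have "C * wcoeff \<sigma> a (fst x + e, snd x) \<le> C * R powr (1 / q)" for x
    using C by (intro mult_left_mono) auto
  then show thesis
    using dvar_le_wcoeff [OF s] by (intro that) (rule order_trans)
qed

lemma wnorm_pow_series_limit_le:
  fixes p q :: real
  assumes p: "1 < p" and q: "1 \<le> q" and C: "1 \<le> C"
  obtains c where "0 < c"
    "\<And>a. (\<forall>i<2. \<forall>j<2. \<exists>e. gm_sequence (a i j) C e) \<Longrightarrow>
      (\<forall>i<2. \<forall>j<2. Delta_summable (a i j)) \<Longrightarrow>
      wnorm_pow p (ereal q) (series_limit a) \<le> ereal c * coeff_sum p (ereal q) a"
proof -
  obtain c where c: "0 < c"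
    "\<And>a e i j. gm_sequence a C e \<Longrightarrow> Delta_summable a \<Longrightarrow>
      pint (\<lambda>z. indicator square z * absprod z powr (q / p - 1) * (indicator square z * \<bar>rect_limit i j a z\<bar>) powr q)
      \<le> ennreal c * coeff_powr_sum (1 - 1 / p) q a"
    using rect_limit_norm_le [OF p q C] by blast
  have "wnorm_pow p (ereal q) (series_limit a) \<le> ereal (4 powr q * c) * coeff_sum p (ereal q) a"
    if gm: "\<forall>i<2. \<forall>j<2. \<exists>e. gm_sequence (a i j) C e"
      and int: "\<forall>i<2. \<forall>j<2. Delta_summable (a i j)" for a
  proof -
    define W where "W z = indicator square z * absprod z powr (q / p - 1)" for z
    define G where "G i j z = indicator square z * \<bar>rect_limit i j (a i j) z\<bar>" for i j z
    have [measurable]: "W \<in> borel_measurable borel" "G i j \<in> borel_measurable borel" for i j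
      unfolding W_def [abs_def] G_def [abs_def] by measurable
    have W0: "0 \<le> W z" for z by (simp add: W_def)
    have pw: "ennreal (absprod z powr (q / p - 1) * \<bar>series_limit a z\<bar> powr q) * indicator square z
        \<le> (\<Sum>i<2. \<Sum>j<2. ennreal (4 powr q) * ennreal (W z * G i j z powr q))" for z
    proof (cases "z \<in> square")
      case True
      have "\<bar>series_limit a z\<bar> \<le> (\<Sum>i<2. \<Sum>j<2. \<bar>rect_limit i j (a i j) z\<bar>)"
        unfolding series_limit_def by (intro order_trans [OF sum_abs] sum_mono sum_abs)
      also have "\<dots> = (\<Sum>s\<in>{..<2::nat}\<times>{..<2::nat}. G (fst s) (snd s) z)"
        using True by (simp add: sum.cartesian_product G_def case_prod_beta)
      finally have "\<bar>series_limit a z\<bar> powr q \<le> (\<Sum>s\<in>{..<2::nat}\<times>{..<2::nat}. G (fst s) (snd s) z) powr q"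
        using q by (intro powr_mono2) auto
      also have "\<dots> \<le> real (card ({..<2::nat}\<times>{..<2::nat})) powr q * (\<Sum>s\<in>{..<2::nat}\<times>{..<2::nat}. G (fst s) (snd s) z powr q)"
        using q by (intro powr_sum_le) (auto simp: G_def)
      finally have "\<bar>series_limit a z\<bar> powr q \<le> 4 powr q * (\<Sum>i<2. \<Sum>j<2. G i j z powr q)"
        by (simp add: sum.cartesian_product case_prod_beta)
      then have "W z * \<bar>series_limit a z\<bar> powr q \<le> W z * (4 powr q * (\<Sum>i<2. \<Sum>j<2. G i j z powr q))"
        by (intro mult_left_mono W0)
      also have "\<dots> = (\<Sum>i<2. \<Sum>j<2. 4 powr q * (W z * G i j z powr q))"
        by (simp add: sum_distrib_left mult_ac)
      finally have "ennreal (W z * \<bar>series_limit a z\<bar> powr q) \<le> (\<Sum>i<2. \<Sum>j<2. ennreal (4 powr q) * ennreal (W z * G i j z powr q))"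
        using W0 by (simp add: ennreal_mult [symmetric] sum_ennreal sum_nonneg ennreal_leI)
      then show ?thesis using True by (simp add: W_def)
    qed simp
    have "(\<integral>\<^sup>+z. ennreal (absprod z powr (q / p - 1) * \<bar>series_limit a z\<bar> powr q) * indicator square z \<partial>lborel)
        \<le> (\<integral>\<^sup>+z. (\<Sum>i<2. \<Sum>j<2. ennreal (4 powr q) * ennreal (W z * G i j z powr q)) \<partial>lborel)"
      by (intro nn_integral_mono pw)
    also have "\<dots> = (\<Sum>i<2. \<Sum>j<2. ennreal (4 powr q) * pint (\<lambda>z. W z * G i j z powr q))"
      by (simp add: nn_integral_sum nn_integral_cmult)
    also have "\<dots> \<le> (\<Sum>i<2. \<Sum>j<2. ennreal (4 powr q) * (ennreal c * coeff_powr_sum (1 - 1 / p) q (a i j)))"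
    proof (intro sum_mono mult_left_mono)
      fix i j :: nat assume "i \<in> {..<2}" "j \<in> {..<2}"
      then have ij: "i < 2" "j < 2" by auto
      then obtain e where "gm_sequence (a i j) C e" using gm by blast
      from c(2) [OF this] int ij show "pint (\<lambda>z. W z * G i j z powr q) \<le> ennreal c * coeff_powr_sum (1 - 1 / p) q (a i j)"
        by (simp add: W_def G_def)
    qed auto
    also have "\<dots> = ennreal (4 powr q * c) * (\<Sum>i<2. \<Sum>j<2. coeff_powr_sum (1 - 1 / p) q (a i j))"
      using c by (simp add: ennreal_mult sum_distrib_left mult.assoc)
    finally have "enn2ereal (\<integral>\<^sup>+z. ennreal (absprod z powr (q / p - 1) * \<bar>series_limit a z\<bar> powr q) * indicator square z \<partial>lborel)
        \<le> enn2ereal (ennreal (4 powr q * c) * (\<Sum>i<2. \<Sum>j<2. coeff_powr_sum (1 - 1 / p) q (a i j)))"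
      by (simp only: less_eq_ennreal.rep_eq)
    then show ?thesis
      using c by (simp add: wnorm_pow_def coeff_sum_finite_exponent [OF p] times_ennreal.rep_eq enn2ereal_ennreal)
  qed
  moreover have "0 < 4 powr q * c" using c by simp
  ultimately show thesis by (rule that [rotated])
qed

text \<open>For finite \<open>q\<close> the block bounds are used only qualitatively and the
  constant comes from the Schur test. For \<open>q = \<infinity>\<close> the block bounds carry an
  explicit constant, and the pointwise kernel estimate is already the norm estimate.\<close>

theorem series_upper_bound:
  fixes p :: real and q :: ereal
  assumes p: "1 < p" and q: "1 \<le> q"
  obtains c where "0 < c"
    "\<And>a. GM_family C a \<Longrightarrow> coeff_sum p q a < \<infinity> \<Longrightarrow>
       (\<forall>i<2. \<forall>j<2. tends_to_zero2 (a i j) \<and> Delta_summable (a i j))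
       \<and> has_fourier_series (series_limit a) a
       \<and> wnorm_pow p q (series_limit a) \<le> ereal c * coeff_sum p q a"
proof -
  define K where "K = max C 1"
  have K: "1 \<le> K" by (simp add: K_def)
  define \<sigma> where "\<sigma> = 1 - 1 / p"
  have s: "0 < \<sigma>" "\<sigma> < 1" using p by (auto simp: \<sigma>_def)
  have gmK: "\<exists>e. gm_sequence b K e" if "GMc1_const C b \<or> GMc2_const C b" for b
    using gm_sequence_of_GMc [OF that] unfolding K_def by blast
  show thesis
  proof (cases q)
    case (real r)
    with q have r: "1 \<le> r" by simp
    obtain c where c: "0 < c"
      "\<And>a. (\<forall>i<2. \<forall>j<2. \<exists>e. gm_sequence (a i j) K e) \<Longrightarrow>
        (\<forall>i<2. \<forall>j<2. Delta_summable (a i j)) \<Longrightarrow>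
        wnorm_pow p (ereal r) (series_limit a) \<le> ereal c * coeff_sum p (ereal r) a"
      using wnorm_pow_series_limit_le [OF p r K] by blast
    show thesis
    proof (rule that [OF c(1)])
      fix a
      assume gm: "GM_family C a" and fin: "coeff_sum p q a < \<infinity>"
      have tz: "tends_to_zero2 (a i j)" if "i < 2" "j < 2" for i j
        using gm that by (auto simp: GMc1_const_def GMc2_const_def)
      have "(\<Sum>i<2. \<Sum>j<2. coeff_powr_sum \<sigma> r (a i j)) \<noteq> \<infinity>"
        using fin by (auto simp: real coeff_sum_finite_exponent [OF p] \<sigma>_def)
      then have fin_ij: "coeff_powr_sum \<sigma> r (a i j) < \<infinity>" if "i < 2" "j < 2" for i j
        using that by (simp add: less_top)
      have "\<exists>B. \<forall>x. dscale x powr \<sigma> * dvar (a i j) x \<le> B" if ij: "i < 2" "j < 2" for i j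
      proof -
        obtain e where "gm_sequence (a i j) K e" using gmK gm ij by blast
        then interpret gm_sequence "a i j" K e .
        show ?thesis using dvar_bounded_of_coeff_sum [OF r s(1) fin_ij [OF ij]] by blast
      qed
      then obtain B where B: "\<And>i j x. i < 2 \<Longrightarrow> j < 2 \<Longrightarrow> dscale x powr \<sigma> * dvar (a i j) x \<le> B i j"
        by metis
      have int: "Delta_summable (a i j)" if "i < 2" "j < 2" for i j
        using B that by (intro integrable_Delta_pos [OF s]) auto
      have "has_fourier_series (series_limit a) a"
        using tz int B by (intro has_fourier_series_series_limit [OF p]) (auto simp: \<sigma>_def)
      moreover have "wnorm_pow p q (series_limit a) \<le> ereal c * coeff_sum p q a"
        unfolding real using gm gmK int by (intro c) blast+
      ultimately show "(\<forall>i<2. \<forall>j<2. tends_to_zero2 (a i j) \<and> Delta_summable (a i j))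
          \<and> has_fourier_series (series_limit a) a
          \<and> wnorm_pow p q (series_limit a) \<le> ereal c * coeff_sum p q a"
        using tz int by blast
    qed
  next
    case PInf
    obtain c where c: "0 < c"
      "\<And>a B z. (\<And>x. dscale x powr \<sigma> * dvar a x \<le> B) \<Longrightarrow> fst z \<noteq> 0 \<Longrightarrow> snd z \<noteq> 0 \<Longrightarrow>
        psum (\<lambda>x. dker2 x z * (4 * dscale x * dvar a x))
        \<le> ennreal (c * B * absprod z powr - (1 - \<sigma>))"
      using kernel_sum_le [OF s] by blast
    \<comment> \<open>\<open>K\<close> comes from the mixed variation of a block, the other factor
      from passing from the supremum of the coefficients to \<open>wcoeff\<close>.\<close>
    define K1 where "K1 = K * (4 powr \<sigma> * (1 + 2 * K))"
    have K1: "0 < K1" using K by (simp add: K1_def)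
    show thesis
    proof (rule that [of "c * K1"])
      show "0 < c * K1" using c K1 by simp
      fix a
      assume gm: "GM_family C a" and fin: "coeff_sum p q a < \<infinity>"
      have tz: "tends_to_zero2 (a i j)" if "i < 2" "j < 2" for i j
        using gm that by (auto simp: GMc1_const_def GMc2_const_def)
      define E where "E i j = (SUP mn\<in>{1..}\<times>{1..}. ereal ((real (fst mn) * real (snd mn)) powr (1 / conj_exp p) * \<bar>a i j (fst mn) (snd mn)\<bar>))" for i j
      have sumE: "coeff_sum p q a = (\<Sum>i<2. \<Sum>j<2. E i j)"
        unfolding coeff_sum_def E_def using PInf by simp
      have E_ge: "ereal ((real m * real n) powr \<sigma> * \<bar>a i j m n\<bar>) \<le> E i j" if "1 \<le> m" "1 \<le> n" for i j m n
        unfolding E_def using that conj_exp_inverse [OF p]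
        by (intro SUP_upper2 [of "(m, n)"]) (auto simp: \<sigma>_def)
      have E0: "0 \<le> E i j" for i j
      proof -
        have "0 \<le> ereal ((real 1 * real 1) powr \<sigma> * \<bar>a i j 1 1\<bar>)" by simp
        also have "\<dots> \<le> E i j" by (rule E_ge) auto
        finally show ?thesis .
      qed
      have "E i j \<noteq> \<infinity>" if "i < 2" "j < 2" for i j
        using fin that unfolding sumE by (auto simp: sum_Pinfty)
      then have "\<exists>F. E i j = ereal F" if "i < 2" "j < 2" for i j
        using E0 [of i j] that by (cases "E i j") auto
      then obtain F where F: "\<And>i j. i < 2 \<Longrightarrow> j < 2 \<Longrightarrow> E i j = ereal (F i j)"
        by metis
      have B: "dscale x powr \<sigma> * dvar (a i j) x \<le> K1 * F i j" if ij: "i < 2" "j < 2" for i j x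
      proof -
        obtain e where "gm_sequence (a i j) K e" using gmK gm ij by blast
        then interpret gm_sequence "a i j" K e .
        have "wcoeff \<sigma> (a i j) y \<le> 4 powr \<sigma> * (1 + 2 * K) * F i j" for y
          using E_ge [of _ _ i j] s F [OF ij] by (intro wcoeff_le_of_abs_le) auto
        then have "K * wcoeff \<sigma> (a i j) (fst x + e, snd x) \<le> K * (4 powr \<sigma> * (1 + 2 * K) * F i j)"
          using K by (intro mult_left_mono) auto
        with dvar_le_wcoeff [OF s(1), of x] show ?thesis by (simp add: K1_def mult.assoc)
      qed
      have int: "Delta_summable (a i j)" if "i < 2" "j < 2" for i j
        using B that by (intro integrable_Delta_pos [OF s]) auto
      have F0: "0 \<le> F i j" if "i < 2" "j < 2" for i j
        using E0 [of i j] F [OF that] by simp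
      have sumF: "coeff_sum p q a = ereal (\<Sum>i<2. \<Sum>j<2. F i j)"
        unfolding sumE using F by (simp add: sum_ereal [symmetric] del: sum_ereal)
      have "has_fourier_series (series_limit a) a"
        using tz int B by (intro has_fourier_series_series_limit [OF p]) (auto simp: \<sigma>_def)
      moreover have "wnorm_pow p q (series_limit a) \<le> ereal (c * K1) * coeff_sum p q a"
      proof -
        have "AE z in lborel. z \<in> square \<longrightarrow> ereal (absprod z powr (1 / p) * \<bar>series_limit a z\<bar>) \<le> ereal (c * K1 * (\<Sum>i<2. \<Sum>j<2. F i j))"
          using AE_coordinates_nonzero
        proof eventually_elim
          case (elim z)
          show ?case
          proof
            assume "z \<in> square"
            then have z: "\<bar>fst z\<bar> \<le> pi" "\<bar>snd z\<bar> \<le> pi" by (auto simp: square_def)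
            define u where "u = absprod z powr (1 / p)"
            have u: "0 < u" using elim by (simp add: u_def)
            have le: "u * \<bar>rect_limit i j (a i j) z\<bar> \<le> c * K1 * F i j" if ij: "i < 2" "j < 2" for i j
            proof -
              have "ennreal \<bar>rect_limit i j (a i j) z\<bar> \<le> psum (\<lambda>x. dker2 x z * (4 * dscale x * dvar (a i j) x))"
                using elim z ij by (intro rect_limit_le tz int) auto
              also have "\<dots> \<le> ennreal (c * (K1 * F i j) * absprod z powr - (1 - \<sigma>))"
                using elim ij by (intro c B) auto
              also have "absprod z powr - (1 - \<sigma>) = 1 / u"
                by (simp add: \<sigma>_def u_def powr_minus_divide)
              finally have "\<bar>rect_limit i j (a i j) z\<bar> \<le> c * (K1 * F i j) * (1 / u)"
                using c K1 F0 [OF ij] u by simp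
              then show ?thesis using u by (simp add: field_simps)
            qed
            have "u * \<bar>series_limit a z\<bar> \<le> u * (\<Sum>i<2. \<Sum>j<2. \<bar>rect_limit i j (a i j) z\<bar>)"
              unfolding series_limit_def using u
              by (intro mult_left_mono order_trans [OF sum_abs] sum_mono sum_abs) auto
            also have "\<dots> = (\<Sum>i<2. \<Sum>j<2. u * \<bar>rect_limit i j (a i j) z\<bar>)"
              by (simp add: sum_distrib_left)
            also have "\<dots> \<le> (\<Sum>i<2. \<Sum>j<2. c * K1 * F i j)"
              by (intro sum_mono le) auto
            also have "\<dots> = c * K1 * (\<Sum>i<2. \<Sum>j<2. F i j)"
              by (simp add: sum_distrib_left)
            finally show "ereal (absprod z powr (1 / p) * \<bar>series_limit a z\<bar>) \<le> ereal (c * K1 * (\<Sum>i<2. \<Sum>j<2. F i j))"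
              by (simp add: u_def)
          qed
        qed
        then have "AE z in restrict_space lborel square. ereal (absprod z powr (1 / p) * \<bar>series_limit a z\<bar>) \<le> ereal (c * K1 * (\<Sum>i<2. \<Sum>j<2. F i j))"
          by (subst AE_restrict_space_iff) auto
        then have "wnorm_pow p q (series_limit a) \<le> ereal (c * K1 * (\<Sum>i<2. \<Sum>j<2. F i j))"
          unfolding wnorm_pow_def if_P [OF PInf]
          by (intro esssup_I measurable_restrict_space1) measurable
        then show ?thesis by (simp add: sumF)
      qed
      ultimately show "(\<forall>i<2. \<forall>j<2. tends_to_zero2 (a i j) \<and> Delta_summable (a i j))
          \<and> has_fourier_series (series_limit a) a
          \<and> wnorm_pow p q (series_limit a) \<le> ereal (c * K1) * coeff_sum p q a"
        using tz int by blast
    qed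
  qed (use q in auto)
qed

text \<open>Norm and Fourier coefficients live on \<open>[-pi, pi]\<close> squared, of which
  \<open>(0, 2 * pi)\<close> squared meets only a quarter. Convergence wherever neither coordinate
  is a multiple of \<open>2 * pi\<close> ties \<open>f\<close> to the series on the whole square up
  to a null set. The witness is \<open>series_limit\<close>.\<close>

theorem theorem1:
  fixes p :: real and q :: ereal
  assumes "1 < p" and "1 \<le> q"
  shows
    "(\<forall>C. \<exists>c>0. \<forall>a f.
        (\<forall>i<2. \<forall>j<2. GMc1_const C (a i j) \<or> GMc2_const C (a i j)) \<longrightarrow>
        has_fourier_series f a \<longrightarrow>
        wnorm_pow p q f \<ge> ereal c * coeff_sum p q a)
   \<and> (\<forall>C. \<exists>c>0. \<forall>a.
        (\<forall>i<2. \<forall>j<2. GMc1_const C (a i j) \<or> GMc2_const C (a i j)) \<longrightarrow>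
        coeff_sum p q a < \<infinity> \<longrightarrow>
        (\<exists>f. (\<forall>x\<in>{0<..<2*pi}. \<forall>y\<in>{0<..<2*pi}.
                ((\<lambda>(M, N). partial_sum a M N x y) \<longlongrightarrow> f (x, y)) (sequentially \<times>\<^sub>F sequentially))
           \<and> (\<forall>x y. (\<forall>k::int. x \<noteq> 2*pi*k) \<longrightarrow> (\<forall>k::int. y \<noteq> 2*pi*k) \<longrightarrow>
                ((\<lambda>(M, N). partial_sum a M N x y) \<longlongrightarrow> f (x, y)) (sequentially \<times>\<^sub>F sequentially))
           \<and> has_fourier_series f a
           \<and> wnorm_pow p q f \<le> ereal c * coeff_sum p q a))"
proof (intro conjI allI)
  fix C :: real
  show "\<exists>c>0. \<forall>a f. GM_family C a \<longrightarrow> has_fourier_series f a \<longrightarrow> wnorm_pow p q f \<ge> ereal c * coeff_sum p q a"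
    by (rule coefficients_lower_bound [OF assms, of C]) blast
next
  fix C :: real
  obtain c where c: "0 < c"
    "\<And>a. GM_family C a \<Longrightarrow> coeff_sum p q a < \<infinity> \<Longrightarrow>
       (\<forall>i<2. \<forall>j<2. tends_to_zero2 (a i j) \<and> Delta_summable (a i j))
       \<and> has_fourier_series (series_limit a) a
       \<and> wnorm_pow p q (series_limit a) \<le> ereal c * coeff_sum p q a"
    by (rule series_upper_bound [OF assms, of C]) (rule that)
  have lim: "((\<lambda>(M, N). partial_sum a M N x y) \<longlongrightarrow> series_limit a (x, y)) (sequentially \<times>\<^sub>F sequentially)"
    if "GM_family C a" "coeff_sum p q a < \<infinity>" "\<forall>k::int. x \<noteq> 2 * pi * k" "\<forall>k::int. y \<noteq> 2 * pi * k" for a x y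
    using c(2) [OF that(1,2)] that(3,4) by (intro partial_sum_tendsto sin_half_nonzero_iff) auto
  have no_period: "\<forall>k::int. x \<noteq> 2 * pi * k" if "x \<in> {0<..<2 * pi}" for x
  proof (intro allI notI)
    fix k :: int assume k: "x = 2 * pi * k"
    with that have "0 < 2 * pi * real_of_int k" "2 * pi * real_of_int k < 2 * pi * 1" by auto
    then have "0 < real_of_int k" "real_of_int k < 1"
      by (auto simp: zero_less_mult_iff)
    then have "0 < k" "k < 1" by simp_all
    then show False by simp
  qed
  show "\<exists>c>0. \<forall>a. GM_family C a \<longrightarrow> coeff_sum p q a < \<infinity> \<longrightarrow>
        (\<exists>f. (\<forall>x\<in>{0<..<2*pi}. \<forall>y\<in>{0<..<2*pi}.
                ((\<lambda>(M, N). partial_sum a M N x y) \<longlongrightarrow> f (x, y)) (sequentially \<times>\<^sub>F sequentially))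
           \<and> (\<forall>x y. (\<forall>k::int. x \<noteq> 2*pi*k) \<longrightarrow> (\<forall>k::int. y \<noteq> 2*pi*k) \<longrightarrow>
                ((\<lambda>(M, N). partial_sum a M N x y) \<longlongrightarrow> f (x, y)) (sequentially \<times>\<^sub>F sequentially))
           \<and> has_fourier_series f a
           \<and> wnorm_pow p q f \<le> ereal c * coeff_sum p q a)"
    using lim no_period c(2)
    by (intro exI [of _ c] conjI allI impI c(1) exI [of _ "series_limit _"]) auto
qed

end
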